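(* Let $\Omega=(a,b)$, $T_0>0$, and for $\varepsilon\in(0,1]$ let $\Phi(t,x)$ be the exact solution, up to the time $t=T_0/\varepsilon$, of the one-dimensional Dirac equation $$i\partial_t\Phi=(-i\sigma_1\partial_x+\sigma_3)\Phi+\varepsilon\left(V(t,x)I_2-A_1(t,x)\sigma_1\right)\Phi,\quad x\in\Omega,\ t>0,$$ with periodic boundary conditions $\Phi(t,a)=\Phi(t,b)$, $\partial_x\Phi(t,a)=\partial_x\Phi(t,b)$ for $t\ge0$, and initial data $\Phi(0,x)=\Phi_0(x)$ for $x\in\overline\Omega$. Assume that: (A) there exists an integer $m_0\ge2$ such that $\|\Phi\|_{L^\infty([0,T_0/\varepsilon];(H^{m_0}_p)^2)}\lesssim1$, $\|\partial_t\Phi\|_{L^\infty([0,T_0/\varepsilon];(L^2)^2)}\lesssim1$, $\|\partial_{tt}\Phi\|_{L^\infty([0,T_0/\varepsilon];(L^2)^2)}\lesssim1$; (B) $\|V\|_{W^{2,\infty}([0,T_0/\varepsilon];L^\infty)}+\|A_1\|_{W^{2,\infty}([0,T_0/\varepsilon];L^\infty)}\lesssim1$. Let $\Phi^n_N(x)$ be the approximation obtained from the symmetric exponential wave integrator Fourier spectral (sEWI-FS) method (defined in the context) with mesh size $h$ and time step $\tau$. Then there exists $\tau_0>0$ sufficiently small and independent of $\varepsilon$ such that, for any $0<\varepsilon\le1$, under the stability condition $$0<\tau<\min\left\{\frac{h\pi}{3\sqrt{h^2+\pi^2}},\ \frac{2-\sqrt3}{2(|V^0|+|A_1^0|)}\right\},$$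 when $0<\tau\le\tau_0$, the following error estimate holds: $$\left\|\Phi(t_n,x)-\Phi^n_N(x)\right\|_{L^2}\le C_{T_0}\left(h^{m_0}+\tau^2\right),\qquad 0\le n\le\frac{T_0/\varepsilon}{\tau},$$ where $C_{T_0}$ is a constant depending on $T_0$ and independent of $h$, $\tau$ and $\varepsilon$.
   Context: $\Phi=\Phi(t,x)\in\mathbb{C}^2$; $V(t,x)$ and $A_1(t,x)$ are the real-valued electric and magnetic potentials; $I_2$ is the $2\times2$ identity matrix, $\sigma_1=\begin{pmatrix}0&1\\1&0\end{pmatrix}$, $\sigma_3=\begin{pmatrix}1&0\\0&-1\end{pmatrix}$. The initial data satisfy $\Phi_0(a)=\Phi_0(b)$, $\Phi_0'(a)=\Phi_0'(b)$. The space $H^k_p(\Omega)=\{u\in H^k(\Omega):\partial_x^lu(a)=\partial_x^lu(b),\ l=0,\dots,k-1\}$. The notation $A\lesssim B$ means $|A|\le CB$ with a generic constant $C>0$ independent of $h$, $\tau$ and $\varepsilon$. Constants in the stability condition: $V^0$ and $A_1^0$ are the two real constants of the linear (von Neumann) stability analysis of the scheme, in which the potentials are assumed constant, $V(t,x)\equiv V^0$ and $A_1(t,x)\equiv A_1^0$. The stability condition is stated in terms of these constants; no separate definition of $V^0$, $A_1^0$ is given for variable potentials. Discretization: $N$ is an even positive integer, $h=(b-a)/N$, $\tau>0$, $t_n=n\tau$, $\mathcal{T}_N=\{-N/2,-N/2+1,\dots,N/2-1\}$, $\mu_l=\frac{2\pi l}{b-a}$. Let $Z_N=\mathrm{span}\{e^{i\mu_l(x-a)}:l\in\mathcal{T}_N\}$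 and $Y_N=Z_N\times Z_N$. For $U\in(L^2(\Omega))^2$, $\widehat{U}_l=\frac1{b-a}\int_a^bU(x)e^{-i\mu_l(x-a)}dx$ and $(P_NU)(x)=\sum_{l\in\mathcal{T}_N}\widehat{U}_le^{i\mu_l(x-a)}$. Let $\Gamma_l=\mu_l\sigma_1+\sigma_3$, a Hermitian matrix with eigenvalues $\pm\delta_l$, $\delta_l=\sqrt{1+\mu_l^2}$; write $\Gamma_l=Q_l\,\mathrm{diag}(\delta_l,-\delta_l)\,Q_l^*$ with $Q_l$ unitary, so that $\sin(\tau\Gamma_l)=Q_l\,\mathrm{diag}(\sin(\tau\delta_l),-\sin(\tau\delta_l))\,Q_l^*$. Let $G(t)=G(t,x)=V(t,x)I_2-\sigma_1A_1(t,x)$. sEWI-FS method: $\Phi_N^0=P_N\Phi_0$, and for $n\ge0$, $\Phi^{n+1}_N(x)=\sum_{l\in\mathcal{T}_N}\widehat{(\Phi^{n+1}_N)}_le^{i\mu_l(x-a)}\in Y_N$, where for $l\in\mathcal{T}_N$ $$\widehat{(\Phi^{1}_N)}_l=e^{-i\tau\Gamma_l}\widehat{(\Phi^0_N)}_l-\varepsilon\Gamma_l^{-1}\left[I_2-e^{-i\tau\Gamma_l}\right]\widehat{(G(t_0)\Phi^0_N)}_l,$$ and for $n\ge1$ $$\widehat{(\Phi^{n+1}_N)}_l=\widehat{(\Phi^{n-1}_N)}_l-2i\sin(\tau\Gamma_l)\widehat{(\Phi^n_N)}_l-i\frac{2\varepsilon}{\delta_l}\sin(\tau\delta_l)\widehat{(G(t_n)\Phi^n_N)}_l.$$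 *)

theory Defs
  imports "HOL-Analysis.Analysis" "HOL-Probability.Essential_Supremum"
begin

section \<open>Function spaces on \<open>\<Omega> = (a, b)\<close> and on \<open>[0, T] \<times> \<Omega>\<close>\<close>

text \<open>
  Elements of Lebesgue and Sobolev spaces are represented by Borel functions.  Norms take values
  in \<open>ereal\<close>; the norm is \<open>\<infinity>\<close> when the function is not in the space (\<open>esssup\<close> is \<open>\<infinity>\<close> for
  non-measurable functions).
\<close>

definition L2_norm :: "real \<Rightarrow> real \<Rightarrow> (real \<Rightarrow> 'v::{banach, second_countable_topology}) \<Rightarrow> ereal" where
  "L2_norm a b u =
     (if set_borel_measurable lborel {a<..<b} u \<and> set_integrable lborel {a<..<b} (\<lambda>x. (norm (u x))\<^sup>2)
      then ereal (sqrt (LINT x:{a<..<b}|lborel. (norm (u x))\<^sup>2)) else \<infinity>)"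

definition Linf_norm :: "real \<Rightarrow> real \<Rightarrow> (real \<Rightarrow> 'v::{banach, second_countable_topology}) \<Rightarrow> ereal" where
  "Linf_norm a b u = esssup (restrict_space lborel {a<..<b}) (\<lambda>x. ereal (norm (u x)))"

text \<open>The norm of \<open>L\<^sup>\<infinity>([0, T]; X)\<close>, where \<open>X\<close> is given by its norm.\<close>

definition Linf_time :: "real \<Rightarrow> ((real \<Rightarrow> 'v) \<Rightarrow> ereal) \<Rightarrow> (real \<Rightarrow> real \<Rightarrow> 'v) \<Rightarrow> ereal" where
  "Linf_time T X u = esssup (restrict_space lborel {0..T}) (\<lambda>t. X (u t))"

text \<open>Weak derivatives are tested against \<open>C\<^sup>1\<close> functions with compact support in the open interval
  (as in Brezis' book); this gives the same derivatives as smooth test functions.\<close>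

definition test_function :: "real \<Rightarrow> real \<Rightarrow> (real \<Rightarrow> real) \<Rightarrow> bool" where
  "test_function \<alpha> \<beta> \<phi> \<longleftrightarrow>
     (\<forall>x. (\<phi> has_real_derivative deriv \<phi> x) (at x)) \<and> continuous_on UNIV (deriv \<phi>) \<and>
     (\<exists>c d. \<alpha> < c \<and> d < \<beta> \<and> (\<forall>x. x \<notin> {c..d} \<longrightarrow> \<phi> x = 0))"

definition has_weak_deriv ::
  "real \<Rightarrow> real \<Rightarrow> (real \<Rightarrow> 'v::{banach, second_countable_topology}) \<Rightarrow> (real \<Rightarrow> 'v) \<Rightarrow> bool" where
  "has_weak_deriv a b u v \<longleftrightarrow>
     set_integrable lborel {a<..<b} u \<and> set_integrable lborel {a<..<b} v \<and>
     (\<forall>\<phi>. test_function a b \<phi> \<longrightarrow>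
        (LINT x:{a<..<b}|lborel. deriv \<phi> x *\<^sub>R u x) = - (LINT x:{a<..<b}|lborel. \<phi> x *\<^sub>R v x))"

text \<open>\<open>u(a) = u(b)\<close>, where the boundary values are those of the continuous representative on \<open>[a, b]\<close>.\<close>

definition periodic_trace ::
  "real \<Rightarrow> real \<Rightarrow> (real \<Rightarrow> 'v::{banach, second_countable_topology}) \<Rightarrow> bool" where
  "periodic_trace a b u \<longleftrightarrow>
     (\<exists>w. continuous_on {a..b} w \<and> (AE x\<in>{a<..<b} in lborel. u x = w x) \<and> w a = w b)"

text \<open>\<open>D l\<close> is the \<open>l\<close>-th weak derivative of \<open>u \<in> H\<^sup>k\<^sub>p(\<Omega>)\<close>.\<close>

definition Hp_derivs :: "real \<Rightarrow> real \<Rightarrow> nat \<Rightarrow> (real \<Rightarrow> 'v::{banach, second_countable_topology})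
    \<Rightarrow> (nat \<Rightarrow> real \<Rightarrow> 'v) \<Rightarrow> bool" where
  "Hp_derivs a b k u D \<longleftrightarrow>
     D 0 = u \<and> (\<forall>l\<le>k. L2_norm a b (D l) < \<infinity>) \<and>
     (\<forall>l<k. has_weak_deriv a b (D l) (D (Suc l)) \<and> periodic_trace a b (D l))"

text \<open>Weak derivatives are unique up to null sets, so the infimum below is over a single value,
  or over the empty set (with value \<open>\<infinity>\<close>) if \<open>u \<notin> H\<^sup>k\<^sub>p(\<Omega>)\<close>.\<close>

definition Hp_norm :: "real \<Rightarrow> real \<Rightarrow> nat \<Rightarrow> (real \<Rightarrow> 'v::{banach, second_countable_topology}) \<Rightarrow> ereal" where
  "Hp_norm a b k u =
     (INF D\<in>{D. Hp_derivs a b k u D}.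
        ereal (sqrt (\<Sum>l\<le>k. LINT x:{a<..<b}|lborel. (norm (D l x))\<^sup>2)))"

text \<open>\<open>u \<in> W\<^sup>1\<^sup>,\<^sup>1([0, T]; L\<^sup>1(\<Omega>))\<close> with weak (Bochner) time derivative \<open>v\<close>, where \<open>u\<close> is the
  representative that is continuous from \<open>[0, T]\<close> to \<open>L\<^sup>1(\<Omega>)\<close>.  This makes \<open>u(t, \<cdot>)\<close> meaningful
  (up to null sets of \<open>\<Omega>\<close>) for every single \<open>t\<close>, e.g. at the grid points \<open>t\<^sub>n\<close>.  For the spaces
  \<open>W\<^sup>1\<^sup>,\<^sup>\<infinity>([0, T]; X)\<close> with \<open>X = L\<^sup>2\<close> or \<open>X = L\<^sup>\<infinity>\<close>, bounds on the norms are to be added.\<close>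

definition has_time_deriv :: "real \<Rightarrow> real \<Rightarrow> real
    \<Rightarrow> (real \<Rightarrow> real \<Rightarrow> 'v::{banach, second_countable_topology}) \<Rightarrow> (real \<Rightarrow> real \<Rightarrow> 'v) \<Rightarrow> bool" where
  "has_time_deriv T a b u v \<longleftrightarrow>
     set_integrable lborel ({0<..<T} \<times> {a<..<b}) (\<lambda>(t, x). u t x) \<and>
     set_integrable lborel ({0<..<T} \<times> {a<..<b}) (\<lambda>(t, x). v t x) \<and>
     (\<forall>\<phi>. test_function 0 T \<phi> \<longrightarrow>
        (AE x\<in>{a<..<b} in lborel.
           (LINT t:{0<..<T}|lborel. deriv \<phi> t *\<^sub>R u t x) = - (LINT t:{0<..<T}|lborel. \<phi> t *\<^sub>R v t x))) \<and>
     (\<forall>t\<in>{0..T}. set_integrable lborel {a<..<b} (u t) \<and>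
        ((\<lambda>s. LINT x:{a<..<b}|lborel. norm (u s x - u t x)) \<longlongrightarrow> 0) (at t within {0..T}))"

text \<open>The norm of \<open>W\<^sup>2\<^sup>,\<^sup>\<infinity>([0, T]; L\<^sup>\<infinity>(\<Omega>))\<close>; for the infimum see \<open>Hp_norm\<close>.\<close>

definition W2inf_norm :: "real \<Rightarrow> real \<Rightarrow> real \<Rightarrow> (real \<Rightarrow> real \<Rightarrow> real) \<Rightarrow> ereal" where
  "W2inf_norm T a b V =
     (INF (V', V'')\<in>{(V', V''). has_time_deriv T a b V V' \<and> has_time_deriv T a b V' V''}.
        max (Linf_time T (Linf_norm a b) V)
          (max (Linf_time T (Linf_norm a b) V') (Linf_time T (Linf_norm a b) V'')))"

section \<open>The Dirac equation\<close>

definition sigma1 :: "complex^2^2" where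
  "sigma1 = vector [vector [0, 1], vector [1, 0]]"

definition sigma3 :: "complex^2^2" where
  "sigma3 = vector [vector [1, 0], vector [0, -1]]"

definition G_mat :: "(real \<Rightarrow> real \<Rightarrow> real) \<Rightarrow> (real \<Rightarrow> real \<Rightarrow> real) \<Rightarrow> real \<Rightarrow> real \<Rightarrow> complex^2^2" where
  "G_mat V A1 t x = V t x *\<^sub>R mat 1 - A1 t x *\<^sub>R sigma1"

text \<open>\<open>u(a) = u(b)\<close> and \<open>u'(a) = u'(b)\<close>.\<close>

definition periodic_bc :: "real \<Rightarrow> real \<Rightarrow> (real \<Rightarrow> complex^2) \<Rightarrow> bool" where
  "periodic_bc a b u \<longleftrightarrow>
     (\<exists>w. has_weak_deriv a b u w \<and> periodic_trace a b u \<and> periodic_trace a b w)"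

text \<open>Strong solution on \<open>[0, T]\<close>, with time derivative \<open>\<Phi>t\<close>: the equation holds almost everywhere.\<close>

definition dirac_solution :: "real \<Rightarrow> real \<Rightarrow> real \<Rightarrow> real
    \<Rightarrow> (real \<Rightarrow> real \<Rightarrow> real) \<Rightarrow> (real \<Rightarrow> real \<Rightarrow> real) \<Rightarrow> (real \<Rightarrow> complex^2)
    \<Rightarrow> (real \<Rightarrow> real \<Rightarrow> complex^2) \<Rightarrow> (real \<Rightarrow> real \<Rightarrow> complex^2) \<Rightarrow> bool" where
  "dirac_solution T a b \<epsilon> V A1 \<Phi>0 \<Phi> \<Phi>t \<longleftrightarrow>
     has_time_deriv T a b \<Phi> \<Phi>t \<and>
     (AE t\<in>{0<..<T} in lborel. \<exists>\<Phi>x. has_weak_deriv a b (\<Phi> t) \<Phi>x \<and>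
        (AE x\<in>{a<..<b} in lborel.
           \<i> *s \<Phi>t t x = - \<i> *s (sigma1 *v \<Phi>x x) + sigma3 *v \<Phi> t x
                         + \<epsilon> *\<^sub>R (G_mat V A1 t x *v \<Phi> t x))) \<and>
     (\<forall>t\<in>{0..T}. periodic_bc a b (\<Phi> t)) \<and>
     (AE x\<in>{a<..<b} in lborel. \<Phi> 0 x = \<Phi>0 x)"

section \<open>The sEWI-FS method\<close>

definition T_idx :: "nat \<Rightarrow> int set" where
  "T_idx N = {- int (N div 2)..<int (N div 2)}"

definition freq :: "real \<Rightarrow> real \<Rightarrow> int \<Rightarrow> real" where
  "freq a b l = 2 * pi * of_int l / (b - a)"

definition fourier_coeff :: "real \<Rightarrow> real \<Rightarrow> (real \<Rightarrow> complex^2) \<Rightarrow> int \<Rightarrow> complex^2" where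
  "fourier_coeff a b U l =
     (1 / (b - a)) *\<^sub>R (LINT x:{a<..<b}|lborel. cis (- freq a b l * (x - a)) *s U x)"

text \<open>The element of \<open>Y\<^sub>N\<close> with Fourier coefficients \<open>c l\<close>, \<open>l \<in> \<T>\<^sub>N\<close>.\<close>

definition trig_poly :: "real \<Rightarrow> real \<Rightarrow> nat \<Rightarrow> (int \<Rightarrow> complex^2) \<Rightarrow> real \<Rightarrow> complex^2" where
  "trig_poly a b N c x = (\<Sum>l\<in>T_idx N. cis (freq a b l * (x - a)) *s c l)"

definition adj :: "complex^2^2 \<Rightarrow> complex^2^2" where
  "adj Q = (\<chi> i j. cnj (Q $ j $ i))"

definition diag2 :: "complex \<Rightarrow> complex \<Rightarrow> complex^2^2" where
  "diag2 p q = vector [vector [p, 0], vector [0, q]]"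

definition Gamma_mat :: "real \<Rightarrow> complex^2^2" where
  "Gamma_mat \<mu> = \<mu> *\<^sub>R sigma1 + sigma3"

definition delta :: "real \<Rightarrow> real" where
  "delta \<mu> = sqrt (1 + \<mu>\<^sup>2)"

definition Q_mat :: "real \<Rightarrow> complex^2^2" where
  "Q_mat \<mu> = (SOME Q. Q ** adj Q = mat 1 \<and> adj Q ** Q = mat 1 \<and>
      Gamma_mat \<mu> = Q ** diag2 (of_real (delta \<mu>)) (of_real (- delta \<mu>)) ** adj Q)"

text \<open>\<open>f(\<Gamma>)\<close> for a scalar function \<open>f\<close>, through the spectral decomposition
  (independent of the choice of \<open>Q\<close>).\<close>

definition fun_Gamma :: "(real \<Rightarrow> complex) \<Rightarrow> real \<Rightarrow> complex^2^2" where
  "fun_Gamma f \<mu> = Q_mat \<mu> ** diag2 (f (delta \<mu>)) (f (- delta \<mu>)) ** adj (Q_mat \<mu>)"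

definition exp_Gamma :: "real \<Rightarrow> real \<Rightarrow> complex^2^2" where
  "exp_Gamma \<tau> \<mu> = fun_Gamma (\<lambda>s. exp (- \<i> * of_real (\<tau> * s))) \<mu>"

definition sin_Gamma :: "real \<Rightarrow> real \<Rightarrow> complex^2^2" where
  "sin_Gamma \<tau> \<mu> = fun_Gamma (\<lambda>s. of_real (sin (\<tau> * s))) \<mu>"

fun sEWI_FS :: "real \<Rightarrow> real \<Rightarrow> nat \<Rightarrow> real \<Rightarrow> real \<Rightarrow> (real \<Rightarrow> real \<Rightarrow> real) \<Rightarrow> (real \<Rightarrow> real \<Rightarrow> real)
    \<Rightarrow> (real \<Rightarrow> complex^2) \<Rightarrow> nat \<Rightarrow> real \<Rightarrow> complex^2" where
  "sEWI_FS a b N \<tau> \<epsilon> V A1 \<Phi>0 0 = trig_poly a b N (fourier_coeff a b \<Phi>0)"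
| "sEWI_FS a b N \<tau> \<epsilon> V A1 \<Phi>0 (Suc 0) =
     (let U = sEWI_FS a b N \<tau> \<epsilon> V A1 \<Phi>0 0 in
      trig_poly a b N (\<lambda>l. let \<mu> = freq a b l in
        exp_Gamma \<tau> \<mu> *v fourier_coeff a b U l
        - \<epsilon> *\<^sub>R ((matrix_inv (Gamma_mat \<mu>) ** (mat 1 - exp_Gamma \<tau> \<mu>))
                 *v fourier_coeff a b (\<lambda>x. G_mat V A1 0 x *v U x) l)))"
| "sEWI_FS a b N \<tau> \<epsilon> V A1 \<Phi>0 (Suc (Suc n)) =
     (let U = sEWI_FS a b N \<tau> \<epsilon> V A1 \<Phi>0 n; W = sEWI_FS a b N \<tau> \<epsilon> V A1 \<Phi>0 (Suc n) in
      trig_poly a b N (\<lambda>l. let \<mu> = freq a b l in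
        fourier_coeff a b U l
        - (2 * \<i>) *s (sin_Gamma \<tau> \<mu> *v fourier_coeff a b W l)
        - (\<i> * of_real (2 * \<epsilon> / delta \<mu> * sin (\<tau> * delta \<mu>)))
            *s fourier_coeff a b (\<lambda>x. G_mat V A1 (real (Suc n) * \<tau>) x *v W x) l))"

text \<open>The division is in \<open>ereal\<close>, so that the second bound is \<open>\<infinity>\<close> (no restriction) if
  \<open>V0 = A0 = 0\<close>.\<close>

definition stability_bound :: "real \<Rightarrow> real \<Rightarrow> real \<Rightarrow> ereal" where
  "stability_bound h V0 A0 =
     min (ereal (h * pi / (3 * sqrt (h\<^sup>2 + pi\<^sup>2))))
         (ereal (2 - sqrt 3) / ereal (2 * (\<bar>V0\<bar> + \<bar>A0\<bar>)))"

end

theory Submission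
  imports Defs
begin

text \<open>In Fourier space the equation decouples, up to the forcing \<open>F = G \<Phi>\<close>, into scalar equations
  \<open>y' = - \<i> (\<lambda> y + \<epsilon> f)\<close>: one for every frequency and every eigenvector of \<open>\<Gamma>\<^sub>l\<close>, with
  \<open>\<lambda> = \<plusminus> \<delta>\<^sub>l\<close> and \<open>f\<close> the coefficient of \<open>F\<close>.  Duhamel's formula from \<open>t\<^sub>n\<close> to \<open>t\<^sub>n \<plusminus> \<tau>\<close>
  reproduces the recursion of the scheme up to a remainder \<open>- \<i> \<epsilon> (C - \<i> S)\<close> with
  \<open>C = \<integral> cos ((\<tau> - s) \<lambda>) (f (t\<^sub>n + s) + f (t\<^sub>n - s) - 2 f (t\<^sub>n)) ds\<close> and
  \<open>S = \<integral> sin ((\<tau> - s) \<lambda>) (f (t\<^sub>n + s) - f (t\<^sub>n - s)) ds\<close>, integrated over \<open>[0, \<tau>]\<close>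
  (\<open>two_step_identity\<close>).

  The term \<open>C\<close> contains a second difference in time and is \<open>O(\<tau>\<^sup>3)\<close>, as a second order method requires.
  The term \<open>S\<close> is only \<open>O(\<tau>\<^sup>2)\<close>: another power of \<open>\<tau>\<close> could be taken from the sine, but at the price of a
  factor \<open>\<lambda>\<close>, that is of a space derivative of \<open>F\<close>, and the potentials have no regularity in space.  Summed
  over \<open>T\<^sub>0 / (\<epsilon> \<tau>)\<close> steps with the factor \<open>\<epsilon>\<close>, a bound \<open>O(\<tau>\<^sup>2)\<close> gives first order only.  The missing power
  comes from cancellation between time steps.  The recursion has the characteristic roots
  \<open>E = e\<^bsup>- \<i> \<tau> \<lambda>\<^esup>\<close> and \<open>- E\<^bsup>-1\<^esup>\<close>; if \<open>U\<close> is one of them, then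
  \<open>\<bar>sin ((\<tau> - s) \<lambda>)\<bar> \<le> \<bar>1 - U\<bar>\<close>, hence \<open>S = (1 - U) Y\<close> with \<open>Y = O(\<tau>\<^sup>2)\<close>, and \<open>Y\<close> changes by
  \<open>O(\<tau>\<^sup>3)\<close> from one step to the next.  Summation by parts (\<open>isometric_recursion_bound\<close>) then turns the sum of
  the terms \<open>U\<^bsup>n - k\<^esup> (1 - U) Y\<^sub>k\<close> into a sum of increments of \<open>Y\<close>.

  The stability condition gives \<open>\<tau> \<delta>\<^sub>l \<le> \<pi> / 3\<close>.  Hence \<open>E + E\<^bsup>-1\<^esup> = 2 cos (\<tau> \<lambda>) \<ge> 1\<close>, the two roots stay
  apart, and the error is a bounded combination of two quantities that obey isometric one-step recursions.  Every
  step feeds back at most \<open>O(\<epsilon> \<tau>)\<close> times the error, so that Gronwall's lemma over \<open>T\<^sub>0 / (\<epsilon> \<tau>)\<close> steps costs a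
  constant which depends on \<open>T\<^sub>0\<close> but not on \<open>\<epsilon>\<close> (\<open>two_step_error_bound\<close>).

  Regularity in time is used through first and mixed second differences only.  They are bounded for \<open>V\<close> and
  \<open>A\<^sub>1\<close> in \<open>L\<^sup>\<infinity>\<close> and for \<open>\<Phi>\<close> in \<open>L\<^sup>2\<close> (\<open>diffs_le_of_derivs\<close>), and they obey a discrete Leibniz rule, which
  transfers the bounds to \<open>F\<close> in \<open>L\<^sup>2\<close> (\<open>diffs_le_product\<close>).  The link to weak derivatives is a fundamental
  theorem of calculus (\<open>weak_FTC\<close>), which also gives the Fourier coefficients of weak space derivatives.

  The term \<open>h\<^bsup>m\<^sub>0\<^esup>\<close> is the error of the Fourier projection (\<open>projection_error\<close>), based on Pythagoras' theorem
  for trigonometric polynomials and on their density.\<close>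

section \<open>A fundamental theorem of calculus for weak derivatives\<close>

text \<open>A \<open>C\<^sup>1\<close> step from \<open>0\<close> (for \<open>y \<le> 0\<close>) to \<open>1\<close> (for \<open>y \<ge> 1\<close>), written as a second
  difference of \<open>(max 0 y)\<^sup>2\<close>; its derivative is a tent on \<open>[0, 1]\<close>.\<close>

definition ramp :: "real \<Rightarrow> real" where
  "ramp y = 2 * ((max 0 y)\<^sup>2 - 2 * (max 0 (y - 1/2))\<^sup>2 + (max 0 (y - 1))\<^sup>2)"

definition ramp' :: "real \<Rightarrow> real" where
  "ramp' y = 4 * (max 0 y - 2 * max 0 (y - 1/2) + max 0 (y - 1))"

lemma has_real_derivative_max0_square:
  "((\<lambda>y. (max 0 (y::real))\<^sup>2) has_real_derivative 2 * max 0 x) (at x)"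
proof -
  consider "x < 0" | "x = 0" | "x > 0" by linarith
  then show ?thesis
  proof cases
    case 1
    have "((\<lambda>y. 0::real) has_real_derivative 0) (at x)" by simp
    then have "((\<lambda>y. (max 0 (y::real))\<^sup>2) has_real_derivative 0) (at x)"
      by (rule has_field_derivative_transform_within_open[where S="{..<0}"]) (use 1 in auto)
    then show ?thesis using 1 by simp
  next
    case 3
    have "((\<lambda>y. y\<^sup>2::real) has_real_derivative 2 * x) (at x)"
      by (auto intro!: derivative_eq_intros)
    then have "((\<lambda>y. (max 0 (y::real))\<^sup>2) has_real_derivative 2 * x) (at x)"
      by (rule has_field_derivative_transform_within_open[where S="{0<..}"]) (use 3 in auto)
    then show ?thesis using 3 by simp
  next
    case 2
    have "((\<lambda>y. max 0 (y::real)) \<longlongrightarrow> max 0 0) (at 0)"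
      by (intro tendsto_intros)
    moreover have "(max 0 y)\<^sup>2 / y = max 0 y" if "y \<noteq> 0" for y :: real
      using that by (auto simp: max_def power2_eq_square)
    ultimately have "((\<lambda>y. (max 0 (y::real))\<^sup>2 / y) \<longlongrightarrow> 0) (at 0)"
      by (subst Lim_cong_within[where g="\<lambda>y. max 0 y"]) auto
    then show ?thesis unfolding 2 has_field_derivative_iff by simp
  qed
qed

lemma ramp_deriv: "(ramp has_real_derivative ramp' y) (at y)"
  unfolding ramp_def ramp'_def
  by (rule derivative_eq_intros DERIV_chain2[OF has_real_derivative_max0_square] refl | simp)+

lemma ramp_simps:
  "y \<le> 0 \<Longrightarrow> ramp y = 0" "y \<ge> 1 \<Longrightarrow> ramp y = 1"
  "y \<le> 0 \<Longrightarrow> ramp' y = 0" "y \<ge> 1 \<Longrightarrow> ramp' y = 0" "ramp' y \<ge> 0"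
  by (auto simp: ramp_def ramp'_def max_def power2_eq_square algebra_simps)

lemma continuous_on_ramp': "continuous_on S ramp'"
  unfolding ramp'_def by (intro continuous_intros)

lemma ramp_bounds: "0 \<le> ramp y" "ramp y \<le> 1"
proof -
  have mono: "ramp x \<le> ramp z" if "x \<le> z" for x z
    using that by (rule DERIV_nonneg_imp_nondecreasing) (use ramp_deriv ramp_simps(5) in blast)
  show "0 \<le> ramp y" using mono[of "min y 0" y] by (simp add: ramp_simps(1))
  show "ramp y \<le> 1" using mono[of y "max y 1"] by (simp add: ramp_simps(2))
qed

text \<open>For \<open>4 \<eta> < \<beta> - \<alpha>\<close> this function vanishes within distance \<open>\<eta>\<close> of the end points and
  equals \<open>1\<close> at distance at least \<open>2 \<eta>\<close> from them.  A sum of two ramps, instead of their product, makes the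
  derivative a difference of two bumps of mass one, one near each end point.\<close>

definition plateau :: "real \<Rightarrow> real \<Rightarrow> real \<Rightarrow> real \<Rightarrow> real" where
  "plateau \<alpha> \<beta> \<eta> x = ramp ((x - \<alpha>) / \<eta> - 1) + ramp ((\<beta> - x) / \<eta> - 1) - 1"

lemma ramp_affine_deriv:
  "((\<lambda>x. ramp ((x - \<alpha>) / \<eta> - 1)) has_real_derivative ramp' ((x - \<alpha>) / \<eta> - 1) / \<eta>) (at x)"
  "((\<lambda>x. - ramp ((\<beta> - x) / \<eta> - 1)) has_real_derivative ramp' ((\<beta> - x) / \<eta> - 1) / \<eta>) (at x)"
proof -
  have "((\<lambda>x. ramp ((x - \<alpha>) / \<eta> - 1)) has_real_derivative ramp' ((x - \<alpha>) / \<eta> - 1) * (1 / \<eta>)) (at x)"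
    by (rule DERIV_chain2[OF ramp_deriv]) (auto intro!: derivative_eq_intros simp: divide_inverse)
  then show "((\<lambda>x. ramp ((x - \<alpha>) / \<eta> - 1)) has_real_derivative ramp' ((x - \<alpha>) / \<eta> - 1) / \<eta>) (at x)"
    by simp
  have "((\<lambda>x. ramp ((\<beta> - x) / \<eta> - 1)) has_real_derivative ramp' ((\<beta> - x) / \<eta> - 1) * (- 1 / \<eta>)) (at x)"
    by (rule DERIV_chain2[OF ramp_deriv]) (auto intro!: derivative_eq_intros simp: divide_inverse)
  from DERIV_minus[OF this]
  show "((\<lambda>x. - ramp ((\<beta> - x) / \<eta> - 1)) has_real_derivative ramp' ((\<beta> - x) / \<eta> - 1) / \<eta>) (at x)"
    by simp
qed

lemma plateau_deriv:
  "(plateau \<alpha> \<beta> \<eta> has_real_derivative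
     (ramp' ((x - \<alpha>) / \<eta> - 1) / \<eta> - ramp' ((\<beta> - x) / \<eta> - 1) / \<eta>)) (at x)"
proof -
  have "((\<lambda>x. ramp ((x - \<alpha>) / \<eta> - 1) - (- ramp ((\<beta> - x) / \<eta> - 1)) - 1) has_real_derivative
     ramp' ((x - \<alpha>) / \<eta> - 1) / \<eta> - ramp' ((\<beta> - x) / \<eta> - 1) / \<eta> - 0) (at x)"
    by (intro DERIV_diff ramp_affine_deriv DERIV_const)
  then show ?thesis unfolding plateau_def by simp
qed

lemma test_function_plateau:
  assumes "\<eta> > 0" "4 * \<eta> < \<beta> - \<alpha>"
  shows "test_function \<alpha> \<beta> (plateau \<alpha> \<beta> \<eta>)"
  unfolding test_function_def
proof (intro conjI)
  have D: "deriv (plateau \<alpha> \<beta> \<eta>) = (\<lambda>x. ramp' ((x - \<alpha>) / \<eta> - 1) / \<eta> - ramp' ((\<beta> - x) / \<eta> - 1) / \<eta>)"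
    using DERIV_imp_deriv[OF plateau_deriv] by blast
  show "\<forall>x. (plateau \<alpha> \<beta> \<eta> has_real_derivative deriv (plateau \<alpha> \<beta> \<eta>) x) (at x)"
    unfolding D using plateau_deriv by blast
  show "continuous_on UNIV (deriv (plateau \<alpha> \<beta> \<eta>))"
    unfolding D using assms(1)
    by (intro continuous_intros continuous_on_compose2[OF continuous_on_ramp'[of UNIV]]) auto
  have "plateau \<alpha> \<beta> \<eta> x = 0" if "x \<notin> {\<alpha> + \<eta>..\<beta> - \<eta>}" for x
  proof (cases "x < \<alpha> + \<eta>")
    case True
    then have "(x - \<alpha>) / \<eta> - 1 \<le> 0" "(\<beta> - x) / \<eta> - 1 \<ge> 1"
      using assms by (auto simp: field_simps)
    then show ?thesis by (simp add: plateau_def ramp_simps)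
  next
    case False
    then have "(x - \<alpha>) / \<eta> - 1 \<ge> 1" "(\<beta> - x) / \<eta> - 1 \<le> 0"
      using assms that by (auto simp: field_simps)
    then show ?thesis by (simp add: plateau_def ramp_simps)
  qed
  then show "\<exists>c d. \<alpha> < c \<and> d < \<beta> \<and> (\<forall>x. x \<notin> {c..d} \<longrightarrow> plateau \<alpha> \<beta> \<eta> x = 0)"
    using assms(1) by (intro exI[of _ "\<alpha> + \<eta>"] exI[of _ "\<beta> - \<eta>"]) auto
qed

lemma plateau_abs_le: "\<bar>plateau \<alpha> \<beta> \<eta> x\<bar> \<le> 1"
  using ramp_bounds[of "(x - \<alpha>) / \<eta> - 1"] ramp_bounds[of "(\<beta> - x) / \<eta> - 1"]
  by (auto simp: plateau_def abs_le_iff)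

lemma set_integrable_continuous_bounded_interval:
  fixes f :: "real \<Rightarrow> 'v::{banach, second_countable_topology}"
  assumes "continuous_on {a..b} f"
  shows "set_integrable lborel {a<..<b} f"
  by (rule set_integrable_subset[OF borel_integrable_atLeastAtMost'[OF assms]]) auto

text \<open>The integral is an average of \<open>u\<close> with the probability density \<open>g'\<close>, which charges
  only points where \<open>u\<close> is close to \<open>c\<close>.  Applied to the two bumps in the derivative of a plateau, it recovers
  the boundary values of \<open>u\<close>.\<close>

lemma norm_average_diff_le:
  fixes u :: "real \<Rightarrow> 'v::{banach, second_countable_topology}"
  assumes "\<alpha> < \<beta>" and u: "continuous_on {\<alpha>..\<beta>} u"
    and g: "\<And>x. (g has_real_derivative g' x) (at x)" "continuous_on UNIV g'"
    and mass: "g \<beta> - g \<alpha> = 1" and nonneg: "\<And>x. g' x \<ge> 0"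
    and near: "\<And>x. x \<in> {\<alpha><..<\<beta>} \<Longrightarrow> g' x \<noteq> 0 \<Longrightarrow> norm (u x - c) \<le> e"
  shows "norm ((LINT x:{\<alpha><..<\<beta>}|lborel. g' x *\<^sub>R u x) - c) \<le> e"
proof -
  have g'c: "continuous_on {\<alpha>..\<beta>} g'" using g(2) continuous_on_subset by blast
  have int: "set_integrable lborel {\<alpha><..<\<beta>} (\<lambda>x. g' x *\<^sub>R u x)"
    "set_integrable lborel {\<alpha><..<\<beta>} (\<lambda>x. g' x *\<^sub>R c)"
    "set_integrable lborel {\<alpha><..<\<beta>} g'" "set_integrable lborel {\<alpha><..<\<beta>} (\<lambda>x. g' x * e)"
    "set_integrable lborel {\<alpha><..<\<beta>} (\<lambda>x. g' x *\<^sub>R (u x - c))"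
    by (intro set_integrable_continuous_bounded_interval continuous_intros u g'c)+
  have "(LBINT x=\<alpha>..\<beta>. g' x) = g \<beta> - g \<alpha>"
    using \<open>\<alpha> < \<beta>\<close> g(1) by (intro interval_integral_FTC_finite continuous_on_subset[OF g(2)])
      (auto intro: has_field_derivative_at_within simp flip: has_real_derivative_iff_has_vector_derivative)
  then have one: "(LINT x:{\<alpha><..<\<beta>}|lborel. g' x) = 1"
    using \<open>\<alpha> < \<beta>\<close> mass by (simp add: interval_lebesgue_integral_def einterval_eq)
  have "(LINT x:{\<alpha><..<\<beta>}|lborel. g' x *\<^sub>R c) = (LINT x:{\<alpha><..<\<beta>}|lborel. g' x) *\<^sub>R c"
    using integral_scaleR_left[of c lborel "\<lambda>x. indicat_real {\<alpha><..<\<beta>} x * g' x"] int(3)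
    by (simp add: set_lebesgue_integral_def set_integrable_def)
  then have "(LINT x:{\<alpha><..<\<beta>}|lborel. g' x *\<^sub>R u x) - c = (LINT x:{\<alpha><..<\<beta>}|lborel. g' x *\<^sub>R (u x - c))"
    using one int by (simp add: scaleR_diff_right set_integral_diff)
  also have "norm \<dots> \<le> (LINT x:{\<alpha><..<\<beta>}|lborel. norm (g' x *\<^sub>R (u x - c)))"
    by (rule set_integral_norm_bound) (rule int(5))
  also have "\<dots> \<le> (LINT x:{\<alpha><..<\<beta>}|lborel. g' x * e)"
  proof (rule set_integral_mono)
    show "set_integrable lborel {\<alpha><..<\<beta>} (\<lambda>x. norm (g' x *\<^sub>R (u x - c)))"
      by (rule set_integrable_norm) (rule int(5))
    show "norm (g' x *\<^sub>R (u x - c)) \<le> g' x * e" if "x \<in> {\<alpha><..<\<beta>}" for x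
      using near[OF that] nonneg[of x] by (cases "g' x = 0") (auto intro: mult_left_mono)
  qed (use int in auto)
  also have "\<dots> = e" using one int(3) by simp
  finally show ?thesis .
qed

text \<open>Plateau functions converge boundedly to the indicator of the interval while their
  derivatives converge to the difference of the point masses at the two end points, so that the definition of the
  weak derivative becomes the formula in the limit.\<close>

theorem weak_FTC:
  fixes u v :: "real \<Rightarrow> 'v::{banach, second_countable_topology}"
  assumes "\<alpha> < \<beta>" and u: "continuous_on {\<alpha>..\<beta>} u" and v: "set_integrable lborel {\<alpha><..<\<beta>} v"
    and weak: "\<And>\<phi>. test_function \<alpha> \<beta> \<phi> \<Longrightarrow>
      (LINT x:{\<alpha><..<\<beta>}|lborel. deriv \<phi> x *\<^sub>R u x) = - (LINT x:{\<alpha><..<\<beta>}|lborel. \<phi> x *\<^sub>R v x)"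
  shows "u \<beta> - u \<alpha> = (LINT x:{\<alpha><..<\<beta>}|lborel. v x)"
proof -
  \<comment> \<open>Any null sequence below a quarter of the length will do.\<close>
  define \<eta> where "\<eta> k = (\<beta> - \<alpha>) / (5 + real k)" for k
  have \<eta>: "\<eta> k > 0" "4 * \<eta> k < \<beta> - \<alpha>" for k
  proof -
    show "\<eta> k > 0" using \<open>\<alpha> < \<beta>\<close> by (simp add: \<eta>_def)
    have "(\<beta> - \<alpha>) * 4 < (\<beta> - \<alpha>) * (5 + real k)"
      using \<open>\<alpha> < \<beta>\<close> by (intro mult_strict_left_mono) auto
    then show "4 * \<eta> k < \<beta> - \<alpha>" unfolding \<eta>_def by (simp add: field_simps)
  qed
  have \<eta>0: "\<eta> \<longlonglongrightarrow> 0" unfolding \<eta>_def by real_asymp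
  define g1 g2 where "g1 k x = ramp ((x - \<alpha>) / \<eta> k - 1)" and "g2 k x = - ramp ((\<beta> - x) / \<eta> k - 1)" for k x
  define g1' g2' where "g1' k x = ramp' ((x - \<alpha>) / \<eta> k - 1) / \<eta> k"
    and "g2' k x = ramp' ((\<beta> - x) / \<eta> k - 1) / \<eta> k" for k x
  have d1: "(g1 k has_real_derivative g1' k x) (at x)" and d2: "(g2 k has_real_derivative g2' k x) (at x)" for k x
    unfolding g1_def g2_def g1'_def g2'_def by (rule ramp_affine_deriv)+
  have c1: "continuous_on UNIV (g1' k)" and c2: "continuous_on UNIV (g2' k)" for k
    unfolding g1'_def g2'_def using \<eta>[of k]
    by (auto intro!: continuous_intros continuous_on_compose2[OF continuous_on_ramp'[of UNIV]])
  have m: "g1 k \<beta> - g1 k \<alpha> = 1" "g2 k \<beta> - g2 k \<alpha> = 1" for k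
    unfolding g1_def g2_def using \<eta>[of k] by (auto simp: ramp_simps field_simps)
  have nn: "g1' k x \<ge> 0" "g2' k x \<ge> 0" for k x
    unfolding g1'_def g2'_def using \<eta>[of k] ramp_simps(5) by auto
  have uni: "uniformly_continuous_on {\<alpha>..\<beta>} u" using u compact_Icc by (rule compact_uniformly_continuous)
  have lim: "(\<lambda>k. LINT x:{\<alpha><..<\<beta>}|lborel. deriv (plateau \<alpha> \<beta> (\<eta> k)) x *\<^sub>R u x) \<longlonglongrightarrow> u \<alpha> - u \<beta>"
  proof -
    have "(\<lambda>k. LINT x:{\<alpha><..<\<beta>}|lborel. g1' k x *\<^sub>R u x) \<longlonglongrightarrow> u \<alpha>" (is ?A)
      and "(\<lambda>k. LINT x:{\<alpha><..<\<beta>}|lborel. g2' k x *\<^sub>R u x) \<longlonglongrightarrow> u \<beta>" (is ?B)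
    proof -
      have "\<forall>\<^sub>F k in sequentially.
          norm ((LINT x:{\<alpha><..<\<beta>}|lborel. g1' k x *\<^sub>R u x) - u \<alpha>) \<le> e \<and>
          norm ((LINT x:{\<alpha><..<\<beta>}|lborel. g2' k x *\<^sub>R u x) - u \<beta>) \<le> e" if "e > 0" for e
      proof -
        obtain d where d: "d > 0" "\<And>x y. x \<in> {\<alpha>..\<beta>} \<Longrightarrow> y \<in> {\<alpha>..\<beta>} \<Longrightarrow> dist x y < d \<Longrightarrow> dist (u x) (u y) < e"
          using uni \<open>e > 0\<close> unfolding uniformly_continuous_on_def by metis
        have "\<forall>\<^sub>F k in sequentially. \<eta> k < d / 2"
          using \<eta>0 d(1) by (intro order_tendstoD(2)) auto
        then show ?thesis
        proof eventually_elim
          case (elim k)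
          have s1: "x - \<alpha> < d" if "g1' k x \<noteq> 0" for x
          proof -
            have "(x - \<alpha>) / \<eta> k - 1 < 1" using that ramp_simps(4) unfolding g1'_def by (metis not_le div_0)
            then have "x - \<alpha> < 2 * \<eta> k" using \<eta>[of k] by (simp add: field_simps)
            with elim show ?thesis by linarith
          qed
          have s2: "\<beta> - x < d" if "g2' k x \<noteq> 0" for x
          proof -
            have "(\<beta> - x) / \<eta> k - 1 < 1" using that ramp_simps(4) unfolding g2'_def by (metis not_le div_0)
            then have "\<beta> - x < 2 * \<eta> k" using \<eta>[of k] by (simp add: field_simps)
            with elim show ?thesis by linarith
          qed
          show ?case
          proof
            show "norm ((LINT x:{\<alpha><..<\<beta>}|lborel. g1' k x *\<^sub>R u x) - u \<alpha>) \<le> e"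
              using s1 d(2)[of _ \<alpha>] \<open>\<alpha> < \<beta>\<close>
              by (intro norm_average_diff_le[OF \<open>\<alpha> < \<beta>\<close> u d1 c1 m(1) nn(1)])
                (auto simp: dist_norm less_imp_le)
            show "norm ((LINT x:{\<alpha><..<\<beta>}|lborel. g2' k x *\<^sub>R u x) - u \<beta>) \<le> e"
              using s2 d(2)[of _ \<beta>] \<open>\<alpha> < \<beta>\<close>
              by (intro norm_average_diff_le[OF \<open>\<alpha> < \<beta>\<close> u d2 c2 m(2) nn(2)])
                (auto simp: dist_norm less_imp_le)
          qed
        qed
      qed
      note * = this
      show ?A ?B
        unfolding tendsto_iff dist_norm using *[of "_ / 2"]
        by (fastforce elim!: eventually_mono)+
    qed
    moreover have "(LINT x:{\<alpha><..<\<beta>}|lborel. deriv (plateau \<alpha> \<beta> (\<eta> k)) x *\<^sub>R u x) =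
        (LINT x:{\<alpha><..<\<beta>}|lborel. g1' k x *\<^sub>R u x) - (LINT x:{\<alpha><..<\<beta>}|lborel. g2' k x *\<^sub>R u x)" for k
    proof -
      have "deriv (plateau \<alpha> \<beta> (\<eta> k)) x = g1' k x - g2' k x" for x
        unfolding g1'_def g2'_def by (rule DERIV_imp_deriv[OF plateau_deriv])
      then show ?thesis
        by (simp add: scaleR_diff_left)
          (intro set_integral_diff set_integrable_continuous_bounded_interval continuous_intros u
            continuous_on_subset[OF c1] continuous_on_subset[OF c2] subset_UNIV)
    qed
    ultimately show ?thesis by (simp add: tendsto_diff)
  qed
  have lim2: "(\<lambda>k. LINT x:{\<alpha><..<\<beta>}|lborel. plateau \<alpha> \<beta> (\<eta> k) x *\<^sub>R v x) \<longlonglongrightarrow> (LINT x:{\<alpha><..<\<beta>}|lborel. v x)"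
    unfolding set_lebesgue_integral_def
  proof (rule integral_dominated_convergence[where w="\<lambda>x. norm (indicat_real {\<alpha><..<\<beta>} x *\<^sub>R v x)"])
    have vm: "(\<lambda>x. indicat_real {\<alpha><..<\<beta>} x *\<^sub>R v x) \<in> borel_measurable lborel"
      using v unfolding set_integrable_def by (rule borel_measurable_integrable)
    then show "(\<lambda>x. indicat_real {\<alpha><..<\<beta>} x *\<^sub>R v x) \<in> borel_measurable lborel" .
    have pm: "plateau \<alpha> \<beta> (\<eta> k) \<in> borel_measurable lborel" for k
    proof -
      have "continuous_on UNIV (plateau \<alpha> \<beta> (\<eta> k))"
        by (intro continuous_at_imp_continuous_on ballI) (rule DERIV_isCont[OF plateau_deriv])
      then show ?thesis by (simp add: borel_measurable_continuous_onI)
    qed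
    show "(\<lambda>x. indicat_real {\<alpha><..<\<beta>} x *\<^sub>R plateau \<alpha> \<beta> (\<eta> k) x *\<^sub>R v x) \<in> borel_measurable lborel" for k
      using borel_measurable_scaleR[OF pm vm, of k] by (simp add: mult.commute)
    show "integrable lborel (\<lambda>x. norm (indicat_real {\<alpha><..<\<beta>} x *\<^sub>R v x))"
      using v unfolding set_integrable_def by (rule integrable_norm)
    show "AE x in lborel. norm (indicat_real {\<alpha><..<\<beta>} x *\<^sub>R plateau \<alpha> \<beta> (\<eta> k) x *\<^sub>R v x)
        \<le> norm (indicat_real {\<alpha><..<\<beta>} x *\<^sub>R v x)" for k
      using plateau_abs_le[of \<alpha> \<beta> "\<eta> k"]
      by (auto simp: indicator_def intro!: AE_I2 mult_left_le_one_le)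
    have "(\<lambda>k. plateau \<alpha> \<beta> (\<eta> k) x) \<longlonglongrightarrow> 1" if "x \<in> {\<alpha><..<\<beta>}" for x
    proof -
      have "\<forall>\<^sub>F k in sequentially. \<eta> k < min (x - \<alpha>) (\<beta> - x) / 2"
        using \<eta>0 that by (intro order_tendstoD(2)) auto
      then have "\<forall>\<^sub>F k in sequentially. plateau \<alpha> \<beta> (\<eta> k) x = 1"
      proof eventually_elim
        case (elim k)
        then have "(x - \<alpha>) / \<eta> k - 1 \<ge> 1" "(\<beta> - x) / \<eta> k - 1 \<ge> 1"
          using \<eta>[of k] by (auto simp: field_simps)
        then show ?case by (simp add: plateau_def ramp_simps)
      qed
      then show ?thesis by (rule tendsto_eventually)
    qed
    then show "AE x in lborel. (\<lambda>k. indicat_real {\<alpha><..<\<beta>} x *\<^sub>R plateau \<alpha> \<beta> (\<eta> k) x *\<^sub>R v x)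
        \<longlonglongrightarrow> indicat_real {\<alpha><..<\<beta>} x *\<^sub>R v x"
      by (intro AE_I2) (auto simp: indicator_def intro!: tendsto_eq_intros)
  qed
  have "u \<alpha> - u \<beta> = - (LINT x:{\<alpha><..<\<beta>}|lborel. v x)"
    using lim unfolding weak[OF test_function_plateau[OF \<eta>]]
    by (rule LIMSEQ_unique) (intro tendsto_minus lim2)
  then show ?thesis by (simp add: algebra_simps)
qed

section \<open>Weak time derivatives of functions of time and space\<close>

text \<open>Lebesgue measure on \<open>(a, b)\<close> as a finite measure of its own; products of such measures
  serve for functions of time and space.\<close>

definition Om :: "real \<Rightarrow> real \<Rightarrow> real measure" where
  "Om a b = restrict_space lborel {a<..<b}"

lemma space_Om [simp]: "space (Om a b) = {a<..<b}"
  by (simp add: Om_def space_restrict_space)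

lemma finite_measure_Om: "finite_measure (Om a b)"
  by (rule finite_measureI, cases "a \<le> b") (auto simp: Om_def emeasure_restrict_space space_restrict_space)

lemma sigma_finite_Om: "sigma_finite_measure (Om a b)"
  using finite_measure_Om by (rule finite_measure.axioms)

lemma pair_sigma_finite_Om: "pair_sigma_finite (Om c d) (Om a b)"
  by (simp add: pair_sigma_finite_def sigma_finite_Om)

lemma emeasure_Om: "a \<le> b \<Longrightarrow> emeasure (Om a b) {a<..<b} = ennreal (b - a)"
  unfolding Om_def by (subst emeasure_restrict_space) auto

lemma measurable_Om: "f \<in> borel_measurable borel \<Longrightarrow> f \<in> borel_measurable (Om a b)"
  unfolding Om_def by (intro measurable_restrict_space1) simp

lemma sets_Om: "A \<in> sets (Om a b) \<longleftrightarrow> A \<in> sets borel \<and> A \<subseteq> {a<..<b}"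
  unfolding Om_def by (subst sets_restrict_space_iff) auto

lemma AE_Om: "(AE x in Om a b. P x) \<longleftrightarrow> (AE x\<in>{a<..<b} in lborel. P x)"
  unfolding Om_def by (rule AE_restrict_space_iff) simp

lemma integrable_Om:
  fixes f :: "real \<Rightarrow> 'v::{banach, second_countable_topology}"
  shows "integrable (Om a b) f \<longleftrightarrow> set_integrable lborel {a<..<b} f"
  unfolding Om_def set_integrable_def by (rule integrable_restrict_space) simp

lemma integral_Om:
  fixes f :: "real \<Rightarrow> 'v::{banach, second_countable_topology}"
  shows "integral\<^sup>L (Om a b) f = (LINT x:{a<..<b}|lborel. f x)"
  unfolding Om_def set_lebesgue_integral_def by (rule integral_restrict_space) simp

lemma borel_measurable_Om:
  fixes f :: "real \<Rightarrow> 'v::{banach, second_countable_topology}"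
  shows "f \<in> borel_measurable (Om a b) \<longleftrightarrow> set_borel_measurable lborel {a<..<b} f"
  unfolding Om_def set_borel_measurable_def by (subst borel_measurable_restrict_space_iff) auto

lemma pair_Om: "Om c d \<Otimes>\<^sub>M Om a b = restrict_space lborel ({c<..<d} \<times> {a<..<b})"
proof (rule pair_measure_eqI[OF sigma_finite_Om sigma_finite_Om])
  show "sets (Om c d \<Otimes>\<^sub>M Om a b) = sets (restrict_space lborel ({c<..<d} \<times> {a<..<b}))" (is "?L = ?R")
  proof (rule antisym)
    have "A \<times> B \<in> ?R" if "A \<in> sets (Om c d)" "B \<in> sets (Om a b)" for A B
    proof -
      have "A \<times> B \<in> sets ((borel :: real measure) \<Otimes>\<^sub>M (borel :: real measure))" using that unfolding sets_Om by (intro pair_measureI) auto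
      then have "A \<times> B \<in> sets borel" by (simp only: borel_prod)
      moreover have "A \<times> B \<subseteq> {c<..<d} \<times> {a<..<b}" using that unfolding sets_Om by blast
      ultimately show ?thesis
        by (subst sets_restrict_space_iff) (simp_all add: borel_open open_Times)
    qed
    moreover have "space (Om c d) \<times> space (Om a b) \<in> ?R"
      using sets.top[of "restrict_space lborel ({c<..<d} \<times> {a<..<b})"] by (simp add: space_restrict_space)
    ultimately have "sigma_sets (space (Om c d) \<times> space (Om a b)) {A \<times> B |A B. A \<in> sets (Om c d) \<and> B \<in> sets (Om a b)}
        \<subseteq> ?R"
      by (intro sets.sigma_sets_subset') auto
    then show "?L \<subseteq> ?R" unfolding sets_pair_measure .
    have id: "(\<lambda>p. (fst p, snd p)) \<in> Om c d \<Otimes>\<^sub>M Om a b \<rightarrow>\<^sub>M borel \<Otimes>\<^sub>M borel"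
      by (intro measurable_Pair measurable_compose[OF measurable_fst] measurable_compose[OF measurable_snd] measurable_Om) auto
    show "?R \<subseteq> ?L"
    proof
      fix X assume "X \<in> ?R"
      moreover have R: "({c<..<d} \<times> {a<..<b}) \<inter> space lborel \<in> sets lborel"
        using borel_open[OF open_Times[OF open_greaterThanLessThan open_greaterThanLessThan]] by simp
      ultimately have "X \<in> sets lborel" and X: "X \<subseteq> {c<..<d} \<times> {a<..<b}"
        using sets_restrict_space_iff[OF R] by blast+
      then have Xs: "X \<in> sets (borel \<Otimes>\<^sub>M borel)" by (simp only: borel_prod sets_lborel)
      have "X = (\<lambda>p. (fst p, snd p)) -` X \<inter> space (Om c d \<Otimes>\<^sub>M Om a b)"
        using X by (auto simp: space_pair_measure)
      also have "\<dots> \<in> ?L" using id Xs by (rule measurable_sets)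
      finally show "X \<in> ?L" .
    qed
  qed
next
  fix A B assume "A \<in> sets (Om c d)" "B \<in> sets (Om a b)"
  then have A: "A \<in> sets borel" "A \<subseteq> {c<..<d}" and B: "B \<in> sets borel" "B \<subseteq> {a<..<b}"
    by (auto simp: sets_Om)
  have "emeasure lborel (A \<times> B) = emeasure lborel A * emeasure lborel B"
    using A B by (subst lborel_prod[symmetric]) (simp add: lborel.emeasure_pair_measure_Times)
  moreover have "A \<times> B \<subseteq> {c<..<d} \<times> {a<..<b}" using A B by auto
  ultimately show "emeasure (Om c d) A * emeasure (Om a b) B = emeasure (restrict_space lborel ({c<..<d} \<times> {a<..<b})) (A \<times> B)"
    using A B by (simp add: Om_def emeasure_restrict_space borel_open open_Times)
qed

lemma integrable_pair_Om:
  fixes f :: "real \<Rightarrow> real \<Rightarrow> 'v::{banach, second_countable_topology}"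
  shows "integrable (Om c d \<Otimes>\<^sub>M Om a b) (\<lambda>(t, x). f t x) \<longleftrightarrow>
    set_integrable lborel ({c<..<d} \<times> {a<..<b}) (\<lambda>(t, x). f t x)"
  unfolding pair_Om set_integrable_def by (rule integrable_restrict_space) (simp add: borel_open open_Times)

text \<open>The support is a compact subset of the open interval, so that the test function vanishes
  near every other point, including the end points.  Hence integrals against a test function do not change
  when the interval of integration is enlarged.\<close>

lemma test_function_deriv_outside:
  assumes "test_function s t \<phi>" and "r \<notin> {s<..<t}"
  shows "\<phi> r = 0" "deriv \<phi> r = 0"
proof -
  obtain c d where cd: "s < c" "d < t" "\<And>x. x \<notin> {c..d} \<Longrightarrow> \<phi> x = 0"
    using assms(1) unfolding test_function_def by blast
  have nin: "r \<in> - {c..d}" using cd assms(2) by auto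
  then show "\<phi> r = 0" using cd by auto
  have "((\<lambda>x. 0) has_real_derivative 0) (at r)" by simp
  then have "(\<phi> has_real_derivative 0) (at r)"
    by (rule has_field_derivative_transform_within_open[where S="- {c..d}"]) (use nin cd(3) in auto)
  then show "deriv \<phi> r = 0" by (rule DERIV_imp_deriv)
qed

lemma test_function_subinterval:
  "test_function s t \<phi> \<Longrightarrow> \<alpha> \<le> s \<Longrightarrow> t \<le> \<beta> \<Longrightarrow> test_function \<alpha> \<beta> \<phi>"
  unfolding test_function_def by (meson le_less_trans less_le_trans)

lemma test_function_bounded:
  assumes "test_function s t \<phi>"
  shows "\<exists>K. \<forall>r. \<bar>\<phi> r\<bar> \<le> K \<and> \<bar>deriv \<phi> r\<bar> \<le> K"
proof -
  have "continuous_on UNIV \<phi>"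
    using assms unfolding test_function_def
    by (intro continuous_at_imp_continuous_on ballI DERIV_isCont) auto
  then have c: "continuous_on {s..t} \<phi>" "continuous_on {s..t} (deriv \<phi>)"
    using assms continuous_on_subset unfolding test_function_def by blast+
  have "bounded (\<phi> ` {s..t})" "bounded (deriv \<phi> ` {s..t})"
    using c by (auto intro!: compact_imp_bounded compact_continuous_image)
  then obtain K1 K2 where K: "\<And>r. r \<in> {s..t} \<Longrightarrow> \<bar>\<phi> r\<bar> \<le> K1" "\<And>r. r \<in> {s..t} \<Longrightarrow> \<bar>deriv \<phi> r\<bar> \<le> K2"
    unfolding bounded_iff by (auto simp del: atLeastAtMost_iff)
  show ?thesis
  proof (intro exI allI)
    fix r
    show "\<bar>\<phi> r\<bar> \<le> max (max K1 K2) 0 \<and> \<bar>deriv \<phi> r\<bar> \<le> max (max K1 K2) 0"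
      using K[of r] test_function_deriv_outside[OF assms, of r] by (cases "r \<in> {s..t}") (auto simp: le_max_iff_disj)
  qed
qed

lemma test_function_measurable:
  assumes "test_function s t \<phi>"
  shows "\<phi> \<in> borel_measurable borel" "deriv \<phi> \<in> borel_measurable borel"
proof -
  have "continuous_on UNIV \<phi>"
    using assms unfolding test_function_def
    by (intro continuous_at_imp_continuous_on ballI DERIV_isCont) auto
  then show "\<phi> \<in> borel_measurable borel" by (rule borel_measurable_continuous_onI)
  show "deriv \<phi> \<in> borel_measurable borel"
    using assms unfolding test_function_def by (intro borel_measurable_continuous_onI) auto
qed

lemma weighted_Fubini:
  fixes f :: "real \<Rightarrow> real \<Rightarrow> 'v::{banach, second_countable_topology}"
  assumes f: "integrable (Om c d \<Otimes>\<^sub>M Om a b) (\<lambda>(t, x). f t x)"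
    and g: "g \<in> borel_measurable (Om c d)" "\<And>t. \<bar>g t\<bar> \<le> K"
    and h: "h \<in> borel_measurable (Om a b)" "\<And>x. \<bar>h x\<bar> \<le> L"
  shows "(LINT t|Om c d. g t *\<^sub>R (LINT x|Om a b. h x *\<^sub>R f t x)) =
    (LINT x|Om a b. h x *\<^sub>R (LINT t|Om c d. g t *\<^sub>R f t x))"
proof -
  interpret pair_sigma_finite "Om c d" "Om a b" by (rule pair_sigma_finite_Om)
  note [measurable] = g(1) h(1)
  have [measurable]: "(\<lambda>(t, x). f t x) \<in> borel_measurable (Om c d \<Otimes>\<^sub>M Om a b)"
    using f by (rule borel_measurable_integrable)
  have "integrable (Om c d \<Otimes>\<^sub>M Om a b) (\<lambda>(t, x). g t *\<^sub>R h x *\<^sub>R f t x)"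
  proof (rule Bochner_Integration.integrable_bound)
    show "integrable (Om c d \<Otimes>\<^sub>M Om a b) (\<lambda>p. (K * L) * norm (f (fst p) (snd p)))"
      using integrable_norm[OF f] by (simp add: case_prod_beta')
    show "(\<lambda>(t, x). g t *\<^sub>R h x *\<^sub>R f t x) \<in> borel_measurable (Om c d \<Otimes>\<^sub>M Om a b)"
      by measurable
    have "\<bar>g t\<bar> * (\<bar>h x\<bar> * norm (f t x)) \<le> \<bar>K * L\<bar> * norm (f t x)" for t x
    proof -
      have "\<bar>g t\<bar> * \<bar>h x\<bar> \<le> K * L" using g(2)[of t] h(2)[of x] by (intro mult_mono) auto
      then have "\<bar>g t\<bar> * \<bar>h x\<bar> \<le> \<bar>K * L\<bar>" by linarith
      then have "\<bar>g t\<bar> * \<bar>h x\<bar> * norm (f t x) \<le> \<bar>K * L\<bar> * norm (f t x)"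
        by (rule mult_right_mono) simp
      then show ?thesis by (simp add: mult.assoc)
    qed
    then show "AE p in Om c d \<Otimes>\<^sub>M Om a b. norm (case p of (t, x) \<Rightarrow> g t *\<^sub>R h x *\<^sub>R f t x) \<le> norm ((K * L) * norm (f (fst p) (snd p)))"
      by (intro AE_I2) (simp add: abs_mult case_prod_beta' mult.assoc)
  qed
  from Fubini_integral[OF this]
  have "(LINT t|Om c d. (LINT x|Om a b. g t *\<^sub>R h x *\<^sub>R f t x)) = (LINT x|Om a b. (LINT t|Om c d. g t *\<^sub>R h x *\<^sub>R f t x))"
    by (rule sym)
  also have "\<dots> = (LINT x|Om a b. (LINT t|Om c d. h x *\<^sub>R g t *\<^sub>R f t x))"
    by (simp add: mult.commute)
  finally show ?thesis by (simp only: integral_scaleR_right)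
qed

lemma integral_Om_subinterval:
  fixes f :: "real \<Rightarrow> 'v::{banach, second_countable_topology}"
  assumes "\<alpha> \<le> s" "t \<le> \<beta>" and "\<And>r. r \<notin> {s<..<t} \<Longrightarrow> f r = 0"
  shows "(LINT r|Om \<alpha> \<beta>. f r) = (LINT r|Om s t. f r)"
  unfolding integral_Om set_lebesgue_integral_def
  using assms by (intro Bochner_Integration.integral_cong) (auto simp: indicator_def)

lemma integrable_pair_subinterval:
  fixes f :: "real \<Rightarrow> real \<Rightarrow> 'v::{banach, second_countable_topology}"
  assumes "integrable (Om \<alpha> \<beta> \<Otimes>\<^sub>M Om a b) (\<lambda>(t, x). f t x)" "\<alpha> \<le> s" "t \<le> \<beta>"
  shows "integrable (Om s t \<Otimes>\<^sub>M Om a b) (\<lambda>(t, x). f t x)"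
  using assms unfolding integrable_pair_Om
  by (elim set_integrable_subset) (auto simp: borel_open open_Times)

text \<open>The exceptional null set in \<open>has_time_deriv\<close> depends on the test function.  Integrating over
  an arbitrary measurable subset of \<open>(a, b)\<close> removes it and leaves a function of time alone, to which the
  theorem above applies; integrals over all measurable sets determine a function almost everywhere.\<close>

theorem has_time_deriv_FTC:
  fixes u v :: "real \<Rightarrow> real \<Rightarrow> 'v::{banach, second_countable_topology}"
  assumes D: "has_time_deriv T a b u v" and st: "0 \<le> s" "s \<le> t" "t \<le> T"
  shows "AE x in Om a b. u t x - u s x = (LINT r|Om s t. v r x)"
proof (cases "s = t")
  case True
  have "(LINT r|Om t t. v r x) = 0" for x by (simp add: integral_Om set_lebesgue_integral_def)
  with True show ?thesis by simp
next
  case False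
  with st have "s < t" by simp
  have iu: "integrable (Om 0 T \<Otimes>\<^sub>M Om a b) (\<lambda>(r, x). u r x)"
    and iv: "integrable (Om 0 T \<Otimes>\<^sub>M Om a b) (\<lambda>(r, x). v r x)"
    using D unfolding has_time_deriv_def integrable_pair_Om by auto
  have iu': "integrable (Om s t \<Otimes>\<^sub>M Om a b) (\<lambda>(r, x). u r x)"
    and iv': "integrable (Om s t \<Otimes>\<^sub>M Om a b) (\<lambda>(r, x). v r x)"
    using iu iv st by (auto intro: integrable_pair_subinterval)
  have ut: "integrable (Om a b) (u r)" if "r \<in> {0..T}" for r
    using D that unfolding has_time_deriv_def integrable_Om by auto
  interpret P: pair_sigma_finite "Om s t" "Om a b" by (rule pair_sigma_finite_Om)
  have int: "integrable (Om a b) (\<lambda>x. u t x - u s x - (LINT r|Om s t. v r x))"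
    using ut st P.integrable_snd[OF iv'] by (auto intro!: Bochner_Integration.integrable_diff)
  have "AE x in Om a b. u t x - u s x - (LINT r|Om s t. v r x) = 0"
  proof (rule sigma_finite_measure.density_zero[OF sigma_finite_Om int])
    fix E assume E: "E \<in> sets (Om a b)"
    define h where "h = indicat_real E"
    have hm [measurable]: "h \<in> borel_measurable (Om a b)" unfolding h_def using E by measurable
    have hb: "\<bar>h x\<bar> \<le> 1" for x by (auto simp: h_def indicator_def)
    have hint: "integrable (Om a b) (\<lambda>x. h x *\<^sub>R f x)" if "integrable (Om a b) f" for f :: "real \<Rightarrow> 'v"
      unfolding h_def by (rule integrable_mult_indicator[OF E that])
    define U where "U r = (LINT x|Om a b. h x *\<^sub>R u r x)" for r
    define W where "W r = (LINT x|Om a b. h x *\<^sub>R v r x)" for r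
    have "continuous_on {0..T} U"
      unfolding continuous_on_def
    proof
      fix r assume r: "r \<in> {0..T}"
      have lim: "((\<lambda>q. LINT x|Om a b. norm (u q x - u r x)) \<longlongrightarrow> 0) (at r within {0..T})"
        using D r unfolding has_time_deriv_def integral_Om by auto
      have "norm (U q - U r) \<le> (LINT x|Om a b. norm (u q x - u r x)) * 1" if q: "q \<in> {0..T}" for q
      proof -
        have "U q - U r = (LINT x|Om a b. h x *\<^sub>R (u q x - u r x))"
          unfolding U_def scaleR_diff_right using q r by (subst Bochner_Integration.integral_diff) (auto intro!: hint ut)
        also have "norm \<dots> \<le> (LINT x|Om a b. norm (u q x - u r x))"
          using ut[OF q] ut[OF r] hb
          by (intro Bochner_Integration.integral_norm_bound[THEN order_trans] integral_mono integrable_norm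
             hint Bochner_Integration.integrable_diff) (auto intro: mult_left_le_one_le)
        finally show ?thesis by simp
      qed
      then have "((\<lambda>q. U q - U r) \<longlongrightarrow> 0) (at r within {0..T})"
        by (intro tendsto_0_le[OF lim, of _ 1])
          (auto simp: eventually_at_filter intro!: always_eventually dest: order_trans[OF _ abs_ge_self])
      then show "(U \<longlongrightarrow> U r) (at r within {0..T})" by (rule LIM_zero_cancel)
    qed
    then have Uc: "continuous_on {s..t} U" using st by (auto elim: continuous_on_subset)
    \<comment> \<open>The reduced pair of functions of time: \<open>U\<close> is continuous, and \<open>W\<close> is its weak derivative.\<close>
    have hv: "integrable (Om s t \<Otimes>\<^sub>M Om a b) (\<lambda>(r, x). h x *\<^sub>R v r x)"
    proof (rule Bochner_Integration.integrable_bound[OF iv'])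
      have [measurable]: "(\<lambda>(t, x). v t x) \<in> borel_measurable (Om s t \<Otimes>\<^sub>M Om a b)"
        using iv' by (rule borel_measurable_integrable)
      show "(\<lambda>(r, x). h x *\<^sub>R v r x) \<in> borel_measurable (Om s t \<Otimes>\<^sub>M Om a b)" by measurable
      show "AE p in Om s t \<Otimes>\<^sub>M Om a b. norm (case p of (r, x) \<Rightarrow> h x *\<^sub>R v r x) \<le> norm (case p of (r, x) \<Rightarrow> v r x)"
        using hb by (auto simp: case_prod_beta' intro!: mult_left_le_one_le)
    qed
    have Wi: "set_integrable lborel {s<..<t} W"
      unfolding W_def integrable_Om[symmetric] by (rule P.integrable_fst[OF hv])
    have "U t - U s = (LINT r:{s<..<t}|lborel. W r)"
    proof (rule weak_FTC[OF \<open>s < t\<close> Uc Wi])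
      fix \<phi> assume \<phi>: "test_function s t \<phi>"
      obtain K where K: "\<And>r. \<bar>\<phi> r\<bar> \<le> K" "\<And>r. \<bar>deriv \<phi> r\<bar> \<le> K" using test_function_bounded[OF \<phi>] by blast
      note m = test_function_measurable[OF \<phi>, THEN measurable_Om]
      have z: "(LINT r|Om s t. \<phi> r *\<^sub>R f r) = (LINT r|Om 0 T. \<phi> r *\<^sub>R f r)"
        "(LINT r|Om s t. deriv \<phi> r *\<^sub>R f r) = (LINT r|Om 0 T. deriv \<phi> r *\<^sub>R f r)" for f :: "real \<Rightarrow> 'v"
        using st test_function_deriv_outside[OF \<phi>] by (auto intro!: integral_Om_subinterval[symmetric])
      have "AE x in Om a b. (LINT r|Om 0 T. deriv \<phi> r *\<^sub>R u r x) = - (LINT r|Om 0 T. \<phi> r *\<^sub>R v r x)"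
        using D test_function_subinterval[OF \<phi> st(1) st(3)] unfolding has_time_deriv_def integral_Om AE_Om by blast
      then have ae: "AE x in Om a b. (LINT r|Om s t. deriv \<phi> r *\<^sub>R u r x) = - (LINT r|Om s t. \<phi> r *\<^sub>R v r x)"
        unfolding z .
      have "(LINT r|Om s t. deriv \<phi> r *\<^sub>R U r) = (LINT x|Om a b. h x *\<^sub>R (LINT r|Om s t. deriv \<phi> r *\<^sub>R u r x))"
        unfolding U_def by (rule weighted_Fubini[OF iu' m(2) K(2) hm hb])
      also have "\<dots> = (LINT x|Om a b. - (h x *\<^sub>R (LINT r|Om s t. \<phi> r *\<^sub>R v r x)))"
      proof (rule integral_cong_AE)
        have [measurable]: "(\<lambda>(t, x). u t x) \<in> borel_measurable (Om s t \<Otimes>\<^sub>M Om a b)"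
            "(\<lambda>(t, x). v t x) \<in> borel_measurable (Om s t \<Otimes>\<^sub>M Om a b)"
          using iu' iv' by (auto intro: borel_measurable_integrable)
        note [measurable] = m
        show "(\<lambda>x. h x *\<^sub>R (LINT r|Om s t. deriv \<phi> r *\<^sub>R u r x)) \<in> borel_measurable (Om a b)"
          "(\<lambda>x. - (h x *\<^sub>R (LINT r|Om s t. \<phi> r *\<^sub>R v r x))) \<in> borel_measurable (Om a b)"
          by measurable
        show "AE x in Om a b. h x *\<^sub>R (LINT r|Om s t. deriv \<phi> r *\<^sub>R u r x) = - (h x *\<^sub>R (LINT r|Om s t. \<phi> r *\<^sub>R v r x))"
          using ae by eventually_elim simp
      qed
      also have "\<dots> = - (LINT r|Om s t. \<phi> r *\<^sub>R W r)"
        unfolding W_def by (simp add: weighted_Fubini[OF iv' m(1) K(1) hm hb])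
      finally show "(LINT r:{s<..<t}|lborel. deriv \<phi> r *\<^sub>R U r) = - (LINT r:{s<..<t}|lborel. \<phi> r *\<^sub>R W r)"
        by (simp add: integral_Om)
    qed
    also have "\<dots> = (LINT r|Om s t. 1 *\<^sub>R W r)" by (simp add: integral_Om)
    also have "\<dots> = (LINT x|Om a b. h x *\<^sub>R (LINT r|Om s t. 1 *\<^sub>R v r x))"
      unfolding W_def by (rule weighted_Fubini[OF iv' _ _ hm hb, of "\<lambda>_. 1" 1]) auto
    finally have "(LINT x|Om a b. h x *\<^sub>R (LINT r|Om s t. v r x)) = U t - U s" by simp
    then show "set_lebesgue_integral (Om a b) E (\<lambda>x. u t x - u s x - (LINT r|Om s t. v r x)) = 0"
      using st unfolding set_lebesgue_integral_def h_def[symmetric] scaleR_diff_right U_def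
      by (subst Bochner_Integration.integral_diff, (auto intro!: hint ut P.integrable_snd[OF iv'] Bochner_Integration.integrable_diff)[2])+ simp
  qed
  then show ?thesis by eventually_elim (simp add: algebra_simps)
qed

section \<open>Size bounds and difference bounds in time\<close>

text \<open>Bounds on norms are kept as predicates with an extended nonnegative integral, so that
  integrability is a consequence of a bound rather than a side condition.\<close>

definition L2_le :: "'a measure \<Rightarrow> real \<Rightarrow> ('a \<Rightarrow> 'v::{banach, second_countable_topology}) \<Rightarrow> bool" where
  "L2_le M K u \<longleftrightarrow> 0 \<le> K \<and> u \<in> borel_measurable M \<and> (\<integral>\<^sup>+x. ennreal ((norm (u x))\<^sup>2) \<partial>M) \<le> ennreal (K\<^sup>2)"

definition Linf_le :: "'a measure \<Rightarrow> real \<Rightarrow> ('a \<Rightarrow> 'v::{banach, second_countable_topology}) \<Rightarrow> bool" where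
  "Linf_le M K u \<longleftrightarrow> 0 \<le> K \<and> u \<in> borel_measurable M \<and> (AE x in M. norm (u x) \<le> K)"

lemma L2_le_dominated:
  assumes u: "L2_le M K u" and g: "g \<in> borel_measurable M" and c: "0 \<le> c"
    and dom: "AE x in M. norm (g x) \<le> c * norm (u x)"
  shows "L2_le M (c * K) g"
proof -
  have [measurable]: "u \<in> borel_measurable M" using u by (simp add: L2_le_def)
  have "(\<integral>\<^sup>+x. ennreal ((norm (g x))\<^sup>2) \<partial>M) \<le> (\<integral>\<^sup>+x. ennreal (c\<^sup>2) * ennreal ((norm (u x))\<^sup>2) \<partial>M)"
    using dom
    by (intro nn_integral_mono_AE, eventually_elim)
      (auto simp: ennreal_mult[symmetric] power_mult_distrib[symmetric] intro!: ennreal_leI power_mono)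
  also have "\<dots> = ennreal (c\<^sup>2) * (\<integral>\<^sup>+x. ennreal ((norm (u x))\<^sup>2) \<partial>M)"
    by (rule nn_integral_cmult) measurable
  also have "\<dots> \<le> ennreal (c\<^sup>2) * ennreal (K\<^sup>2)"
    using u by (intro mult_left_mono) (auto simp: L2_le_def)
  finally show ?thesis using u g c
    by (simp add: L2_le_def ennreal_mult[symmetric] power_mult_distrib)
qed

lemma L2_le_mono: "L2_le M K u \<Longrightarrow> K \<le> L \<Longrightarrow> L2_le M L u"
  by (auto simp: L2_le_def intro: order_trans ennreal_leI power_mono)

lemma L2_le_minus: "L2_le M K u \<Longrightarrow> L2_le M K (\<lambda>x. - u x)"
  using L2_le_dominated[of M K u "\<lambda>x. - u x" 1] by (simp add: L2_le_def)

text \<open>Minkowski's inequality, obtained by integrating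
  \<open>(p + q)\<^sup>2 \<le> (1 + L / K) p\<^sup>2 + (1 + K / L) q\<^sup>2\<close>.  The constants are enlarged first in order to have
  \<open>K, L > 0\<close>.\<close>

lemma L2_le_add:
  assumes u: "L2_le M K u" and v: "L2_le M L v"
  shows "L2_le M (K + L) (\<lambda>x. u x + v x)"
proof -
  have [measurable]: "u \<in> borel_measurable M" "v \<in> borel_measurable M" using u v by (auto simp: L2_le_def)
  have KL: "0 \<le> K" "0 \<le> L" using u v by (auto simp: L2_le_def)
  let ?I = "\<integral>\<^sup>+x. ennreal ((norm (u x + v x))\<^sup>2) \<partial>M"
  \<comment> \<open>Strictly larger constants are positive, so that the quotients in the pointwise bound make sense.\<close>
  have step: "?I \<le> ennreal ((K' + L')\<^sup>2)" if K: "K' > K" and L: "L' > L" for K' L'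
  proof -
    have pos: "K' > 0" "L' > 0" using KL that by auto
    have pw: "(norm (u x + v x))\<^sup>2 \<le> (1 + L' / K') * (norm (u x))\<^sup>2 + (1 + K' / L') * (norm (v x))\<^sup>2" for x
    proof -
      let ?p = "norm (u x)" and ?q = "norm (v x)"
      have "0 \<le> (L' * ?p - K' * ?q)\<^sup>2 / (K' * L')" using pos by simp
      also have "\<dots> = L' / K' * ?p\<^sup>2 + K' / L' * ?q\<^sup>2 - 2 * ?p * ?q"
        using pos by (simp add: power2_eq_square field_simps)
      finally have "(?p + ?q)\<^sup>2 \<le> (1 + L' / K') * ?p\<^sup>2 + (1 + K' / L') * ?q\<^sup>2"
        by (simp add: power2_sum algebra_simps)
      moreover have "(norm (u x + v x))\<^sup>2 \<le> (?p + ?q)\<^sup>2"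
        by (intro power_mono norm_triangle_ineq) auto
      ultimately show ?thesis by linarith
    qed
    have "?I \<le> (\<integral>\<^sup>+x. ennreal (1 + L' / K') * ennreal ((norm (u x))\<^sup>2) + ennreal (1 + K' / L') * ennreal ((norm (v x))\<^sup>2) \<partial>M)"
      using pw pos by (intro nn_integral_mono) (simp add: ennreal_mult[symmetric] ennreal_plus[symmetric] del: ennreal_plus)
    also have "\<dots> = ennreal (1 + L' / K') * (\<integral>\<^sup>+x. ennreal ((norm (u x))\<^sup>2) \<partial>M)
        + ennreal (1 + K' / L') * (\<integral>\<^sup>+x. ennreal ((norm (v x))\<^sup>2) \<partial>M)"
      by (subst nn_integral_add) (auto simp: nn_integral_cmult)
    also have "\<dots> \<le> ennreal (1 + L' / K') * ennreal (K'\<^sup>2) + ennreal (1 + K' / L') * ennreal (L'\<^sup>2)"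
      using L2_le_mono[OF u, of K'] L2_le_mono[OF v, of L'] K L
      by (intro add_mono mult_left_mono) (auto simp: L2_le_def)
    also have "\<dots> = ennreal ((1 + L' / K') * K'\<^sup>2 + (1 + K' / L') * L'\<^sup>2)"
      using pos by (simp add: ennreal_mult[symmetric] ennreal_plus[symmetric] del: ennreal_plus)
    also have "(1 + L' / K') * K'\<^sup>2 + (1 + K' / L') * L'\<^sup>2 = (K' + L')\<^sup>2"
      using pos by (simp add: power2_eq_square field_simps)
    finally show ?thesis .
  qed
  have "?I < \<infinity>" using step[of "K + 1" "L + 1"] by (auto simp: top.extremum_strict intro: le_less_trans)
  then obtain r where r: "r \<ge> 0" "?I = ennreal r" by (cases ?I) auto
  have "sqrt r \<le> (K + L) + e" if "e > 0" for e
  proof -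
    have "r \<le> (K + e / 2 + (L + e / 2))\<^sup>2" using step[of "K + e / 2" "L + e / 2"] that r by simp
    then have "sqrt r \<le> K + e / 2 + (L + e / 2)" using KL that by (intro real_le_lsqrt) auto
    then show ?thesis by simp
  qed
  then have "sqrt r \<le> K + L" by (rule field_le_epsilon)
  then have "r \<le> (K + L)\<^sup>2" using r(1) by (simp add: sqrt_le_D)
  then show ?thesis using r KL by (simp add: L2_le_def ennreal_leI)
qed

lemma L2_le_diff: "L2_le M K u \<Longrightarrow> L2_le M L v \<Longrightarrow> L2_le M (K + L) (\<lambda>x. u x - v x)"
  using L2_le_add[OF _ L2_le_minus] by fastforce

lemma L2_le_scaleR_Linf:
  fixes V :: "'a \<Rightarrow> real"
  assumes "Linf_le M K V" "L2_le M L u"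
  shows "L2_le M (K * L) (\<lambda>x. V x *\<^sub>R u x)"
  using assms by (intro L2_le_dominated[of M L u])
    (auto simp: Linf_le_def L2_le_def elim!: eventually_mono intro!: mult_right_mono)

lemma Linf_le_mono: "Linf_le M K u \<Longrightarrow> K \<le> L \<Longrightarrow> Linf_le M L u"
  by (auto simp: Linf_le_def elim!: eventually_mono)

lemma Linf_le_add: "Linf_le M K u \<Longrightarrow> Linf_le M L v \<Longrightarrow> Linf_le M (K + L) (\<lambda>x. u x + v x)"
  by (auto simp: Linf_le_def elim!: eventually_elim2 intro: norm_triangle_le add_mono)

lemma Linf_le_minus: "Linf_le M K u \<Longrightarrow> Linf_le M K (\<lambda>x. - u x)"
  by (auto simp: Linf_le_def)

lemma norm_integral_le_nn_integral:
  fixes f :: "'a \<Rightarrow> 'v::{banach, second_countable_topology}"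
  shows "ennreal (norm (integral\<^sup>L M f)) \<le> (\<integral>\<^sup>+x. ennreal (norm (f x)) \<partial>M)"
  by (cases "integrable M f") (auto simp: integral_norm_bound_ennreal not_integrable_integral_eq)

lemma Linf_le_integral:
  fixes d :: "real \<Rightarrow> real \<Rightarrow> 'v::{banach, second_countable_topology}"
  assumes d: "(\<lambda>(r, x). d r x) \<in> borel_measurable (Om s t \<Otimes>\<^sub>M Om a b)" and w: "w \<in> borel_measurable (Om a b)"
    and eq: "AE x in Om a b. w x = (LINT r|Om s t. d r x)"
    and bound: "AE r in Om s t. Linf_le (Om a b) K (d r)" and st: "s \<le> t" and K: "0 \<le> K"
  shows "Linf_le (Om a b) (K * (t - s)) w"
proof -
  interpret pair_sigma_finite "Om s t" "Om a b" by (rule pair_sigma_finite_Om)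
  note [measurable] = d
  have "AE r in Om s t. AE x in Om a b. norm (d r x) \<le> K"
    using bound by (auto simp: Linf_le_def)
  then have "AE x in Om a b. AE r in Om s t. norm (d r x) \<le> K"
    by (subst (asm) AE_commute) measurable
  with eq have "AE x in Om a b. norm (w x) \<le> K * (t - s)"
  proof eventually_elim
    case (elim x)
    have "ennreal (norm (w x)) \<le> (\<integral>\<^sup>+r. ennreal (norm (d r x)) \<partial>Om s t)"
      unfolding elim(1) by (rule norm_integral_le_nn_integral)
    also have "\<dots> \<le> (\<integral>\<^sup>+r. ennreal K \<partial>Om s t)"
      using elim(2) by (intro nn_integral_mono_AE) (auto elim!: eventually_mono intro: ennreal_leI)
    also have "\<dots> = ennreal (K * (t - s))"
      using st K by (simp add: emeasure_Om ennreal_mult)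
    finally show ?case using st K by simp
  qed
  then show ?thesis using w st K by (simp add: Linf_le_def)
qed

text \<open>By Cauchy--Schwarz in time the square of the integral is at most \<open>t - s\<close> times the integral
  of the squares; Tonelli's theorem then allows integration in space first.\<close>

lemma L2_le_integral:
  fixes d :: "real \<Rightarrow> real \<Rightarrow> 'v::{banach, second_countable_topology}"
  assumes d: "(\<lambda>(r, x). d r x) \<in> borel_measurable (Om s t \<Otimes>\<^sub>M Om a b)" and w: "w \<in> borel_measurable (Om a b)"
    and eq: "AE x in Om a b. w x = (LINT r|Om s t. d r x)"
    and bound: "AE r in Om s t. L2_le (Om a b) K (d r)" and st: "s \<le> t" and K: "0 \<le> K"
  shows "L2_le (Om a b) (K * (t - s)) w"
proof -
  interpret pair_sigma_finite "Om s t" "Om a b" by (rule pair_sigma_finite_Om)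
  note [measurable] = d
  have "(\<integral>\<^sup>+x. ennreal ((norm (w x))\<^sup>2) \<partial>Om a b)
      \<le> (\<integral>\<^sup>+x. ennreal (t - s) * (\<integral>\<^sup>+r. ennreal ((norm (d r x))\<^sup>2) \<partial>Om s t) \<partial>Om a b)"
  proof (rule nn_integral_mono_AE)
    show "AE x in Om a b. ennreal ((norm (w x))\<^sup>2) \<le> ennreal (t - s) * (\<integral>\<^sup>+r. ennreal ((norm (d r x))\<^sup>2) \<partial>Om s t)"
      using eq AE_space
    proof eventually_elim
      case (elim x)
      have dx [measurable]: "(\<lambda>r. d r x) \<in> borel_measurable (Om s t)"
        using elim(2) by measurable
      have "ennreal ((norm (w x))\<^sup>2) = (ennreal (norm (w x)))\<^sup>2" by (simp add: ennreal_power)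
      also have "\<dots> \<le> (\<integral>\<^sup>+r. 1 * ennreal (norm (d r x)) \<partial>Om s t)\<^sup>2"
        unfolding elim(1) using norm_integral_le_nn_integral[of "Om s t" "\<lambda>r. d r x"] by (intro power_mono) auto
      also have "\<dots> \<le> (\<integral>\<^sup>+r. 1 ^ 2 \<partial>Om s t) * (\<integral>\<^sup>+r. (ennreal (norm (d r x)))\<^sup>2 \<partial>Om s t)"
        by (rule Cauchy_Schwarz_nn_integral) measurable
      also have "\<dots> = ennreal (t - s) * (\<integral>\<^sup>+r. ennreal ((norm (d r x))\<^sup>2) \<partial>Om s t)"
        using st by (simp add: emeasure_Om ennreal_power)
      finally show ?case .
    qed
  qed
  also have "\<dots> = ennreal (t - s) * (\<integral>\<^sup>+x. (\<integral>\<^sup>+r. ennreal ((norm (d r x))\<^sup>2) \<partial>Om s t) \<partial>Om a b)"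
    by (rule nn_integral_cmult) measurable
  also have "(\<integral>\<^sup>+x. (\<integral>\<^sup>+r. ennreal ((norm (d r x))\<^sup>2) \<partial>Om s t) \<partial>Om a b)
      = (\<integral>\<^sup>+r. (\<integral>\<^sup>+x. ennreal ((norm (d r x))\<^sup>2) \<partial>Om a b) \<partial>Om s t)"
    by (rule Fubini') measurable
  also have "\<dots> \<le> (\<integral>\<^sup>+r. ennreal (K\<^sup>2) \<partial>Om s t)"
    using bound by (intro nn_integral_mono_AE) (auto simp: L2_le_def elim!: eventually_mono)
  also have "\<dots> = ennreal (K\<^sup>2) * ennreal (t - s)" using st by (simp add: emeasure_Om)
  finally have "(\<integral>\<^sup>+x. ennreal ((norm (w x))\<^sup>2) \<partial>Om a b) \<le> ennreal (t - s) * (ennreal (K\<^sup>2) * ennreal (t - s))"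
    by (simp add: mult_left_mono)
  also have "\<dots> = ennreal ((K * (t - s))\<^sup>2)"
    using st by (simp add: ennreal_mult[symmetric]) (simp add: power2_eq_square ac_simps)
  finally show ?thesis using w st K by (simp add: L2_le_def)
qed

text \<open>What \<open>L2_le\<close> and \<open>Linf_le\<close> have in common, so that difference bounds are derived
  only once for the wave function and the potentials.\<close>

locale size_bound =
  fixes a b :: real and B :: "real \<Rightarrow> (real \<Rightarrow> 'v::{banach, second_countable_topology}) \<Rightarrow> bool"
  assumes nonneg: "B K u \<Longrightarrow> 0 \<le> K"
    and mono: "B K u \<Longrightarrow> K \<le> L \<Longrightarrow> B L u"
    and add: "B K u \<Longrightarrow> B L v \<Longrightarrow> B (K + L) (\<lambda>x. u x + v x)"
    and minus: "B K u \<Longrightarrow> B K (\<lambda>x. - u x)"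
    and integral: "(\<lambda>(r, x). d r x) \<in> borel_measurable (Om s t \<Otimes>\<^sub>M Om a b) \<Longrightarrow> w \<in> borel_measurable (Om a b) \<Longrightarrow>
      (AE x in Om a b. w x = (LINT r|Om s t. d r x)) \<Longrightarrow> (AE r in Om s t. B K (d r)) \<Longrightarrow>
      s \<le> t \<Longrightarrow> 0 \<le> K \<Longrightarrow> B (K * (t - s)) w"

lemma size_bound_L2: "size_bound a b (L2_le (Om a b))"
  by (rule size_bound.intro, simp add: L2_le_def, rule L2_le_mono, assumption+, rule L2_le_add, assumption+,
      rule L2_le_minus, assumption, rule L2_le_integral)

lemma size_bound_Linf: "size_bound a b (Linf_le (Om a b))"
  by (rule size_bound.intro, simp add: Linf_le_def, rule Linf_le_mono, assumption+, rule Linf_le_add, assumption+,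
      rule Linf_le_minus, assumption, rule Linf_le_integral)

text \<open>A substitute for a bound in \<open>W\<^bsup>2,\<infinity>\<^esup>([0, T]; X)\<close> that holds at every time.  The two
  increments of the second difference are independent: \<open>h = k\<close> gives the symmetric second difference of the
  local error, and \<open>k = \<tau>\<close> its change from one time step to the next.\<close>

definition diffs_le :: "real \<Rightarrow> (real \<Rightarrow> (real \<Rightarrow> 'v) \<Rightarrow> bool) \<Rightarrow> real \<Rightarrow> (real \<Rightarrow> real \<Rightarrow> 'v::real_normed_vector) \<Rightarrow> bool" where
  "diffs_le T B K u \<longleftrightarrow> 0 \<le> K \<and> (\<forall>t\<in>{0..T}. B K (u t)) \<and>
     (\<forall>t h. 0 \<le> t \<longrightarrow> 0 \<le> h \<longrightarrow> t + h \<le> T \<longrightarrow> B (K * h) (\<lambda>x. u (t + h) x - u t x)) \<and>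
     (\<forall>t h k. 0 \<le> t \<longrightarrow> 0 \<le> h \<longrightarrow> 0 \<le> k \<longrightarrow> t + h + k \<le> T \<longrightarrow>
        B (K * h * k) (\<lambda>x. u (t + h + k) x - u (t + h) x - u (t + k) x + u t x))"

lemma AE_Om_mono:
  assumes "AE r in Om \<alpha> \<beta>. P r" "\<alpha> \<le> s" "t \<le> \<beta>"
  shows "AE r in Om s t. P r"
  using assms unfolding AE_Om by (auto elim!: eventually_mono)

text \<open>Bounds known for almost every time are moved to a given time by choosing a good time
  arbitrarily close to it.\<close>

lemma ex_AE_time_near:
  assumes P: "AE r in Om 0 T. P r" and "0 < T" "t \<in> {0..T}" "\<delta> > 0"
  shows "\<exists>r\<in>{0<..<T}. \<bar>r - t\<bar> \<le> \<delta> \<and> P r"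
proof (rule ccontr)
  assume no: "\<not> ?thesis"
  define l u where "l = max 0 (t - \<delta>)" and "u = min T (t + \<delta>)"
  have lu: "l < u" "0 \<le> l" "u \<le> T" using assms by (auto simp: l_def u_def)
  have "AE r in Om l u. P r" using P lu by (auto intro: AE_Om_mono)
  then have "AE r in Om l u. False"
    using AE_space
  proof eventually_elim
    case (elim r)
    then have "r \<in> {0<..<T}" "\<bar>r - t\<bar> \<le> \<delta>" by (auto simp: l_def u_def)
    with no elim show False by blast
  qed
  then have "emeasure (Om l u) {l<..<u} = 0" by (simp add: eventually_False ae_filter_eq_bot_iff)
  then show False using lu by (simp add: emeasure_Om)
qed

lemma integral_Om_shift:
  fixes f :: "real \<Rightarrow> 'v::{banach, second_countable_topology}"
  shows "(LINT r|Om (s + k) (t + k). f r) = (LINT r|Om s t. f (r + k))"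
    and "integrable (Om (s + k) (t + k)) f \<longleftrightarrow> integrable (Om s t) (\<lambda>r. f (r + k))"
proof -
  have i: "indicat_real {s + k<..<t + k} (k + r) = indicat_real {s<..<t} r" for r
    by (auto simp: indicator_def)
  show "(LINT r|Om (s + k) (t + k). f r) = (LINT r|Om s t. f (r + k))"
    unfolding integral_Om set_lebesgue_integral_def
    by (subst lborel_integral_real_affine[of 1 _ k]) (simp_all add: i, simp add: add.commute)
  show "integrable (Om (s + k) (t + k)) f \<longleftrightarrow> integrable (Om s t) (\<lambda>r. f (r + k))"
    unfolding integrable_Om set_integrable_def
    using lborel_integrable_real_affine_iff[of 1 "\<lambda>r. indicat_real {s + k<..<t + k} r *\<^sub>R f r" k]
    by (simp add: i) (simp add: add.commute)
qed

context size_bound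
begin

lemma diff: "B K u \<Longrightarrow> B L v \<Longrightarrow> B (K + L) (\<lambda>x. u x - v x)"
  using add[OF _ minus] by fastforce

lemma time_deriv_measurable:
  assumes "has_time_deriv T a b u v" "t \<in> {0..T}"
  shows "u t \<in> borel_measurable (Om a b)"
  using assms unfolding has_time_deriv_def integrable_Om[symmetric] by (auto intro: borel_measurable_integrable)

lemma time_deriv_integrable:
  assumes "has_time_deriv T a b u v" "0 \<le> s" "t \<le> T"
  shows "integrable (Om s t \<Otimes>\<^sub>M Om a b) (\<lambda>(r, x). v r x)"
  using assms integrable_pair_subinterval[of 0 T a b v s t]
  unfolding has_time_deriv_def integrable_pair_Om[symmetric] by auto

lemma first_difference:
  assumes D: "has_time_deriv T a b u v" and K: "AE r in Om 0 T. B K (v r)" "0 \<le> K"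
    and t: "0 \<le> t" "0 \<le> h" "t + h \<le> T"
  shows "B (K * h) (\<lambda>x. u (t + h) x - u t x)"
proof -
  have "B (K * ((t + h) - t)) (\<lambda>x. u (t + h) x - u t x)"
  proof (rule integral)
    show "(\<lambda>(r, x). v r x) \<in> borel_measurable (Om t (t + h) \<Otimes>\<^sub>M Om a b)"
      using time_deriv_integrable[OF D] t by (auto intro: borel_measurable_integrable)
    show "(\<lambda>x. u (t + h) x - u t x) \<in> borel_measurable (Om a b)"
      using time_deriv_measurable[OF D] t by (intro borel_measurable_diff) auto
    show "AE x in Om a b. u (t + h) x - u t x = (LINT r|Om t (t + h). v r x)"
      by (rule has_time_deriv_FTC[OF D]) (use t in auto)
    show "AE r in Om t (t + h). B K (v r)" using K(1) t by (auto intro: AE_Om_mono)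
  qed (use t K in auto)
  then show ?thesis by simp
qed

lemma second_difference:
  assumes D: "has_time_deriv T a b u v" and D': "has_time_deriv T a b v w"
    and K: "AE r in Om 0 T. B K (w r)" "0 \<le> K"
    and t: "0 \<le> t" "0 \<le> h" "0 \<le> k" "t + h + k \<le> T"
  shows "B (K * h * k) (\<lambda>x. u (t + h + k) x - u (t + h) x - u (t + k) x + u t x)"
proof -
  interpret P: pair_sigma_finite "Om t (t + h)" "Om a b" by (rule pair_sigma_finite_Om)
  interpret P': pair_sigma_finite "Om (t + k) (t + h + k)" "Om a b" by (rule pair_sigma_finite_Om)
  have i1: "integrable (Om t (t + h) \<Otimes>\<^sub>M Om a b) (\<lambda>(r, x). v r x)"
    and i2: "integrable (Om (t + k) (t + h + k) \<Otimes>\<^sub>M Om a b) (\<lambda>(r, x). v r x)"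
    using time_deriv_integrable[OF D] t by auto
  have "B ((K * k) * ((t + h) - t)) (\<lambda>x. u (t + h + k) x - u (t + h) x - u (t + k) x + u t x)"
  proof (rule integral)
    have [measurable]: "(\<lambda>(r, x). v r x) \<in> borel_measurable (Om 0 T \<Otimes>\<^sub>M Om a b)"
      using time_deriv_integrable[OF D, of 0 T] by (auto intro: borel_measurable_integrable)
    have sh: "(\<lambda>r. r + k) \<in> Om t (t + h) \<rightarrow>\<^sub>M Om 0 T" "(\<lambda>r. r) \<in> Om t (t + h) \<rightarrow>\<^sub>M Om 0 T"
      unfolding Om_def using t by (auto intro!: measurable_restrict_space3)
    note [measurable] = sh
    have "(\<lambda>p. v (fst p + k) (snd p)) = (\<lambda>(r, x). v r x) \<circ> (\<lambda>p. (fst p + k, snd p))" by auto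
    moreover have "\<dots> \<in> borel_measurable (Om t (t + h) \<Otimes>\<^sub>M Om a b)"
      by (rule measurable_comp[of _ _ "Om 0 T \<Otimes>\<^sub>M Om a b"]) measurable
    moreover have "(\<lambda>p. v (fst p) (snd p)) \<in> borel_measurable (Om t (t + h) \<Otimes>\<^sub>M Om a b)"
      using i1 by (auto simp: case_prod_beta' dest: borel_measurable_integrable)
    ultimately show "(\<lambda>(r, x). v (r + k) x - v r x) \<in> borel_measurable (Om t (t + h) \<Otimes>\<^sub>M Om a b)"
      unfolding case_prod_beta' by (intro borel_measurable_diff) auto
    show "(\<lambda>x. u (t + h + k) x - u (t + h) x - u (t + k) x + u t x) \<in> borel_measurable (Om a b)"
      using time_deriv_measurable[OF D] t by (intro borel_measurable_diff borel_measurable_add) auto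
    have 1: "AE x in Om a b. u (t + h + k) x - u (t + k) x = (LINT r|Om (t + k) (t + h + k). v r x)"
      and 2: "AE x in Om a b. u (t + h) x - u t x = (LINT r|Om t (t + h). v r x)"
      using t by (intro has_time_deriv_FTC[OF D]; simp)+
    show "AE x in Om a b. u (t + h + k) x - u (t + h) x - u (t + k) x + u t x = (LINT r|Om t (t + h). v (r + k) x - v r x)"
      using 1 2 P.AE_integrable_snd[OF i1] P'.AE_integrable_snd[OF i2]
    proof eventually_elim
      case (elim x)
      have "(LINT r|Om t (t + h). v (r + k) x - v r x) = (LINT r|Om (t + k) (t + h + k). v r x) - (LINT r|Om t (t + h). v r x)"
        using elim(3,4) unfolding integral_Om_shift by (intro Bochner_Integration.integral_diff)
      moreover have "u (t + h + k) x - u (t + h) x - u (t + k) x + u t x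
          = (u (t + h + k) x - u (t + k) x) - (u (t + h) x - u t x)" by simp
      ultimately show ?case unfolding elim(1,2) by simp
    qed
    show "AE r in Om t (t + h). B (K * k) (\<lambda>x. v (r + k) x - v r x)"
      using t by (intro AE_I2 first_difference[OF D' K]) auto
  qed (use t K in auto)
  then show ?thesis by (simp add: ac_simps)
qed

text \<open>A difference is the integral of the derivative, and a second difference is the integral of a
  first difference of the derivative.  The factor \<open>2\<close> pays for passing from almost every time to every time in
  the bound on \<open>u\<close> itself.\<close>

theorem diffs_le_of_derivs:
  assumes D: "has_time_deriv T a b u v" and D': "has_time_deriv T a b v w" and T: "0 < T" and K0: "0 \<le> K"
    and K: "AE r in Om 0 T. B K (u r)" "AE r in Om 0 T. B K (v r)" "AE r in Om 0 T. B K (w r)"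
  shows "diffs_le T B (2 * K) u"
  unfolding diffs_le_def
proof (intro conjI allI impI ballI)
  fix t assume t: "t \<in> {0..T}"
  obtain r where r: "r \<in> {0<..<T}" "\<bar>r - t\<bar> \<le> 1" "B K (u r)"
    using ex_AE_time_near[OF K(1) T t, of 1] by auto
  show "B (2 * K) (u t)"
  proof (cases "r \<le> t")
    case True
    have "B (K * (t - r)) (\<lambda>x. u (r + (t - r)) x - u r x)"
      using first_difference[OF D K(2) K0, of r "t - r"] r t True by simp
    then have "B (K * (t - r) + K) (\<lambda>x. (u t x - u r x) + u r x)" using r by (intro add) auto
    then show ?thesis using r True K0 mult_left_mono[of "t - r" 1 K] by (auto intro: mono)
  next
    case False
    have "B (K * (r - t)) (\<lambda>x. u (t + (r - t)) x - u t x)"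
      using first_difference[OF D K(2) K0, of t "r - t"] r t False by simp
    then have "B (K + K * (r - t)) (\<lambda>x. u r x - (u r x - u t x))" using r by (intro diff) auto
    then show ?thesis using r False K0 mult_left_mono[of "r - t" 1 K] by (auto intro: mono)
  qed
next
  fix t h :: real assume t: "0 \<le> t" "0 \<le> h" "t + h \<le> T"
  show "B (2 * K * h) (\<lambda>x. u (t + h) x - u t x)"
    using first_difference[OF D K(2) K0 t] by (rule mono) (use t K0 in auto)
next
  fix t h k :: real assume t: "0 \<le> t" "0 \<le> h" "0 \<le> k" "t + h + k \<le> T"
  show "B (2 * K * h * k) (\<lambda>x. u (t + h + k) x - u (t + h) x - u (t + k) x + u t x)"
    using second_difference[OF D D' K(3) K0 t] by (rule mono) (use t K0 in auto)
qed (use K0 in auto)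

end

text \<open>The discrete Leibniz rule: the second difference of a product is a sum of four terms, in
  each of which the two increments act on the factors in one of the possible ways.  Only products of an
  \<open>L\<^sup>\<infinity>\<close> and an \<open>L\<^sup>2\<close> function occur.\<close>

lemma diffs_le_product:
  fixes V :: "real \<Rightarrow> real \<Rightarrow> real" and u :: "real \<Rightarrow> real \<Rightarrow> 'v::{banach, second_countable_topology}"
  assumes V: "diffs_le T (Linf_le M) K V" and u: "diffs_le T (L2_le M) L u"
  shows "diffs_le T (L2_le M) (4 * (K * L)) (\<lambda>t x. V t x *\<^sub>R u t x)"
proof -
  have nn: "0 \<le> K" "0 \<le> L" using assms by (auto simp: diffs_le_def)
  note V' = V[unfolded diffs_le_def] and u' = u[unfolded diffs_le_def]
  show ?thesis unfolding diffs_le_def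
  proof (intro conjI allI impI ballI)
    fix t assume t: "t \<in> {0..T}"
    have "L2_le M (K * L) (\<lambda>x. V t x *\<^sub>R u t x)"
      using V' u' t by (intro L2_le_scaleR_Linf) auto
    then show "L2_le M (4 * (K * L)) (\<lambda>x. V t x *\<^sub>R u t x)" by (rule L2_le_mono) (use nn in auto)
  next
    fix t h :: real assume t: "0 \<le> t" "0 \<le> h" "t + h \<le> T"
    have "L2_le M ((K * h) * L + K * (L * h)) (\<lambda>x. (V (t + h) x - V t x) *\<^sub>R u (t + h) x + V t x *\<^sub>R (u (t + h) x - u t x))"
      using V' u' t by (intro L2_le_add L2_le_scaleR_Linf) auto
    then show "L2_le M (4 * (K * L) * h) (\<lambda>x. V (t + h) x *\<^sub>R u (t + h) x - V t x *\<^sub>R u t x)"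
      by (rule L2_le_mono[where K="(K * h) * L + K * (L * h)", THEN back_subst[of "L2_le M _"]])
         (use nn t in \<open>auto simp: algebra_simps\<close>)
  next
    fix t h k :: real assume t: "0 \<le> t" "0 \<le> h" "0 \<le> k" "t + h + k \<le> T"
    let ?dV = "\<lambda>x. V (t + h + k) x - V (t + h) x - V (t + k) x + V t x"
    let ?du = "\<lambda>x. u (t + h + k) x - u (t + h) x - u (t + k) x + u t x"
    have s: "t + k + h = t + h + k" by simp
    have "L2_le M ((K * h * k) * L + (K * k) * (L * h) + (K * h) * (L * k) + K * (L * h * k))
      (\<lambda>x. ?dV x *\<^sub>R u (t + h + k) x + (V (t + k) x - V t x) *\<^sub>R (u (t + k + h) x - u (t + k) x)
         + (V (t + h) x - V t x) *\<^sub>R (u (t + h + k) x - u (t + h) x) + V t x *\<^sub>R ?du x)"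
      using V' u' t by (intro L2_le_add L2_le_scaleR_Linf) auto
    then show "L2_le M (4 * (K * L) * h * k) (\<lambda>x. V (t + h + k) x *\<^sub>R u (t + h + k) x - V (t + h) x *\<^sub>R u (t + h) x
         - V (t + k) x *\<^sub>R u (t + k) x + V t x *\<^sub>R u t x)"
      by (rule back_subst[of "\<lambda>p. L2_le M (fst p) (snd p)" "(_, _)" "(_, _)", simplified])
        (auto simp: algebra_simps s)
  qed (use nn in auto)
qed

section \<open>Fourier coefficients and trigonometric polynomials\<close>

lemma inner_cis_smult:
  fixes x y :: "complex^2"
  shows "(cis t *s x) \<bullet> y = x \<bullet> (cis (- t) *s y)"
  by (simp add: inner_vec_def inner_complex_def algebra_simps)

lemma cis_smult_smult: "cis s *s (cis t *s x) = cis (s + t) *s (x :: complex^2)"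
  by (simp add: vec_eq_iff mult.assoc[symmetric] cis_mult)

lemma norm_smult: "norm (c *s x) = cmod c * norm (x :: complex^2)"
  by (simp add: norm_vec_def norm_mult L2_set_right_distrib)

lemma norm_cis_smult [simp]: "norm (cis t *s x) = norm (x :: complex^2)"
  by (simp add: norm_smult)

text \<open>Reduces complex scalar multiples to real ones, for which measurability is immediate.\<close>

lemma smult_eq_scaleR: "c *s x = Re c *\<^sub>R x + Im c *\<^sub>R (\<i> *s x)" for x :: "complex^2"
  by (simp add: vec_eq_iff complex_eq_iff)

lemma bounded_linear_smult: "bounded_linear (\<lambda>x :: complex^2. c *s x)"
  by (rule linear_conv_bounded_linear[THEN iffD1])
    (auto intro!: linearI simp: vec_eq_iff algebra_simps)

lemma bounded_linear_smult_left: "bounded_linear (\<lambda>c. c *s (x :: complex^2))"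
  by (rule linear_conv_bounded_linear[THEN iffD1])
    (auto intro!: linearI simp: vec_eq_iff algebra_simps)

lemma bounded_linear_matrix: "bounded_linear (\<lambda>x :: complex^2. (A :: complex^2^2) *v x)"
  by (rule linear_conv_bounded_linear[THEN iffD1])
    (auto intro!: linearI simp: matrix_vector_right_distrib vec_eq_iff matrix_vector_mult_def scaleR_sum_right distrib_left sum.distrib)

lemma measurable_smult:
  assumes "c \<in> borel_measurable M" "u \<in> borel_measurable M"
  shows "(\<lambda>x. c x *s (u x :: complex^2)) \<in> borel_measurable M"
proof -
  have "(\<lambda>x. \<i> *s u x) \<in> borel_measurable M"
    using assms(2) by (intro borel_measurable_continuous_on[where f="\<lambda>x. \<i> *s x"]
        linear_continuous_on bounded_linear_smult) auto
  note [measurable] = this assms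
  show ?thesis by (subst smult_eq_scaleR) measurable
qed

lemma measurable_cis_affine: "(\<lambda>x. cis (c * (x - a))) \<in> borel_measurable (Om \<alpha> \<beta>)"
  by (intro measurable_Om borel_measurable_continuous_onI continuous_intros)

lemma integrable_cis_smult:
  fixes u :: "real \<Rightarrow> complex^2"
  assumes "integrable (Om \<alpha> \<beta>) u"
  shows "integrable (Om \<alpha> \<beta>) (\<lambda>x. cis (c * (x - a)) *s u x)"
  by (rule Bochner_Integration.integrable_bound[OF assms])
    (auto intro!: measurable_smult measurable_cis_affine borel_measurable_integrable[OF assms])

lemma fourier_coeff_Om:
  "fourier_coeff a b U l = (1 / (b - a)) *\<^sub>R (LINT x|Om a b. cis (- freq a b l * (x - a)) *s U x)"
  by (simp add: fourier_coeff_def integral_Om)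

lemma L2_le_integrable:
  fixes u :: "real \<Rightarrow> 'v::{banach, second_countable_topology}"
  assumes "L2_le (Om a b) K u"
  shows "integrable (Om a b) u" "integrable (Om a b) (\<lambda>x. (norm (u x))\<^sup>2)"
    "(LINT x|Om a b. (norm (u x))\<^sup>2) \<le> K\<^sup>2"
proof -
  have [measurable]: "u \<in> borel_measurable (Om a b)" using assms by (simp add: L2_le_def)
  have le: "(\<integral>\<^sup>+x. ennreal ((norm (u x))\<^sup>2) \<partial>Om a b) \<le> ennreal (K\<^sup>2)" using assms by (simp add: L2_le_def)
  show i: "integrable (Om a b) (\<lambda>x. (norm (u x))\<^sup>2)"
    by (rule integrableI_bounded) (use le in \<open>auto intro: le_less_trans\<close>)
  have "integrable (Om a b) (\<lambda>x. norm (u x))"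
    by (rule finite_measure.square_integrable_imp_integrable[OF finite_measure_Om _ i]) measurable
  then show "integrable (Om a b) u" by (simp add: integrable_norm_iff)
  show "(LINT x|Om a b. (norm (u x))\<^sup>2) \<le> K\<^sup>2"
    using le nn_integral_eq_integral[OF i] by simp
qed

lemma L2_leI:
  fixes u :: "real \<Rightarrow> 'v::{banach, second_countable_topology}"
  assumes "u \<in> borel_measurable (Om a b)" "integrable (Om a b) (\<lambda>x. (norm (u x))\<^sup>2)"
    "(LINT x|Om a b. (norm (u x))\<^sup>2) \<le> K\<^sup>2" "0 \<le> K"
  shows "L2_le (Om a b) K u"
  using assms nn_integral_eq_integral[OF assms(2)] by (simp add: L2_le_def ennreal_leI)

lemma measurable_trig_sum:
  "(\<lambda>x. \<Sum>l\<in>L. cis (freq a b l * (x - a)) *s (d l :: complex^2)) \<in> borel_measurable (Om \<alpha> \<beta>)"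
  by (intro borel_measurable_sum measurable_smult measurable_cis_affine) auto

lemma norm_trig_sum_le: "norm (\<Sum>l\<in>L. cis (freq a b l * (x - a)) *s (d l :: complex^2)) \<le> (\<Sum>l\<in>L. norm (d l))"
  by (rule order_trans[OF norm_sum]) simp

lemma L2_le_trig_sum: "a \<le> b \<Longrightarrow> \<exists>K. L2_le (Om a b) K (\<lambda>x. \<Sum>l\<in>L. cis (freq a b l * (x - a)) *s (d l :: complex^2))"
proof -
  assume "a \<le> b"
  let ?S = "\<Sum>l\<in>L. norm (d l)"
  have "(\<integral>\<^sup>+x. ennreal ((norm (\<Sum>l\<in>L. cis (freq a b l * (x - a)) *s (d l :: complex^2)))\<^sup>2) \<partial>Om a b)
      \<le> (\<integral>\<^sup>+x. ennreal (?S\<^sup>2) \<partial>Om a b)"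
    by (intro nn_integral_mono ennreal_leI power_mono norm_trig_sum_le) auto
  also have "\<dots> = ennreal ((?S * sqrt (b - a))\<^sup>2)"
    using \<open>a \<le> b\<close> by (simp add: emeasure_Om ennreal_mult power_mult_distrib)
  finally show ?thesis using \<open>a \<le> b\<close>
    by (intro exI[of _ "?S * sqrt (b - a)"]) (auto simp: L2_le_def measurable_trig_sum intro!: mult_nonneg_nonneg sum_nonneg)
qed

lemma freq_periodic: "a < b \<Longrightarrow> cis (freq a b l * (b - a)) = 1"
  using cis_multiple_2pi[of "of_int l"] by (simp add: freq_def)

lemma integral_cis_freq:
  assumes "a < b"
  shows "(LINT x|Om a b. cis (freq a b k * (x - a)) *s (d :: complex^2)) = (if k = 0 then (b - a) *\<^sub>R d else 0)"
proof (cases "k = 0")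
  case True
  have "(LINT x|Om a b. d) = measure (Om a b) (space (Om a b)) *\<^sub>R d"
    by (rule lebesgue_integral_const)
  moreover have "measure (Om a b) {a<..<b} = b - a" using assms by (simp add: measure_def emeasure_Om)
  ultimately show ?thesis using True by (simp add: freq_def)
next
  case False
  define c where "c = freq a b k"
  have c: "c \<noteq> 0" using assms False by (simp add: c_def freq_def)
  define F where "F x = (- \<i> / of_real c) * cis (c * (x - a))" for x
  have "(F has_vector_derivative cis (c * (x - a))) (at x within S)" for x S
  proof -
    have "((\<lambda>x. cis (c * (x - a))) has_vector_derivative (c *\<^sub>R (\<i> * cis (c * (x - a))))) (at x within S)"
      unfolding has_vector_derivative_def
      by (rule has_derivative_eq_rhs, rule has_derivative_cis, auto intro!: derivative_eq_intros simp: algebra_simps scaleR_conv_of_real)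
    from has_vector_derivative_mult_right[OF this, of "- \<i> / of_real c"]
    show ?thesis unfolding F_def using c by (simp add: scaleR_conv_of_real field_simps)
  qed
  then have "(LBINT x=a..b. cis (c * (x - a))) = F b - F a"
    by (intro interval_integral_FTC_finite continuous_intros)
  also have "\<dots> = 0" using freq_periodic[OF assms, of k] unfolding F_def c_def by simp
  finally have z: "(LINT x|Om a b. cis (c * (x - a))) = 0"
    using assms by (simp add: interval_lebesgue_integral_def einterval_eq integral_Om)
  have "integrable (Om a b) (\<lambda>x. cis (c * (x - a)))"
    unfolding integrable_Om by (intro set_integrable_continuous_bounded_interval continuous_intros)
  then have "(LINT x|Om a b. cis (c * (x - a)) *s d) = (LINT x|Om a b. cis (c * (x - a))) *s d"
    by (rule integral_bounded_linear[OF bounded_linear_smult_left])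
  with z False show ?thesis by (simp add: c_def)
qed

lemma freq_diff: "freq a b l - freq a b m = freq a b (l - m)"
  by (simp add: freq_def field_simps add_divide_distrib[symmetric] diff_divide_distrib[symmetric])

lemma integral_inner_trig_sum:
  fixes u :: "real \<Rightarrow> complex^2"
  assumes "a < b" and u: "integrable (Om a b) u"
  shows "integrable (Om a b) (\<lambda>x. u x \<bullet> (\<Sum>l\<in>L. cis (freq a b l * (x - a)) *s d l))"
    and "(LINT x|Om a b. u x \<bullet> (\<Sum>l\<in>L. cis (freq a b l * (x - a)) *s d l))
       = (b - a) * (\<Sum>l\<in>L. fourier_coeff a b u l \<bullet> d l)"
proof -
  have e: "u x \<bullet> (\<Sum>l\<in>L. cis (freq a b l * (x - a)) *s d l) = (\<Sum>l\<in>L. (cis (- freq a b l * (x - a)) *s u x) \<bullet> d l)" for x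
    by (simp add: inner_sum_right inner_cis_smult)
  have i: "integrable (Om a b) (\<lambda>x. (cis (- freq a b l * (x - a)) *s u x) \<bullet> d l)" for l
    by (intro integrable_inner_left integrable_cis_smult u)
  show "integrable (Om a b) (\<lambda>x. u x \<bullet> (\<Sum>l\<in>L. cis (freq a b l * (x - a)) *s d l))"
    unfolding e by (intro Bochner_Integration.integrable_sum i)
  have "(LINT x|Om a b. u x \<bullet> (\<Sum>l\<in>L. cis (freq a b l * (x - a)) *s d l))
      = (\<Sum>l\<in>L. (LINT x|Om a b. cis (- freq a b l * (x - a)) *s u x) \<bullet> d l)"
    unfolding e by (subst Bochner_Integration.integral_sum[OF i])
      (intro sum.cong refl integral_inner_left integrable_cis_smult u)
  also have "\<dots> = (\<Sum>l\<in>L. (b - a) * (fourier_coeff a b u l \<bullet> d l))"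
    using assms by (intro sum.cong) (auto simp: fourier_coeff_Om)
  finally show "(LINT x|Om a b. u x \<bullet> (\<Sum>l\<in>L. cis (freq a b l * (x - a)) *s d l))
       = (b - a) * (\<Sum>l\<in>L. fourier_coeff a b u l \<bullet> d l)"
    by (simp add: sum_distrib_left)
qed

lemma integrable_trig_sum: "integrable (Om a b) (\<lambda>x. \<Sum>l\<in>L. cis (freq a b l * (x - a)) *s (d l :: complex^2))"
  by (intro Bochner_Integration.integrable_sum integrable_cis_smult finite_measure.integrable_const finite_measure_Om)

lemma fourier_coeff_trig_sum:
  assumes "a < b" "finite L"
  shows "fourier_coeff a b (\<lambda>x. \<Sum>l\<in>L. cis (freq a b l * (x - a)) *s d l) m = (if m \<in> L then d m else 0)"
proof -
  have "(LINT x|Om a b. cis (- freq a b m * (x - a)) *s (\<Sum>l\<in>L. cis (freq a b l * (x - a)) *s d l))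
      = (LINT x|Om a b. (\<Sum>l\<in>L. cis (freq a b (l - m) * (x - a)) *s d l))"
  proof -
    have "cis (- freq a b m * (x - a)) *s (cis (freq a b l * (x - a)) *s d l) = cis (freq a b (l - m) * (x - a)) *s d l" for l x
      unfolding freq_diff[symmetric] by (subst cis_smult_smult) (simp add: algebra_simps)
    then show ?thesis
      by (simp only: linear_sum[OF bounded_linear.linear[OF bounded_linear_smult]])
  qed
  also have "\<dots> = (\<Sum>l\<in>L. (LINT x|Om a b. cis (freq a b (l - m) * (x - a)) *s d l))"
    by (intro Bochner_Integration.integral_sum integrable_cis_smult finite_measure.integrable_const finite_measure_Om)
  also have "\<dots> = (\<Sum>l\<in>L. if l = m then (b - a) *\<^sub>R d l else 0)"
    by (simp add: integral_cis_freq[OF \<open>a < b\<close>])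
  also have "\<dots> = (if m \<in> L then (b - a) *\<^sub>R d m else 0)" using \<open>finite L\<close> by simp
  finally show ?thesis using \<open>a < b\<close> by (simp add: fourier_coeff_Om)
qed

text \<open>Completing the square.  The identity contains Bessel's inequality, Parseval's identity for
  trigonometric polynomials (\<open>u = 0\<close>), and the fact that the Fourier projection is the best approximation.\<close>

theorem trig_sum_Pythagoras:
  fixes u :: "real \<Rightarrow> complex^2"
  assumes "a < b" "finite L" and u: "L2_le (Om a b) K u"
  shows "(LINT x|Om a b. (norm (u x - (\<Sum>l\<in>L. cis (freq a b l * (x - a)) *s d l)))\<^sup>2)
    = (LINT x|Om a b. (norm (u x))\<^sup>2) - (b - a) * (\<Sum>l\<in>L. (norm (fourier_coeff a b u l))\<^sup>2)
      + (b - a) * (\<Sum>l\<in>L. (norm (fourier_coeff a b u l - d l))\<^sup>2)"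
proof -
  let ?p = "\<lambda>x. \<Sum>l\<in>L. cis (freq a b l * (x - a)) *s d l"
  have e: "(norm (u x - ?p x))\<^sup>2 = (norm (u x))\<^sup>2 - 2 * (u x \<bullet> ?p x) + ?p x \<bullet> ?p x" for x
    by (simp add: power2_norm_eq_inner inner_diff_left inner_diff_right inner_commute)
  have "(LINT x|Om a b. (norm (u x - ?p x))\<^sup>2)
      = (LINT x|Om a b. (norm (u x))\<^sup>2) - 2 * (LINT x|Om a b. u x \<bullet> ?p x) + (LINT x|Om a b. ?p x \<bullet> ?p x)"
    unfolding e using integral_inner_trig_sum(1)[OF \<open>a < b\<close>] L2_le_integrable[OF u] integrable_trig_sum
    by (subst Bochner_Integration.integral_add Bochner_Integration.integral_diff; force)+
  also have "\<dots> = (LINT x|Om a b. (norm (u x))\<^sup>2) - 2 * ((b - a) * (\<Sum>l\<in>L. fourier_coeff a b u l \<bullet> d l))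
      + (b - a) * (\<Sum>l\<in>L. d l \<bullet> d l)"
    using integral_inner_trig_sum(2)[OF \<open>a < b\<close> L2_le_integrable(1)[OF u], where L=L and d=d]
      integral_inner_trig_sum(2)[OF \<open>a < b\<close> integrable_trig_sum, where L=L and d=d and L1=L and d1=d]
      fourier_coeff_trig_sum[OF \<open>a < b\<close> \<open>finite L\<close>, where d=d] by simp
  also have "\<dots> = (LINT x|Om a b. (norm (u x))\<^sup>2) - (b - a) * (\<Sum>l\<in>L. (norm (fourier_coeff a b u l))\<^sup>2)
      + (b - a) * (\<Sum>l\<in>L. (norm (fourier_coeff a b u l - d l))\<^sup>2)"
    by (simp add: power2_norm_eq_inner inner_diff_left inner_diff_right inner_commute sum_subtractf sum.distrib
        sum_distrib_left[symmetric] algebra_simps)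
  finally show ?thesis .
qed

lemma Bessel:
  assumes "a < b" "finite L" and u: "L2_le (Om a b) K u"
  shows "(b - a) * (\<Sum>l\<in>L. (norm (fourier_coeff a b u l))\<^sup>2) \<le> K\<^sup>2"
proof -
  have "0 \<le> (LINT x|Om a b. (norm (u x - (\<Sum>l\<in>L. cis (freq a b l * (x - a)) *s fourier_coeff a b u l)))\<^sup>2)"
    by (rule Bochner_Integration.integral_nonneg) simp
  then show ?thesis
    using trig_sum_Pythagoras[OF assms, where d="fourier_coeff a b u"] L2_le_integrable(3)[OF u] by simp
qed

lemma finite_T_idx: "finite (T_idx N)"
  by (simp add: T_idx_def)

text \<open>Only the contraction property of \<open>1 - P\<^sub>N\<close>: it transports a projection error from one time to
  another at the cost of the increment of the function.\<close>

lemma L2_le_projection_error: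
  assumes "a < b" and u: "L2_le (Om a b) K u"
  shows "L2_le (Om a b) K (\<lambda>x. u x - trig_poly a b N (fourier_coeff a b u) x)"
proof -
  obtain L where "L2_le (Om a b) L (trig_poly a b N (fourier_coeff a b u))"
    using L2_le_trig_sum[of a b] \<open>a < b\<close> unfolding trig_poly_def by (auto simp: less_imp_le)
  from L2_le_diff[OF u this] have d: "L2_le (Om a b) (K + L) (\<lambda>x. u x - trig_poly a b N (fourier_coeff a b u) x)" .
  have "0 \<le> (b - a) * (\<Sum>l\<in>T_idx N. (norm (fourier_coeff a b u l))\<^sup>2)"
    using \<open>a < b\<close> by (intro mult_nonneg_nonneg sum_nonneg) auto
  then have "(LINT x|Om a b. (norm (u x - trig_poly a b N (fourier_coeff a b u) x))\<^sup>2) \<le> K\<^sup>2"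
    using trig_sum_Pythagoras[OF \<open>a < b\<close> finite_T_idx u, where d="fourier_coeff a b u"] L2_le_integrable(3)[OF u]
    unfolding trig_poly_def by simp
  then show ?thesis using L2_le_integrable[OF d] d u by (intro L2_leI) (auto simp: L2_le_def)
qed

lemma L2_le_trig_poly:
  assumes "a < b" "0 \<le> K" and "(b - a) * (\<Sum>l\<in>T_idx N. (norm (c l))\<^sup>2) \<le> K\<^sup>2"
  shows "L2_le (Om a b) K (trig_poly a b N c)"
proof -
  obtain L where L: "L2_le (Om a b) L (trig_poly a b N c)"
    using L2_le_trig_sum[of a b] \<open>a < b\<close> unfolding trig_poly_def by (auto simp: less_imp_le)
  have z: "L2_le (Om a b) 0 (\<lambda>x. 0 :: complex^2)" by (simp add: L2_le_def)
  have z': "fourier_coeff a b (\<lambda>x. 0 :: complex^2) l = 0" for l by (simp add: fourier_coeff_Om)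
  have "(LINT x|Om a b. (norm (trig_poly a b N c x))\<^sup>2) \<le> K\<^sup>2"
    using trig_sum_Pythagoras[OF \<open>a < b\<close> finite_T_idx z, where d=c] assms unfolding trig_poly_def
    by (simp add: z' norm_minus_commute)
  then show ?thesis using L2_le_integrable[OF L] L assms by (intro L2_leI) (auto simp: L2_le_def)
qed

section \<open>Density of trigonometric polynomials\<close>

text \<open>Trigonometric polynomials with arbitrary finite spectrum, which form an algebra;
  \<open>trig_poly\<close> has a fixed spectrum and does not.\<close>

definition trig_scalar :: "(real \<Rightarrow> complex) \<Rightarrow> bool" where
  "trig_scalar r \<longleftrightarrow> (\<exists>L d. finite L \<and> (\<forall>\<theta>. r \<theta> = (\<Sum>l\<in>L. cis (of_int l * \<theta>) * d l)))"

lemma trig_scalar_monom: "trig_scalar (\<lambda>\<theta>. cis (of_int l * \<theta>) * c)"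
  unfolding trig_scalar_def by (rule exI[of _ "{l}"], rule exI[of _ "\<lambda>_. c"]) simp

lemma trig_scalar_const: "trig_scalar (\<lambda>\<theta>. c)"
  using trig_scalar_monom[of 0 c] by simp

lemma trig_scalar_add:
  assumes "trig_scalar r" "trig_scalar s"
  shows "trig_scalar (\<lambda>\<theta>. r \<theta> + s \<theta>)"
proof -
  obtain L d L' d' where r: "finite L" "\<And>\<theta>. r \<theta> = (\<Sum>l\<in>L. cis (of_int l * \<theta>) * d l)"
    and s: "finite L'" "\<And>\<theta>. s \<theta> = (\<Sum>l\<in>L'. cis (of_int l * \<theta>) * d' l)"
    using assms unfolding trig_scalar_def by blast
  have "r \<theta> = (\<Sum>l\<in>L \<union> L'. cis (of_int l * \<theta>) * (if l \<in> L then d l else 0))" for \<theta>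
    unfolding r(2) using r(1) s(1) by (intro sum.mono_neutral_cong_left) auto
  moreover have "s \<theta> = (\<Sum>l\<in>L \<union> L'. cis (of_int l * \<theta>) * (if l \<in> L' then d' l else 0))" for \<theta>
    unfolding s(2) using r(1) s(1) by (intro sum.mono_neutral_cong_left) auto
  ultimately have "r \<theta> + s \<theta> = (\<Sum>l\<in>L \<union> L'. cis (of_int l * \<theta>) * ((if l \<in> L then d l else 0) + (if l \<in> L' then d' l else 0)))" for \<theta>
    by (simp add: sum.distrib distrib_left)
  then show ?thesis unfolding trig_scalar_def using r(1) s(1)
    by (intro exI[of _ "L \<union> L'"] exI[of _ "\<lambda>l. (if l \<in> L then d l else 0) + (if l \<in> L' then d' l else 0)"]) simp
qed

lemma trig_scalar_sum:
  "finite A \<Longrightarrow> (\<And>i. i \<in> A \<Longrightarrow> trig_scalar (f i)) \<Longrightarrow> trig_scalar (\<lambda>\<theta>. \<Sum>i\<in>A. f i \<theta>)"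
  by (induction A rule: finite_induct) (auto intro: trig_scalar_add trig_scalar_const)

lemma trig_scalar_mult:
  assumes "trig_scalar r" "trig_scalar s"
  shows "trig_scalar (\<lambda>\<theta>. r \<theta> * s \<theta>)"
proof -
  obtain L d L' d' where r: "finite L" "\<And>\<theta>. r \<theta> = (\<Sum>l\<in>L. cis (of_int l * \<theta>) * d l)"
    and s: "finite L'" "\<And>\<theta>. s \<theta> = (\<Sum>l\<in>L'. cis (of_int l * \<theta>) * d' l)"
    using assms unfolding trig_scalar_def by blast
  have "r \<theta> * s \<theta> = (\<Sum>l\<in>L. \<Sum>m\<in>L'. cis (of_int (l + m) * \<theta>) * (d l * d' m))" for \<theta>
    unfolding r(2) s(2) sum_product
    by (intro sum.cong refl) (simp add: distrib_right cis_mult[symmetric])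
  then show ?thesis
    using r(1) s(1) by (simp only:) (intro trig_scalar_sum trig_scalar_monom)
qed

text \<open>On the unit circle the real and imaginary parts of \<open>z\<close> are combinations of \<open>z\<close> and
  \<open>1 / z\<close>.\<close>

lemma trig_scalar_real_polynomial:
  "real_polynomial_function p \<Longrightarrow> trig_scalar (\<lambda>\<theta>. complex_of_real (p (cis \<theta>)))"
proof (induction rule: real_polynomial_function.induct)
  case (linear f)
  interpret bounded_linear f by fact
  have "complex_of_real (f (cis \<theta>)) = cis (of_int 1 * \<theta>) * ((f 1 - \<i> * f \<i>) / 2) + cis (of_int (-1) * \<theta>) * ((f 1 + \<i> * f \<i>) / 2)" for \<theta>
  proof -
    have "cis \<theta> = cos \<theta> *\<^sub>R 1 + sin \<theta> *\<^sub>R \<i>" by (simp add: complex_eq_iff)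
    then have "f (cis \<theta>) = cos \<theta> * f 1 + sin \<theta> * f \<i>" by (simp only: add scaleR) simp
    then show ?thesis by (simp add: complex_eq_iff field_simps)
  qed
  then show ?case by (simp only:) (intro trig_scalar_add trig_scalar_monom)
qed (auto intro: trig_scalar_add trig_scalar_mult trig_scalar_const)

definition trig_vector :: "(real \<Rightarrow> complex^2) \<Rightarrow> bool" where
  "trig_vector r \<longleftrightarrow> (\<exists>L d. finite L \<and> (\<forall>\<theta>. r \<theta> = (\<Sum>l\<in>L. cis (of_int l * \<theta>) *s d l)))"

lemma trig_vector_of_components:
  assumes "\<And>i. trig_scalar (\<lambda>\<theta>. r \<theta> $ i)"
  shows "trig_vector r"
proof -
  have "\<forall>i. \<exists>L d. finite L \<and> (\<forall>\<theta>. r \<theta> $ i = (\<Sum>l\<in>L. cis (of_int l * \<theta>) * d l))"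
    using assms unfolding trig_scalar_def by blast
  then obtain L d where Ld: "\<And>i. finite (L i)" "\<And>i \<theta>. r \<theta> $ i = (\<Sum>l\<in>L i. cis (of_int l * \<theta>) * d i l)"
    by metis
  define L' where "L' = (\<Union>i. L i)"
  have fin: "finite L'" using Ld(1) by (auto simp: L'_def)
  have "r \<theta> = (\<Sum>l\<in>L'. cis (of_int l * \<theta>) *s (\<chi> i. if l \<in> L i then d i l else 0))" for \<theta>
  proof (rule vec_eq_iff[THEN iffD2], rule allI)
    fix i
    have "(\<Sum>l\<in>L i. cis (of_int l * \<theta>) * d i l) = (\<Sum>l\<in>L'. cis (of_int l * \<theta>) * (if l \<in> L i then d i l else 0))"
      using fin by (intro sum.mono_neutral_cong_left) (auto simp: L'_def)
    then show "r \<theta> $ i = (\<Sum>l\<in>L'. cis (of_int l * \<theta>) *s (\<chi> i. if l \<in> L i then d i l else 0)) $ i"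
      by (simp add: Ld(2))
  qed
  with fin show ?thesis unfolding trig_vector_def
    by (intro exI[of _ L'] exI[of _ "\<lambda>l. \<chi> i. if l \<in> L i then d i l else 0"]) simp
qed

lemma trig_vector_polynomial:
  fixes g :: "complex \<Rightarrow> complex^2"
  assumes "polynomial_function g"
  shows "trig_vector (\<lambda>\<theta>. g (cis \<theta>))"
proof (rule trig_vector_of_components)
  fix i
  have "bounded_linear (\<lambda>v :: complex^2. Re (v $ i))" "bounded_linear (\<lambda>v :: complex^2. Im (v $ i))"
    by (intro bounded_linear_compose[OF bounded_linear_Re bounded_linear_vec_nth]
       bounded_linear_compose[OF bounded_linear_Im bounded_linear_vec_nth])+
  then have "real_polynomial_function ((\<lambda>v. Re (v $ i)) \<circ> g)" "real_polynomial_function ((\<lambda>v. Im (v $ i)) \<circ> g)"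
    using assms unfolding polynomial_function_def by blast+
  then have "real_polynomial_function (\<lambda>z. Re (g z $ i))" "real_polynomial_function (\<lambda>z. Im (g z $ i))"
    by (simp_all add: o_def)
  then have "trig_scalar (\<lambda>\<theta>. complex_of_real (Re (g (cis \<theta>) $ i)) + complex_of_real (Im (g (cis \<theta>) $ i)) * \<i>)"
    by (intro trig_scalar_add trig_scalar_mult trig_scalar_const trig_scalar_real_polynomial)
  moreover have "complex_of_real (Re z) + complex_of_real (Im z) * \<i> = z" for z by (simp add: complex_eq_iff)
  ultimately show "trig_scalar (\<lambda>\<theta>. g (cis \<theta>) $ i)" by simp
qed

text \<open>A continuous function with equal values at the end points is a continuous function on the
  circle.  There the Stone--Weierstrass theorem provides polynomials in the real and imaginary parts,
  which are trigonometric polynomials in the angle.\<close>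

theorem trig_dense:
  fixes w :: "real \<Rightarrow> complex^2"
  assumes "a < b" and w: "continuous_on {a..b} w" "w a = w b" and e: "e > 0"
  shows "\<exists>L d. finite L \<and> (\<forall>x\<in>{a..b}. norm (w x - (\<Sum>l\<in>L. cis (freq a b l * (x - a)) *s d l)) < e)"
proof -
  define p where "p t = w (a + (b - a) * t)" for t
  have "a + (b - a) * t \<le> b" if "t \<in> {0..1}" for t
  proof -
    have "(b - a) * t \<le> (b - a) * 1" using that \<open>a < b\<close> by (intro mult_left_mono) auto
    then show ?thesis by (simp add: algebra_simps)
  qed
  then have p: "path p" unfolding path_def p_def using \<open>a < b\<close>
    by (intro continuous_on_compose2[OF w(1)] continuous_intros) auto
  have pf: "pathfinish p = pathstart p" using w(2) by (simp add: pathfinish_def pathstart_def p_def)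
  define f where "f = p \<circ> (\<lambda>z. Arg2pi z / (2 * pi))"
  \<comment> \<open>The trivial homotopy serves to pass from a closed path to a continuous map on the circle.\<close>
  have "homotopic_loops UNIV p p" using p pf by (simp add: homotopic_loops_refl)
  then have "homotopic_with_canon (\<lambda>h. True) (sphere 0 1) UNIV f f"
    unfolding f_def by (rule homotopic_loops_imp_homotopic_circlemaps)
  then have "continuous_on (sphere 0 1) f" by (auto dest: homotopic_with_imp_continuous)
  then obtain g where g: "polynomial_function g" "\<And>z. z \<in> sphere 0 1 \<Longrightarrow> norm (f z - g z) < e"
    using Stone_Weierstrass_polynomial_function[OF _ _ e, of "sphere 0 1" f] by auto
  obtain L d where L: "finite L" "\<And>\<theta>. g (cis \<theta>) = (\<Sum>l\<in>L. cis (of_int l * \<theta>) *s d l)"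
    using trig_vector_polynomial[OF g(1)] unfolding trig_vector_def by blast
  have "norm (w x - (\<Sum>l\<in>L. cis (freq a b l * (x - a)) *s d l)) < e" if x: "x \<in> {a..b}" for x
  proof -
    define \<theta> where "\<theta> = 2 * pi * (x - a) / (b - a)"
    have fw: "f (cis \<theta>) = w x"
    proof (cases "x = b")
      case True
      then have "cis \<theta> = of_real 1" using \<open>a < b\<close> cis_2pi by (simp add: \<theta>_def)
      then show ?thesis using True w(2) by (simp add: f_def p_def Arg2pi_of_real del: of_real_1)
    next
      case False
      then have "0 \<le> \<theta>" "\<theta> < 2 * pi" using x \<open>a < b\<close> by (auto simp: \<theta>_def field_simps)
      then have "Arg2pi (cis \<theta>) = \<theta>" by (intro Arg2pi_unique[of 1]) (auto simp: cis_conv_exp)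
      then show ?thesis using \<open>a < b\<close> by (simp add: f_def p_def \<theta>_def)
    qed
    have "norm (f (cis \<theta>) - g (cis \<theta>)) < e" by (intro g(2)) simp
    moreover have "of_int l * \<theta> = freq a b l * (x - a)" for l by (simp add: \<theta>_def freq_def)
    ultimately show ?thesis by (simp add: fw L(2))
  qed
  with L(1) show ?thesis by blast
qed

section \<open>Fourier coefficients of weak derivatives and the projection error\<close>

lemma L2_norm_le_iff: "0 \<le> K \<Longrightarrow> L2_norm a b u \<le> ereal K \<longleftrightarrow> L2_le (Om a b) K u"
proof -
  assume K: "0 \<le> K"
  have sq: "(sqrt I \<le> K) = (I \<le> K\<^sup>2)" for I using K real_sqrt_le_iff[of I "K\<^sup>2"] by simp
  let ?m = "u \<in> borel_measurable (Om a b)" and ?i = "integrable (Om a b) (\<lambda>x. (norm (u x))\<^sup>2)"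
  have n: "L2_norm a b u = (if ?m \<and> ?i then ereal (sqrt (LINT x|Om a b. (norm (u x))\<^sup>2)) else \<infinity>)"
    unfolding L2_norm_def borel_measurable_Om integrable_Om integral_Om ..
  show ?thesis
  proof
    assume "L2_norm a b u \<le> ereal K"
    then have "?m" "?i" "(LINT x|Om a b. (norm (u x))\<^sup>2) \<le> K\<^sup>2"
      unfolding n by (simp_all add: sq split: if_splits)
    then show "L2_le (Om a b) K u" using K by (rule L2_leI)
  next
    assume u: "L2_le (Om a b) K u"
    then have "?m" by (simp add: L2_le_def)
    with L2_le_integrable[OF u] show "L2_norm a b u \<le> ereal K" unfolding n by (simp add: sq)
  qed
qed

lemma integrable_continuous_scaleR:
  fixes u :: "real \<Rightarrow> 'v::{banach, second_countable_topology}"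
  assumes g: "continuous_on UNIV (g :: real \<Rightarrow> real)" and u: "integrable (Om a b) u"
  shows "integrable (Om a b) (\<lambda>x. g x *\<^sub>R u x)"
proof -
  have "bounded (g ` {a..b})"
    using g by (intro compact_imp_bounded compact_continuous_image continuous_on_subset[OF g]) auto
  then obtain K where K: "\<And>x. x \<in> {a..b} \<Longrightarrow> \<bar>g x\<bar> \<le> K" unfolding bounded_iff by (auto simp del: atLeastAtMost_iff)
  have gm: "g \<in> borel_measurable (Om a b)" using g by (intro measurable_Om borel_measurable_continuous_onI)
  show ?thesis
  proof (rule Bochner_Integration.integrable_bound)
    show "integrable (Om a b) (\<lambda>x. K * norm (u x))" using u by auto
    show "(\<lambda>x. g x *\<^sub>R u x) \<in> borel_measurable (Om a b)"
      using gm u by (intro borel_measurable_scaleR) auto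
    show "AE x in Om a b. norm (g x *\<^sub>R u x) \<le> norm (K * norm (u x))"
    proof (rule AE_I2)
      fix x assume "x \<in> space (Om a b)"
      then have "\<bar>g x\<bar> \<le> \<bar>K\<bar>" using K[of x] by auto
      then show "norm (g x *\<^sub>R u x) \<le> norm (K * norm (u x))" by (simp add: abs_mult mult_right_mono)
    qed
  qed
qed

lemma test_function_mult:
  assumes \<phi>: "test_function \<alpha> \<beta> \<phi>" and g: "\<And>x. (g has_real_derivative g' x) (at x)" "continuous_on UNIV g'"
  shows "test_function \<alpha> \<beta> (\<lambda>x. \<phi> x * g x)"
    and "deriv (\<lambda>x. \<phi> x * g x) = (\<lambda>x. deriv \<phi> x * g x + \<phi> x * g' x)"
proof -
  have d: "(\<phi> has_real_derivative deriv \<phi> x) (at x)" for x using \<phi> by (simp add: test_function_def)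
  have D: "((\<lambda>x. \<phi> x * g x) has_real_derivative (deriv \<phi> x * g x + \<phi> x * g' x)) (at x)" for x
    using DERIV_mult[OF d g(1)] by (simp add: mult.commute add.commute)
  show e: "deriv (\<lambda>x. \<phi> x * g x) = (\<lambda>x. deriv \<phi> x * g x + \<phi> x * g' x)"
    using D by (auto intro: DERIV_imp_deriv)
  have c: "continuous_on UNIV \<phi>" "continuous_on UNIV g" "continuous_on UNIV (deriv \<phi>)"
    using d g(1) \<phi> by (auto intro!: continuous_at_imp_continuous_on DERIV_isCont simp: test_function_def)
  show "test_function \<alpha> \<beta> (\<lambda>x. \<phi> x * g x)"
    unfolding test_function_def e
  proof (intro conjI)
    show "\<forall>x. ((\<lambda>x. \<phi> x * g x) has_real_derivative deriv \<phi> x * g x + \<phi> x * g' x) (at x)" using D by blast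
    show "continuous_on UNIV (\<lambda>x. deriv \<phi> x * g x + \<phi> x * g' x)"
      by (intro continuous_intros c g(2))
    show "\<exists>c d. \<alpha> < c \<and> d < \<beta> \<and> (\<forall>x. x \<notin> {c..d} \<longrightarrow> \<phi> x * g x = 0)"
      using \<phi> unfolding test_function_def by fastforce
  qed
qed

text \<open>The product of a weakly differentiable and a \<open>C\<^sup>1\<close> function has the expected weak derivative,
  because a test function times a \<open>C\<^sup>1\<close> function is again a test function; the fundamental theorem applies to
  that product.\<close>

lemma weak_integration_by_parts:
  fixes u v w :: "real \<Rightarrow> 'v::{banach, second_countable_topology}"
  assumes "a < b" and D: "has_weak_deriv a b u v"
    and w: "continuous_on {a..b} w" "AE x in Om a b. u x = w x"
    and g: "\<And>x. (g has_real_derivative g' x) (at x)" "continuous_on UNIV g'"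
  shows "g b *\<^sub>R w b - g a *\<^sub>R w a = (LINT x|Om a b. g x *\<^sub>R v x) + (LINT x|Om a b. g' x *\<^sub>R u x)"
proof -
  have gc: "continuous_on UNIV g" using g(1) by (auto intro!: continuous_at_imp_continuous_on DERIV_isCont)
  have iu: "integrable (Om a b) u" and iv: "integrable (Om a b) v"
    using D by (auto simp: has_weak_deriv_def integrable_Om)
  have iw: "integrable (Om a b) w"
    using w(1) unfolding integrable_Om by (rule set_integrable_continuous_bounded_interval)
  have cong: "(LINT x|Om a b. f x *\<^sub>R u x) = (LINT x|Om a b. f x *\<^sub>R w x)" if f: "continuous_on UNIV f" for f :: "real \<Rightarrow> real"
    using integrable_continuous_scaleR[OF f iu] integrable_continuous_scaleR[OF f iw] w(2)
    by (intro integral_cong_AE) (auto elim!: eventually_mono)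
  have ig: "integrable (Om a b) (\<lambda>x. g x *\<^sub>R v x)" "integrable (Om a b) (\<lambda>x. g' x *\<^sub>R w x)"
    by (intro integrable_continuous_scaleR gc g(2) iv iw)+
  have "g b *\<^sub>R w b - g a *\<^sub>R w a = (LINT x:{a<..<b}|lborel. g x *\<^sub>R v x + g' x *\<^sub>R w x)"
  proof (rule weak_FTC[OF \<open>a < b\<close>])
    show "continuous_on {a..b} (\<lambda>x. g x *\<^sub>R w x)"
      by (intro continuous_intros continuous_on_subset[OF gc] w(1)) auto
    show "set_integrable lborel {a<..<b} (\<lambda>x. g x *\<^sub>R v x + g' x *\<^sub>R w x)"
      unfolding integrable_Om[symmetric] by (intro Bochner_Integration.integrable_add ig)
    fix \<phi> assume \<phi>: "test_function a b \<phi>"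
    note T = test_function_mult[OF \<phi> g]
    have c: "continuous_on UNIV \<phi>" "continuous_on UNIV (deriv \<phi>)"
      using \<phi> by (auto intro!: continuous_at_imp_continuous_on DERIV_isCont simp: test_function_def)
    have i: "integrable (Om a b) (\<lambda>x. (deriv \<phi> x * g x) *\<^sub>R w x)" "integrable (Om a b) (\<lambda>x. (\<phi> x * g' x) *\<^sub>R w x)"
       "integrable (Om a b) (\<lambda>x. (\<phi> x * g x) *\<^sub>R v x)"
      by (intro integrable_continuous_scaleR continuous_intros c gc g(2) iw iv)+
    have "(LINT x|Om a b. (deriv \<phi> x * g x + \<phi> x * g' x) *\<^sub>R u x) = - (LINT x|Om a b. (\<phi> x * g x) *\<^sub>R v x)"
      using D[unfolded has_weak_deriv_def, THEN conjunct2, THEN conjunct2, rule_format, OF T(1)]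
      unfolding T(2) integral_Om .
    moreover have "(LINT x|Om a b. (deriv \<phi> x * g x + \<phi> x * g' x) *\<^sub>R u x)
        = (LINT x|Om a b. (deriv \<phi> x * g x) *\<^sub>R w x) + (LINT x|Om a b. (\<phi> x * g' x) *\<^sub>R w x)"
      by (subst cong) (intro continuous_intros c gc g(2), simp add: scaleR_add_left i)
    moreover have "(LINT x|Om a b. \<phi> x *\<^sub>R (g x *\<^sub>R v x + g' x *\<^sub>R w x))
        = (LINT x|Om a b. (\<phi> x * g x) *\<^sub>R v x) + (LINT x|Om a b. (\<phi> x * g' x) *\<^sub>R w x)"
      using i by (simp add: scaleR_add_right)
    ultimately show "(LINT x:{a<..<b}|lborel. deriv \<phi> x *\<^sub>R g x *\<^sub>R w x)
        = - (LINT x:{a<..<b}|lborel. \<phi> x *\<^sub>R (g x *\<^sub>R v x + g' x *\<^sub>R w x))"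
      unfolding integral_Om[symmetric] by (simp add: algebra_simps)
  qed
  then show ?thesis
    unfolding integral_Om[symmetric] cong[OF g(2)] using ig by simp
qed

lemma integral_cis_smult:
  fixes u :: "real \<Rightarrow> complex^2"
  assumes "integrable (Om \<alpha> \<beta>) u"
  shows "(LINT x|Om \<alpha> \<beta>. cis (- c * (x - a)) *s u x)
    = (LINT x|Om \<alpha> \<beta>. cos (c * (x - a)) *\<^sub>R u x) - \<i> *s (LINT x|Om \<alpha> \<beta>. sin (c * (x - a)) *\<^sub>R u x)"
proof -
  have i: "integrable (Om \<alpha> \<beta>) (\<lambda>x. cos (c * (x - a)) *\<^sub>R u x)" "integrable (Om \<alpha> \<beta>) (\<lambda>x. sin (c * (x - a)) *\<^sub>R u x)"
    by (intro integrable_continuous_scaleR continuous_intros assms)+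
  have "cis (- c * (x - a)) *s u x = cos (c * (x - a)) *\<^sub>R u x - \<i> *s (sin (c * (x - a)) *\<^sub>R u x)" for x
    by (simp add: vec_eq_iff complex_eq_iff)
  then show ?thesis
    using i integrable_bounded_linear[OF bounded_linear_smult[of \<i>] i(2)]
    by (simp add: integral_bounded_linear[OF bounded_linear_smult[of \<i>]])
qed

text \<open>Integration by parts against cosine and sine; the boundary terms cancel by periodicity.\<close>

theorem fourier_coeff_weak_deriv:
  assumes "a < b" and D: "has_weak_deriv a b u v" and P: "periodic_trace a b u"
  shows "fourier_coeff a b v l = (\<i> * of_real (freq a b l)) *s fourier_coeff a b u l"
proof -
  obtain w where w: "continuous_on {a..b} w" "AE x in Om a b. u x = w x" "w a = w b"
    using P unfolding periodic_trace_def AE_Om by blast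
  define c where "c = freq a b l"
  have iu: "integrable (Om a b) u" and iv: "integrable (Om a b) v"
    using D by (auto simp: has_weak_deriv_def integrable_Om)
  have "cis (c * (b - a)) = 1" unfolding c_def by (rule freq_periodic[OF \<open>a < b\<close>])
  then have per: "cos (c * (b - a)) = 1" "sin (c * (b - a)) = 0"
    by (simp_all add: complex_eq_iff)
  have 1: "(LINT x|Om a b. cos (c * (x - a)) *\<^sub>R v x) = c *\<^sub>R (LINT x|Om a b. sin (c * (x - a)) *\<^sub>R u x)"
  proof -
    have "cos (c * (b - a)) *\<^sub>R w b - cos (c * (a - a)) *\<^sub>R w a
        = (LINT x|Om a b. cos (c * (x - a)) *\<^sub>R v x) + (LINT x|Om a b. (- c * sin (c * (x - a))) *\<^sub>R u x)"
      by (rule weak_integration_by_parts[OF \<open>a < b\<close> D w(1,2)])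
        (auto intro!: derivative_eq_intros continuous_intros)
    moreover have "(LINT x|Om a b. (- c * sin (c * (x - a))) *\<^sub>R u x) = - c *\<^sub>R (LINT x|Om a b. sin (c * (x - a)) *\<^sub>R u x)"
      by (simp flip: scaleR_scaleR)
    ultimately show ?thesis using per w(3) by simp
  qed
  have 2: "(LINT x|Om a b. sin (c * (x - a)) *\<^sub>R v x) = - c *\<^sub>R (LINT x|Om a b. cos (c * (x - a)) *\<^sub>R u x)"
  proof -
    have "sin (c * (b - a)) *\<^sub>R w b - sin (c * (a - a)) *\<^sub>R w a
        = (LINT x|Om a b. sin (c * (x - a)) *\<^sub>R v x) + (LINT x|Om a b. (c * cos (c * (x - a))) *\<^sub>R u x)"
      by (rule weak_integration_by_parts[OF \<open>a < b\<close> D w(1,2)])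
        (auto intro!: derivative_eq_intros continuous_intros)
    moreover have "(LINT x|Om a b. (c * cos (c * (x - a))) *\<^sub>R u x) = c *\<^sub>R (LINT x|Om a b. cos (c * (x - a)) *\<^sub>R u x)"
      by (simp flip: scaleR_scaleR)
    ultimately show ?thesis using per by (simp add: eq_neg_iff_add_eq_0)
  qed
  have "(LINT x|Om a b. cis (- c * (x - a)) *s v x) = (\<i> * of_real c) *s (LINT x|Om a b. cis (- c * (x - a)) *s u x)"
    unfolding integral_cis_smult[OF iu] integral_cis_smult[OF iv] 1 2
    by (simp add: vec_eq_iff complex_eq_iff algebra_simps)
  then show ?thesis unfolding fourier_coeff_Om c_def
    by (simp add: vec_eq_iff)
qed

lemma Hp_derivs_fourier_coeff:
  assumes "a < b" and D: "Hp_derivs a b m u D" and "k \<le> m"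
  shows "fourier_coeff a b (D k) l = (\<i> * of_real (freq a b l)) ^ k *s fourier_coeff a b u l"
  using \<open>k \<le> m\<close>
proof (induction k)
  case 0
  then show ?case using D by (simp add: Hp_derivs_def)
next
  case (Suc k)
  then have "has_weak_deriv a b (D k) (D (Suc k))" "periodic_trace a b (D k)"
    using D by (auto simp: Hp_derivs_def)
  with Suc show ?case by (simp add: fourier_coeff_weak_deriv[OF \<open>a < b\<close>])
qed

lemma freq_outside_T_idx:
  assumes "a < b" "even N" "N > 0" "l \<notin> T_idx N"
  shows "pi / ((b - a) / real N) \<le> \<bar>freq a b l\<bar>"
proof -
  obtain k where k: "N = 2 * k" using \<open>even N\<close> by blast
  have "int k \<le> \<bar>l\<bar>" using assms(4) by (auto simp: T_idx_def k)
  then have "real k \<le> \<bar>of_int l\<bar>" by linarith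
  then have "2 * pi * real k / (b - a) \<le> 2 * pi * \<bar>of_int l\<bar> / (b - a)"
    using \<open>a < b\<close> by (intro divide_right_mono mult_left_mono) auto
  then show ?thesis using \<open>a < b\<close> by (simp add: freq_def k abs_mult ac_simps)
qed

lemma freq_inside_T_idx:
  assumes "a < b" "even N" "N > 0" "l \<in> T_idx N"
  shows "\<bar>freq a b l\<bar> \<le> pi / ((b - a) / real N)"
proof -
  obtain k where k: "N = 2 * k" using \<open>even N\<close> by blast
  have "\<bar>l\<bar> \<le> int k" using assms(4) by (auto simp: T_idx_def k)
  then have "\<bar>of_int l\<bar> \<le> real k" by linarith
  then have "2 * pi * \<bar>of_int l\<bar> / (b - a) \<le> 2 * pi * real k / (b - a)"
    using \<open>a < b\<close> by (intro divide_right_mono mult_left_mono) auto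
  then show ?thesis using \<open>a < b\<close> by (simp add: freq_def k abs_mult ac_simps)
qed

text \<open>For a frequency outside \<open>\<T>\<^sub>N\<close> we have \<open>\<bar>\<mu>\<^sub>l\<bar> \<ge> \<pi> / h\<close>, so the coefficient of \<open>u\<close> is at most
  \<open>(h / \<pi>)\<^sup>m\<close> times that of the \<open>m\<close>-th derivative, and Bessel's inequality sums these bounds.  Density is what
  shows that nothing but these coefficients contributes to the error.\<close>

theorem projection_error:
  assumes "a < b" "even N" "N > 0" and h: "h = (b - a) / real N"
    and D: "Hp_derivs a b m u D" and "m \<ge> 1" and Dm: "L2_le (Om a b) K (D m)" and u: "L2_le (Om a b) K' u"
  shows "L2_le (Om a b) ((h / pi) ^ m * K) (\<lambda>x. u x - trig_poly a b N (fourier_coeff a b u) x)"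
proof -
  have h0: "h > 0" using assms by simp
  have K: "0 \<le> K" using Dm by (simp add: L2_le_def)
  define \<rho> where "\<rho> = ((h / pi) ^ m)\<^sup>2"
  define U where "U l = (norm (fourier_coeff a b u l))\<^sup>2" for l
  define E where "E = (LINT x|Om a b. (norm (u x - trig_poly a b N (fourier_coeff a b u) x))\<^sup>2)"
  have high: "U l \<le> \<rho> * (norm (fourier_coeff a b (D m) l))\<^sup>2" if "l \<notin> T_idx N" for l
  proof -
    have f: "pi / h \<le> \<bar>freq a b l\<bar>" using freq_outside_T_idx[OF assms(1-3) that] h by simp
    have "norm (fourier_coeff a b (D m) l) = \<bar>freq a b l\<bar> ^ m * norm (fourier_coeff a b u l)"
      unfolding Hp_derivs_fourier_coeff[OF \<open>a < b\<close> D order_refl] norm_smult by (simp add: norm_power norm_mult)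
    moreover have "1 \<le> (h / pi) ^ m * \<bar>freq a b l\<bar> ^ m"
      unfolding power_mult_distrib[symmetric] using f h0 by (intro one_le_power) (simp add: field_simps)
    then have "1 * norm (fourier_coeff a b u l) \<le> ((h / pi) ^ m * \<bar>freq a b l\<bar> ^ m) * norm (fourier_coeff a b u l)"
      by (rule mult_right_mono) simp
    ultimately have "norm (fourier_coeff a b u l) \<le> (h / pi) ^ m * norm (fourier_coeff a b (D m) l)"
      by (simp add: mult.assoc)
    then show ?thesis unfolding U_def \<rho>_def power_mult_distrib[symmetric] by (intro power_mono) auto
  qed
  have "periodic_trace a b u" using D \<open>m \<ge> 1\<close> by (auto simp: Hp_derivs_def dest: spec[of _ 0])
  then obtain w where w: "continuous_on {a..b} w" "AE x in Om a b. u x = w x" "w a = w b"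
    unfolding periodic_trace_def AE_Om by blast
  \<comment> \<open>A trigonometric polynomial close to \<open>u\<close> bounds the part of the \<open>L\<^sup>2\<close> norm outside its spectrum.\<close>
  have main: "E \<le> ((h / pi) ^ m * K)\<^sup>2 + e\<^sup>2 * (b - a)" if e: "e > 0" for e
  proof -
    obtain L d where L: "finite L" "\<And>x. x \<in> {a..b} \<Longrightarrow> norm (w x - (\<Sum>l\<in>L. cis (freq a b l * (x - a)) *s d l)) < e"
      using trig_dense[OF \<open>a < b\<close> w(1,3) e] by blast
    have "(LINT x|Om a b. (norm (u x - (\<Sum>l\<in>L. cis (freq a b l * (x - a)) *s d l)))\<^sup>2) \<le> e\<^sup>2 * (b - a)"
    proof -
      have "(LINT x|Om a b. (norm (u x - (\<Sum>l\<in>L. cis (freq a b l * (x - a)) *s d l)))\<^sup>2) \<le> (LINT x|Om a b. e\<^sup>2)"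
      proof (rule integral_mono_AE')
        show "integrable (Om a b) (\<lambda>x. e\<^sup>2)" by (intro finite_measure.integrable_const finite_measure_Om)
        show "AE x in Om a b. (norm (u x - (\<Sum>l\<in>L. cis (freq a b l * (x - a)) *s d l)))\<^sup>2 \<le> e\<^sup>2"
          using w(2) AE_space
        proof eventually_elim
          case (elim x)
          then show ?case using L(2)[of x] by (intro power_mono) auto
        qed
      qed auto
      also have "\<dots> = e\<^sup>2 * (b - a)"
        using \<open>a < b\<close> by (simp add: measure_def emeasure_Om)
      finally show ?thesis .
    qed
    moreover have "0 \<le> (b - a) * (\<Sum>l\<in>L. (norm (fourier_coeff a b u l - d l))\<^sup>2)"
      using \<open>a < b\<close> by (intro mult_nonneg_nonneg sum_nonneg) auto
    ultimately have 1: "(LINT x|Om a b. (norm (u x))\<^sup>2) \<le> e\<^sup>2 * (b - a) + (b - a) * sum U L"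
      using trig_sum_Pythagoras[OF \<open>a < b\<close> L(1) u, where d=d] unfolding U_def by linarith
    have 2: "E = (LINT x|Om a b. (norm (u x))\<^sup>2) - (b - a) * sum U (T_idx N)"
      using trig_sum_Pythagoras[OF \<open>a < b\<close> finite_T_idx u, where d="fourier_coeff a b u"]
      unfolding U_def E_def trig_poly_def by simp
    have "sum U L \<le> sum U (T_idx N) + sum U (L - T_idx N)"
    proof -
      have "sum U L \<le> sum U (T_idx N \<union> (L - T_idx N))"
        using L(1) finite_T_idx by (intro sum_mono2) (auto simp: U_def)
      also have "\<dots> = sum U (T_idx N) + sum U (L - T_idx N)"
        using L(1) finite_T_idx by (intro sum.union_disjoint) auto
      finally show ?thesis .
    qed
    then have 3: "(b - a) * sum U L \<le> (b - a) * sum U (T_idx N) + (b - a) * sum U (L - T_idx N)"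
      using \<open>a < b\<close> by (simp flip: distrib_left)
    have "(b - a) * sum U (L - T_idx N) \<le> (b - a) * (\<Sum>l\<in>L - T_idx N. \<rho> * (norm (fourier_coeff a b (D m) l))\<^sup>2)"
      using \<open>a < b\<close> high by (intro mult_left_mono sum_mono) auto
    also have "\<dots> = \<rho> * ((b - a) * (\<Sum>l\<in>L - T_idx N. (norm (fourier_coeff a b (D m) l))\<^sup>2))"
      by (simp add: sum_distrib_left ac_simps)
    also have "\<dots> \<le> \<rho> * K\<^sup>2"
      using Bessel[OF \<open>a < b\<close> _ Dm, of "L - T_idx N"] L(1) by (intro mult_left_mono) (auto simp: \<rho>_def)
    finally have 4: "(b - a) * sum U (L - T_idx N) \<le> ((h / pi) ^ m * K)\<^sup>2" by (simp add: \<rho>_def power_mult_distrib)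
    show ?thesis using 1 2 3 4 by linarith
  qed
  have "E \<le> ((h / pi) ^ m * K)\<^sup>2 + e" if "e > 0" for e
    using main[of "sqrt (e / (b - a))"] that \<open>a < b\<close> by simp
  then have "E \<le> ((h / pi) ^ m * K)\<^sup>2" by (rule field_le_epsilon)
  moreover have "L2_le (Om a b) K' (\<lambda>x. u x - trig_poly a b N (fourier_coeff a b u) x)"
    by (rule L2_le_projection_error[OF \<open>a < b\<close> u])
  ultimately show ?thesis
    using L2_le_integrable(2) K h0 unfolding E_def by (intro L2_leI) (auto simp: L2_le_def)
qed

lemma fourier_coeff_cong_AE:
  assumes "u \<in> borel_measurable (Om a b)" "v \<in> borel_measurable (Om a b)" "AE x in Om a b. u x = v x"
  shows "fourier_coeff a b u l = fourier_coeff a b v l"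
proof -
  have "(LINT x|Om a b. cis (- freq a b l * (x - a)) *s u x) = (LINT x|Om a b. cis (- freq a b l * (x - a)) *s v x)"
  proof (rule integral_cong_AE)
    show "AE x in Om a b. cis (- freq a b l * (x - a)) *s u x = cis (- freq a b l * (x - a)) *s v x"
      using assms(3) by eventually_elim simp
  qed (rule measurable_smult[OF measurable_cis_affine], rule assms)+
  then show ?thesis unfolding fourier_coeff_Om by (rule arg_cong)
qed

lemma fourier_coeff_add:
  assumes "integrable (Om a b) u" "integrable (Om a b) v"
  shows "fourier_coeff a b (\<lambda>x. u x + v x) l = fourier_coeff a b u l + fourier_coeff a b v l"
  using Bochner_Integration.integral_add[OF integrable_cis_smult[OF assms(1)] integrable_cis_smult[OF assms(2)],
      of "- freq a b l" a "- freq a b l" a]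
  unfolding fourier_coeff_Om vector_add_ldistrib by (simp only: scaleR_add_right)

lemma fourier_coeff_linear:
  assumes f: "bounded_linear f" and c: "\<And>c x. f (c *s x) = c *s f x" and u: "integrable (Om a b) u"
  shows "fourier_coeff a b (\<lambda>x. f (u x)) l = f (fourier_coeff a b u l)"
proof -
  interpret bounded_linear f by fact
  show ?thesis
    using integral_bounded_linear[OF f integrable_cis_smult[OF u], of "- freq a b l" a]
    by (simp add: fourier_coeff_Om c[symmetric] scaleR)
qed

lemma matrix_smult_commute: "A *v (c *s x) = c *s (A *v x)" for A :: "complex^2^2"
  by (simp add: vec_eq_iff matrix_vector_mult_def sum_distrib_left mult.left_commute)

lemma fourier_coeff_matrix:
  "integrable (Om a b) u \<Longrightarrow> fourier_coeff a b (\<lambda>x. A *v u x) l = A *v fourier_coeff a b u l"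
  by (rule fourier_coeff_linear[OF bounded_linear_matrix matrix_smult_commute])

lemma fourier_coeff_smult:
  "integrable (Om a b) u \<Longrightarrow> fourier_coeff a b (\<lambda>x. c *s u x) l = c *s fourier_coeff a b u l"
  by (rule fourier_coeff_linear[OF bounded_linear_smult]) (simp_all add: vec_eq_iff mult.left_commute)

lemma fourier_coeff_diff:
  assumes "integrable (Om a b) u" "integrable (Om a b) v"
  shows "fourier_coeff a b (\<lambda>x. u x - v x) l = fourier_coeff a b u l - fourier_coeff a b v l"
proof -
  have m: "- 1 *s y = - y" for y :: "complex^2" by (simp add: vec_eq_iff)
  show ?thesis
    using fourier_coeff_add[OF assms(1), of "\<lambda>x. - v x" l] assms(2) fourier_coeff_smult[OF assms(2), of "-1" l]
    by (simp add: m)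
qed

section \<open>Stability of the two-step recursion\<close>

abbreviation norm2 :: "'j set \<Rightarrow> ('j \<Rightarrow> complex) \<Rightarrow> real" where
  "norm2 J x \<equiv> L2_set (\<lambda>j. cmod (x j)) J"

lemma norm2_add: "norm2 J (\<lambda>j. x j + y j) \<le> norm2 J x + norm2 J y"
  by (rule order_trans[OF L2_set_mono L2_set_triangle_ineq]) (auto intro: norm_triangle_ineq)

lemma norm2_mult_le:
  assumes "\<And>j. j \<in> J \<Longrightarrow> cmod (c j) \<le> K" "0 \<le> K"
  shows "norm2 J (\<lambda>j. c j * x j) \<le> K * norm2 J x"
  unfolding L2_set_right_distrib[OF \<open>0 \<le> K\<close>]
  using assms by (intro L2_set_mono) (auto simp: norm_mult mult_right_mono)

text \<open>Minkowski's inequality for integrals, by duality: the square of the norm of the integrals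
  \<open>I\<^sub>j\<close> is the integral of a scalar product with the fixed vector \<open>I\<close>.\<close>

lemma norm2_integral_le:
  fixes d :: "'j \<Rightarrow> real \<Rightarrow> complex"
  assumes "finite J" and \<tau>: "0 \<le> \<tau>"
    and d: "\<And>j. j \<in> J \<Longrightarrow> continuous_on {0..\<tau>} (d j)" and \<kappa>: "\<And>j. j \<in> J \<Longrightarrow> continuous_on {0..\<tau>} (\<kappa> j)"
    and \<kappa>1: "\<And>j s. j \<in> J \<Longrightarrow> s \<in> {0..\<tau>} \<Longrightarrow> cmod (\<kappa> j s) \<le> 1"
    and D: "\<And>s. s \<in> {0..\<tau>} \<Longrightarrow> norm2 J (\<lambda>j. d j s) \<le> D"
  shows "norm2 J (\<lambda>j. integral {0..\<tau>} (\<lambda>s. \<kappa> j s * d j s)) \<le> \<tau> * D"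
proof -
  define I where "I j = integral {0..\<tau>} (\<lambda>s. \<kappa> j s * d j s)" for j
  have c: "continuous_on {0..\<tau>} (\<lambda>s. cnj (I j) * (\<kappa> j s * d j s))" if "j \<in> J" for j
    by (intro continuous_intros d \<kappa> that)
  have "complex_of_real ((norm2 J I)\<^sup>2) = (\<Sum>j\<in>J. cnj (I j) * I j)"
    by (simp add: L2_set_def sum_nonneg complex_norm_square mult.commute del: of_real_power)
  also have "\<dots> = (\<Sum>j\<in>J. integral {0..\<tau>} (\<lambda>s. cnj (I j) * (\<kappa> j s * d j s)))"
    by (simp add: I_def)
  also have "\<dots> = integral {0..\<tau>} (\<lambda>s. \<Sum>j\<in>J. cnj (I j) * (\<kappa> j s * d j s))"
    using c \<open>finite J\<close> by (intro integral_sum[symmetric] integrable_continuous_real)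
  finally have "cmod (complex_of_real ((norm2 J I)\<^sup>2)) = cmod (integral {0..\<tau>} (\<lambda>s. \<Sum>j\<in>J. cnj (I j) * (\<kappa> j s * d j s)))"
    by simp
  also have "\<dots> \<le> (norm2 J I * D) * (\<tau> - 0)"
  proof (rule integral_bound[OF \<tau>])
    show "continuous_on {0..\<tau>} (\<lambda>s. \<Sum>j\<in>J. cnj (I j) * (\<kappa> j s * d j s))"
      by (intro continuous_on_sum c)
    fix s assume s: "s \<in> {0..\<tau>}"
    have "cmod (\<Sum>j\<in>J. cnj (I j) * (\<kappa> j s * d j s)) \<le> (\<Sum>j\<in>J. \<bar>cmod (I j)\<bar> * \<bar>cmod (d j s)\<bar>)"
      using \<kappa>1[OF _ s] by (intro sum_norm_le) (auto simp: norm_mult intro!: mult_left_mono mult_left_le_one_le)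
    also have "\<dots> \<le> norm2 J I * norm2 J (\<lambda>j. d j s)" by (rule L2_set_mult_ineq)
    also have "\<dots> \<le> norm2 J I * D" using D[OF s] by (intro mult_left_mono) auto
    finally show "cmod (\<Sum>j\<in>J. cnj (I j) * (\<kappa> j s * d j s)) \<le> norm2 J I * D" .
  qed
  finally have sq: "norm2 J I * norm2 J I \<le> norm2 J I * (\<tau> * D)"
    by (simp add: power2_eq_square ac_simps norm_mult)
  have "0 \<le> D" using order_trans[OF L2_set_nonneg D[of 0]] \<tau> by simp
  then have "norm2 J I \<le> \<tau> * D"
    using sq \<tau> by (cases "norm2 J I = 0") (auto dest: mult_left_le_imp_le simp: less_le)
  then show ?thesis by (simp add: I_def)
qed

text \<open>Summation by parts: \<open>x\<^bsub>k+1\<^esub> - y\<^sub>k\<close> satisfies the same recursion with the forcing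
  \<open>r\<^sub>k - U (y\<^sub>k - y\<^bsub>k-1\<^esub>)\<close> in place of \<open>r\<^sub>k + (1 - U) y\<^sub>k\<close>.\<close>

lemma isometric_recursion_bound:
  fixes x r y :: "nat \<Rightarrow> 'j \<Rightarrow> complex"
  assumes U: "\<And>j. j \<in> J \<Longrightarrow> cmod (U j) = 1"
    and rec: "\<And>k j. k < n \<Longrightarrow> j \<in> J \<Longrightarrow> x (Suc k) j = U j * x k j + r k j + (1 - U j) * y k j"
    and n: "0 < n"
    and r: "\<And>k. k < n \<Longrightarrow> norm2 J (r k) \<le> R k"
    and y: "\<And>k. k < n \<Longrightarrow> norm2 J (y k) \<le> Y" and dy: "\<And>k. Suc k < n \<Longrightarrow> norm2 J (\<lambda>j. y (Suc k) j - y k j) \<le> Y'"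
    and Y': "0 \<le> Y'"
  shows "norm2 J (x n) \<le> norm2 J (x 0) + 2 * Y + (\<Sum>k<n. R k) + real n * Y'"
proof -
  have iso: "norm2 J (\<lambda>j. U j * z j) = norm2 J z" for z
    using U by (intro L2_set_cong) (auto simp: norm_mult)
  have "norm2 J (\<lambda>j. x (Suc m) j - y m j) \<le> norm2 J (x 0) + Y + (\<Sum>k<Suc m. R k) + real m * Y'" if "m < n" for m
    using that
  proof (induction m)
    case 0
    have "norm2 J (\<lambda>j. x (Suc 0) j - y 0 j) = norm2 J (\<lambda>j. (U j * x 0 j + r 0 j) + U j * (- y 0 j))"
      by (intro L2_set_cong refl) (simp add: rec[OF n] algebra_simps)
    also have "\<dots> \<le> (norm2 J (x 0) + norm2 J (r 0)) + norm2 J (y 0)"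
      using norm2_add[of "\<lambda>j. U j * x 0 j + r 0 j" "\<lambda>j. U j * (- y 0 j)" J] norm2_add[of "\<lambda>j. U j * x 0 j" "r 0" J]
      unfolding iso by simp
    finally show ?case using r[of 0] y[of 0] n by simp
  next
    case (Suc m)
    have "norm2 J (\<lambda>j. x (Suc (Suc m)) j - y (Suc m) j)
        = norm2 J (\<lambda>j. (U j * (x (Suc m) j - y m j) + r (Suc m) j) + (- U j) * (y (Suc m) j - y m j))"
      by (intro L2_set_cong refl) (simp add: rec[OF Suc.prems] algebra_simps)
    also have "\<dots> \<le> (norm2 J (\<lambda>j. x (Suc m) j - y m j) + norm2 J (r (Suc m))) + norm2 J (\<lambda>j. y (Suc m) j - y m j)"
      using norm2_add[of "\<lambda>j. U j * (x (Suc m) j - y m j) + r (Suc m) j" "\<lambda>j. (- U j) * (y (Suc m) j - y m j)" J]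
        norm2_add[of "\<lambda>j. U j * (x (Suc m) j - y m j)" "r (Suc m)" J] iso[of "\<lambda>j. x (Suc m) j - y m j"]
        iso[of "\<lambda>j. y (Suc m) j - y m j"]
      by (simp add: norm_mult)
    also have "\<dots> \<le> (norm2 J (x 0) + Y + (\<Sum>k<Suc m. R k) + real m * Y' + R (Suc m)) + Y'"
      using Suc r[of "Suc m"] dy[of m] by (intro add_mono) auto
    finally show ?case by (simp add: algebra_simps)
  qed
  from this[of "n - 1"] n have 1: "norm2 J (\<lambda>j. x n j - y (n - 1) j) \<le> norm2 J (x 0) + Y + (\<Sum>k<n. R k) + real (n - 1) * Y'"
    by simp
  have "norm2 J (x n) = norm2 J (\<lambda>j. (x n j - y (n - 1) j) + y (n - 1) j)" by simp
  also have "\<dots> \<le> norm2 J (\<lambda>j. x n j - y (n - 1) j) + norm2 J (y (n - 1))" by (rule norm2_add)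
  also have "\<dots> \<le> (norm2 J (x 0) + Y + (\<Sum>k<n. R k) + real (n - 1) * Y') + Y"
    using 1 y[of "n - 1"] n by (intro add_mono) auto
  also have "real (n - 1) * Y' \<le> real n * Y'" using Y' by (intro mult_right_mono) auto
  finally show ?thesis by simp
qed

lemma discrete_Gronwall:
  fixes u :: "nat \<Rightarrow> real"
  assumes A: "0 \<le> A" and B: "0 \<le> B"
    and u: "\<And>n. n \<le> N \<Longrightarrow> u n \<le> A + B * (\<Sum>k<n. u k)" and "n \<le> N"
  shows "u n \<le> A * exp (B * real n)"
proof -
  have "u n \<le> A * (1 + B) ^ n \<and> A + B * (\<Sum>k<n. u k) \<le> A * (1 + B) ^ n" if "n \<le> N" for n
    using that
  proof (induction n)
    case 0
    then show ?case using u[of 0] by simp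
  next
    case (Suc n)
    then have "A + B * (\<Sum>k<n. u k) \<le> A * (1 + B) ^ n" "B * u n \<le> B * (A * (1 + B) ^ n)"
      using B by (auto intro: mult_left_mono)
    then have "A + B * (\<Sum>k<Suc n. u k) \<le> A * (1 + B) ^ Suc n" by (simp add: algebra_simps)
    then show ?case using u[of "Suc n"] Suc.prems by simp
  qed
  then have "u n \<le> A * (1 + B) ^ n" using \<open>n \<le> N\<close> by blast
  also have "\<dots> \<le> A * exp B ^ n"
    using A B by (intro mult_left_mono power_mono) auto
  also have "exp B ^ n = exp (B * real n)" by (simp add: exp_of_nat_mult[symmetric] mult.commute)
  finally show ?thesis .
qed

lemma abs_sin_mono: "\<bar>x\<bar> \<le> \<bar>y\<bar> \<Longrightarrow> \<bar>y\<bar> \<le> pi / 2 \<Longrightarrow> \<bar>sin x\<bar> \<le> \<bar>sin (y::real)\<bar>"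
proof -
  assume xy: "\<bar>x\<bar> \<le> \<bar>y\<bar>" "\<bar>y\<bar> \<le> pi / 2"
  have "sin \<bar>x\<bar> \<le> sin \<bar>y\<bar>" using xy by (intro sin_monotone_2pi_le) auto
  moreover have "\<bar>sin z\<bar> = sin \<bar>z\<bar>" if "\<bar>z\<bar> \<le> pi / 2" for z :: real
  proof -
    have "0 \<le> sin \<bar>z\<bar>" using that pi_gt_zero by (intro sin_ge_zero) auto
    then show ?thesis by (cases "z \<ge> 0") auto
  qed
  ultimately show ?thesis using xy by simp
qed

text \<open>The imaginary part of \<open>1 - U\<close> is \<open>\<plusminus> sin \<theta>\<close> for both characteristic roots \<open>U\<close> of the scheme.\<close>

lemma cmod_one_minus_cis_ge: "\<bar>sin \<theta>\<bar> \<le> cmod (1 - cis (- \<theta>))" "\<bar>sin \<theta>\<bar> \<le> cmod (1 - - cis \<theta>)"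
  using abs_Im_le_cmod[of "1 - cis (- \<theta>)"] abs_Im_le_cmod[of "1 - - cis \<theta>"] by auto

text \<open>The characteristic polynomial factors as \<open>(z - E) (z + E\<^bsup>-1\<^esup>)\<close> with \<open>E = e\<^bsup>- \<i> \<tau> \<lambda>\<^esup>\<close>.  Hence
  \<open>q\<^sub>k = e\<^bsub>k+1\<^esub> + E\<^bsup>-1\<^esup> e\<^sub>k\<close> and \<open>p\<^sub>k = e\<^bsub>k+1\<^esub> - E e\<^sub>k\<close> satisfy one-step recursions with the
  isometric multipliers \<open>E\<close> and \<open>- E\<^bsup>-1\<^esup>\<close>, and \<open>E q\<^sub>k + E\<^bsup>-1\<^esup> p\<^sub>k = 2 cos (\<tau> \<lambda>) e\<^bsub>k+1\<^esub>\<close> recovers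
  the error.  In both recursions the integral with the sine is absorbed by summation by parts, and the terms
  \<open>g\<close>, which contain the error itself, by Gronwall's lemma.\<close>

theorem two_step_error_bound:
  fixes e C g :: "nat \<Rightarrow> 'j \<Rightarrow> complex" and d :: "nat \<Rightarrow> 'j \<Rightarrow> real \<Rightarrow> complex" and lam :: "'j \<Rightarrow> real"
  assumes J: "finite J" and \<tau>: "0 < \<tau>" and \<epsilon>: "0 < \<epsilon>" "\<epsilon> \<le> 1"
    and lam: "\<And>j. j \<in> J \<Longrightarrow> lam j \<noteq> 0" "\<And>j. j \<in> J \<Longrightarrow> \<bar>\<tau> * lam j\<bar> \<le> pi / 3"
    and e0: "\<And>j. j \<in> J \<Longrightarrow> e 0 j = 0"
    and rec: "\<And>k j. Suc (Suc k) \<le> M \<Longrightarrow> j \<in> J \<Longrightarrow>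
      e (Suc (Suc k)) j = e k j - 2 * \<i> * of_real (sin (\<tau> * lam j)) * e (Suc k) j
        - \<i> * of_real \<epsilon> * (C (Suc k) j - \<i> * integral {0..\<tau>} (\<lambda>s. of_real (sin ((\<tau> - s) * lam j)) * d (Suc k) j s)
            + of_real (2 * sin (\<tau> * lam j) / lam j) * g (Suc k) j)"
    and d: "\<And>k j. Suc (Suc k) \<le> M \<Longrightarrow> j \<in> J \<Longrightarrow> continuous_on {0..\<tau>} (d (Suc k) j)"
    and c: "0 \<le> c" and B: "0 \<le> B" and H: "0 \<le> H"
    and C: "\<And>k. Suc (Suc k) \<le> M \<Longrightarrow> norm2 J (C (Suc k)) \<le> c * \<tau> ^ 3"
    and d1: "\<And>k s. Suc (Suc k) \<le> M \<Longrightarrow> s \<in> {0..\<tau>} \<Longrightarrow> norm2 J (\<lambda>j. d (Suc k) j s) \<le> c * \<tau>"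
    and d2: "\<And>k s. Suc (Suc (Suc k)) \<le> M \<Longrightarrow> s \<in> {0..\<tau>} \<Longrightarrow>
      norm2 J (\<lambda>j. d (Suc (Suc k)) j s - d (Suc k) j s) \<le> c * \<tau>\<^sup>2"
    and g: "\<And>k. Suc (Suc k) \<le> M \<Longrightarrow> norm2 J (g (Suc k)) \<le> B * (H + norm2 J (e (Suc k)))"
    and e1: "M \<ge> 1 \<Longrightarrow> norm2 J (e 1) \<le> E1"
    and M: "real M * (\<epsilon> * \<tau>) \<le> T0" and n: "n \<le> M" and T0: "0 \<le> T0" and E1: "0 \<le> E1"
  shows "norm2 J (e n) \<le> (2 * E1 + 4 * c * (1 + T0) * \<tau>\<^sup>2 + 4 * T0 * B * H) * exp (4 * B * T0)"
proof -
  define A where "A = 2 * E1 + 4 * c * (1 + T0) * \<tau>\<^sup>2 + 4 * T0 * B * H"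
  have A0: "0 \<le> A" unfolding A_def using T0 E1 c B H by (intro add_nonneg_nonneg mult_nonneg_nonneg) auto
  define S where "S k j = integral {0..\<tau>} (\<lambda>s. of_real (sin ((\<tau> - s) * lam j)) * d (Suc k) j s)" for k j
  define q where "q k j = e (Suc k) j + cis (\<tau> * lam j) * e k j" for k j
  define p where "p k j = e (Suc k) j - cis (- (\<tau> * lam j)) * e k j" for k j
  define r where "r k j = - \<i> * of_real \<epsilon> * (C (Suc k) j + of_real (2 * sin (\<tau> * lam j) / lam j) * g (Suc k) j)" for k j
  have s2: "- 2 * \<i> * of_real (sin \<theta>) = cis (- \<theta>) - cis \<theta>" for \<theta> by (simp add: complex_eq_iff)
  have cc: "cis (- \<theta>) * cis \<theta> = 1" for \<theta> by (simp add: cis_mult)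
  have rec': "e (Suc (Suc k)) j = e k j + (cis (- (\<tau> * lam j)) - cis (\<tau> * lam j)) * e (Suc k) j + r k j - of_real \<epsilon> * S k j"
    if "Suc (Suc k) \<le> M" "j \<in> J" for k j
    unfolding rec[OF that] s2[symmetric] r_def S_def[symmetric] by (simp add: algebra_simps)
  \<comment> \<open>Since \<open>\<bar>sin (\<tau> \<lambda>)\<bar> \<le> \<bar>1 - U\<bar>\<close>, this makes \<open>1 - U\<close> invertible.\<close>
  have neq: "sin (\<tau> * lam j) \<noteq> 0" if "j \<in> J" for j
  proof
    assume "sin (\<tau> * lam j) = 0"
    moreover have "- pi < \<tau> * lam j" "\<tau> * lam j < pi"
      using lam(2)[OF that] pi_gt_zero by linarith+
    ultimately have "\<tau> * lam j = 0" using sin_eq_0_pi by blast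
    with \<tau> lam(1)[OF that] show False by simp
  qed
  have rb: "norm2 J (r k) \<le> \<epsilon> * c * \<tau> ^ 3 + 2 * \<epsilon> * \<tau> * (B * (H + norm2 J (e (Suc k))))" if k: "Suc (Suc k) \<le> M" for k
  proof -
    have "cmod (of_real (2 * sin (\<tau> * lam j) / lam j)) \<le> 2 * \<tau>" if "j \<in> J" for j
    proof -
      have "\<bar>sin (\<tau> * lam j)\<bar> \<le> \<tau> * \<bar>lam j\<bar>" using abs_sin_x_le_abs_x[of "\<tau> * lam j"] \<tau> by (simp add: abs_mult)
      then show ?thesis using lam(1)[OF that] by (simp add: norm_mult norm_divide field_simps)
    qed
    then have "norm2 J (\<lambda>j. C (Suc k) j + of_real (2 * sin (\<tau> * lam j) / lam j) * g (Suc k) j)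
        \<le> c * \<tau> ^ 3 + 2 * \<tau> * norm2 J (g (Suc k))"
      using \<tau> by (intro order_trans[OF norm2_add] add_mono C[OF k] norm2_mult_le) auto
    also have "\<dots> \<le> c * \<tau> ^ 3 + 2 * \<tau> * (B * (H + norm2 J (e (Suc k))))"
      using \<tau> g[OF k] by (intro add_left_mono mult_left_mono) auto
    finally have "\<epsilon> * norm2 J (\<lambda>j. C (Suc k) j + of_real (2 * sin (\<tau> * lam j) / lam j) * g (Suc k) j)
        \<le> \<epsilon> * (c * \<tau> ^ 3 + 2 * \<tau> * (B * (H + norm2 J (e (Suc k)))))"
      using \<epsilon> by (intro mult_left_mono) auto
    moreover have "norm2 J (r k) \<le> \<epsilon> * norm2 J (\<lambda>j. C (Suc k) j + of_real (2 * sin (\<tau> * lam j) / lam j) * g (Suc k) j)"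
      unfolding r_def using \<epsilon> by (intro norm2_mult_le) (auto simp: norm_mult)
    ultimately show ?thesis by (simp add: algebra_simps)
  qed
  \<comment> \<open>Here \<open>w\<close> stands for \<open>- \<epsilon> / (1 - U)\<close>.  It may be large for small \<open>\<tau> \<lambda>\<close>, but no power of \<open>\<tau>\<close>
    is lost, because the kernel of \<open>S\<close> is dominated by \<open>\<bar>1 - U\<bar>\<close>.\<close>
  have Yb: "norm2 J (\<lambda>j. w j * S k j) \<le> \<epsilon> * c * \<tau>\<^sup>2" "Suc (Suc (Suc k)) \<le> M \<Longrightarrow> norm2 J (\<lambda>j. w j * S (Suc k) j - w j * S k j) \<le> \<epsilon> * c * \<tau> ^ 3"
    if k: "Suc (Suc k) \<le> M" and w: "\<And>j. j \<in> J \<Longrightarrow> cmod (w j) * \<bar>sin (\<tau> * lam j)\<bar> \<le> \<epsilon>" for w k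
  proof -
    define \<kappa> where "\<kappa> j s = w j * of_real (sin ((\<tau> - s) * lam j)) / of_real \<epsilon>" for j s
    have \<kappa>c: "continuous_on {0..\<tau>} (\<kappa> j)" for j unfolding \<kappa>_def using \<epsilon> by (intro continuous_intros) auto
    have \<kappa>1: "cmod (\<kappa> j s) \<le> 1" if j: "j \<in> J" and s: "s \<in> {0..\<tau>}" for j s
    proof -
      have "\<bar>(\<tau> - s) * lam j\<bar> \<le> \<bar>\<tau> * lam j\<bar>" unfolding abs_mult using s by (intro mult_right_mono) auto
      then have "\<bar>sin ((\<tau> - s) * lam j)\<bar> \<le> \<bar>sin (\<tau> * lam j)\<bar>"
        using lam(2)[OF j] pi_gt_zero by (intro abs_sin_mono) auto
      then have "cmod (w j) * \<bar>sin ((\<tau> - s) * lam j)\<bar> \<le> \<epsilon>"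
        using w[OF j] by (meson mult_left_mono norm_ge_zero order_trans)
      then show ?thesis using \<epsilon> by (simp add: \<kappa>_def norm_mult norm_divide)
    qed
    have wS: "w j * S k j = of_real \<epsilon> * integral {0..\<tau>} (\<lambda>s. \<kappa> j s * d (Suc k) j s)" for j k
    proof -
      have "of_real \<epsilon> * integral {0..\<tau>} (\<lambda>s. \<kappa> j s * d (Suc k) j s) = integral {0..\<tau>} (\<lambda>s. of_real \<epsilon> * (\<kappa> j s * d (Suc k) j s))"
        by simp
      also have "\<dots> = integral {0..\<tau>} (\<lambda>s. w j * (of_real (sin ((\<tau> - s) * lam j)) * d (Suc k) j s))"
        using \<epsilon> by (intro integral_cong) (simp add: \<kappa>_def)
      finally show ?thesis by (simp add: S_def)
    qed
    have "norm2 J (\<lambda>j. w j * S k j) \<le> \<epsilon> * norm2 J (\<lambda>j. integral {0..\<tau>} (\<lambda>s. \<kappa> j s * d (Suc k) j s))"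
      unfolding wS using \<epsilon> by (intro norm2_mult_le) auto
    also have "\<dots> \<le> \<epsilon> * (\<tau> * (c * \<tau>))"
      using \<epsilon> \<tau> k by (intro mult_left_mono norm2_integral_le J d \<kappa>c \<kappa>1 d1) auto
    finally show "norm2 J (\<lambda>j. w j * S k j) \<le> \<epsilon> * c * \<tau>\<^sup>2" by (simp add: power2_eq_square ac_simps)
    assume k': "Suc (Suc (Suc k)) \<le> M"
    have ik: "(\<lambda>s. \<kappa> j s * d (Suc m) j s) integrable_on {0..\<tau>}" if "j \<in> J" "Suc (Suc m) \<le> M" for j m
      using that by (intro integrable_continuous_real continuous_intros \<kappa>c d)
    have "norm2 J (\<lambda>j. w j * S (Suc k) j - w j * S k j)
        = norm2 J (\<lambda>j. of_real \<epsilon> * integral {0..\<tau>} (\<lambda>s. \<kappa> j s * (d (Suc (Suc k)) j s - d (Suc k) j s)))"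
      by (intro L2_set_cong refl) (simp add: wS right_diff_distrib integral_diff[OF ik ik] k k')
    also have "\<dots> \<le> \<epsilon> * norm2 J (\<lambda>j. integral {0..\<tau>} (\<lambda>s. \<kappa> j s * (d (Suc (Suc k)) j s - d (Suc k) j s)))"
      using \<epsilon> by (intro norm2_mult_le) auto
    also have "\<dots> \<le> \<epsilon> * (\<tau> * (c * \<tau>\<^sup>2))"
      using \<epsilon> \<tau> k k' by (intro mult_left_mono norm2_integral_le J continuous_intros d \<kappa>c \<kappa>1 d2) auto
    finally show "norm2 J (\<lambda>j. w j * S (Suc k) j - w j * S k j) \<le> \<epsilon> * c * \<tau> ^ 3"
      by (simp add: power2_eq_square power3_eq_cube ac_simps)
  qed
  define R where "R k = \<epsilon> * c * \<tau> ^ 3 + 2 * \<epsilon> * \<tau> * (B * (H + norm2 J (e (Suc k))))" for k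
  \<comment> \<open>Both one-step recursions at once; \<open>V\<close> is the inverse of the root \<open>U\<close>.\<close>
  have isometric_factor: "norm2 J (x m) \<le> norm2 J (e 1) + 2 * (\<epsilon> * c * \<tau>\<^sup>2) + (\<Sum>k<m. R k) + real m * (\<epsilon> * c * \<tau> ^ 3)"
    if m: "Suc m \<le> M" "0 < m" and U: "\<And>j. j \<in> J \<Longrightarrow> cmod (U j) = 1" "\<And>j. \<bar>sin (\<tau> * lam j)\<bar> \<le> cmod (1 - U j)"
      and x: "x = (\<lambda>k j. e (Suc k) j + V j * e k j)" and UV: "\<And>j. U j * V j = 1" "\<And>j. U j - V j = cis (- (\<tau> * lam j)) - cis (\<tau> * lam j)"
    for x U V m
  proof -
    define w where "w j = - of_real \<epsilon> / (1 - U j)" for j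
    have nz: "1 - U j \<noteq> 0" if "j \<in> J" for j using neq[OF that] U(2)[of j] by auto
    have w: "cmod (w j) * \<bar>sin (\<tau> * lam j)\<bar> \<le> \<epsilon>" if "j \<in> J" for j
    proof -
      have "\<bar>sin (\<tau> * lam j)\<bar> / cmod (1 - U j) \<le> 1" using U(2)[of j] nz[OF that] by (simp add: divide_le_eq)
      then have "\<epsilon> * (\<bar>sin (\<tau> * lam j)\<bar> / cmod (1 - U j)) \<le> \<epsilon> * 1" using \<epsilon> by (intro mult_left_mono) auto
      then show ?thesis using \<epsilon> by (simp add: w_def norm_divide)
    qed
    have "norm2 J (x m) \<le> norm2 J (x 0) + 2 * (\<epsilon> * c * \<tau>\<^sup>2) + (\<Sum>k<m. R k) + real m * (\<epsilon> * c * \<tau> ^ 3)"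
    proof (rule isometric_recursion_bound[where U=U and r=r and y="\<lambda>k j. w j * S k j"])
      show "x (Suc k) j = U j * x k j + r k j + (1 - U j) * (w j * S k j)" if "k < m" "j \<in> J" for k j
      proof -
        have 1: "(1 - U j) * (w j * S k j) = - of_real \<epsilon> * S k j" using nz[OF that(2)] by (simp add: w_def)
        have 2: "x (Suc k) j = e k j + (U j - V j) * e (Suc k) j + r k j - of_real \<epsilon> * S k j + V j * e (Suc k) j"
          unfolding x UV(2) using rec'[of k j] that m by simp
        have 3: "U j * x k j = U j * e (Suc k) j + (U j * V j) * e k j" unfolding x by (simp add: algebra_simps)
        show ?thesis unfolding 1 2 3 UV(1) by (simp add: algebra_simps)
      qed
    qed (use m U w rb Yb \<epsilon> c \<tau> in \<open>auto simp: R_def\<close>)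
    moreover have "norm2 J (x 0) = norm2 J (e 1)" unfolding x using e0 by (intro L2_set_cong) auto
    ultimately show ?thesis by simp
  qed
  have Mk: "real m * (\<epsilon> * \<tau>) \<le> T0" if "m \<le> M" for m
  proof -
    have "real m * (\<epsilon> * \<tau>) \<le> real M * (\<epsilon> * \<tau>)" using that \<epsilon> \<tau> by (intro mult_right_mono) auto
    then show ?thesis using M by linarith
  qed
  have step: "norm2 J (e (Suc m)) \<le> A + 4 * \<epsilon> * \<tau> * B * (\<Sum>k<m. norm2 J (e (Suc k)))" if m: "Suc m \<le> M" for m
  proof (cases "m = 0")
    case True
    have "norm2 J (e 1) \<le> E1" using e1 m by simp
    moreover have "0 \<le> 4 * c * (1 + T0) * \<tau>\<^sup>2" "0 \<le> 4 * T0 * B * H"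
      using c T0 B H by (auto intro!: mult_nonneg_nonneg add_nonneg_nonneg)
    ultimately have "norm2 J (e 1) \<le> A" unfolding A_def using E1 by linarith
    then show ?thesis using True by simp
  next
    case False
    then have m0: "0 < m" by simp
    have q: "norm2 J (q m) \<le> norm2 J (e 1) + 2 * (\<epsilon> * c * \<tau>\<^sup>2) + (\<Sum>k<m. R k) + real m * (\<epsilon> * c * \<tau> ^ 3)"
      by (rule isometric_factor[OF m m0, where U="\<lambda>j. cis (- (\<tau> * lam j))" and V="\<lambda>j. cis (\<tau> * lam j)"])
        (auto simp: q_def fun_eq_iff cc cmod_one_minus_cis_ge)
    have p: "norm2 J (p m) \<le> norm2 J (e 1) + 2 * (\<epsilon> * c * \<tau>\<^sup>2) + (\<Sum>k<m. R k) + real m * (\<epsilon> * c * \<tau> ^ 3)"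
      using cmod_one_minus_cis_ge(2) cc
      by (intro isometric_factor[OF m m0, where U="\<lambda>j. - cis (\<tau> * lam j)" and V="\<lambda>j. - cis (- (\<tau> * lam j))"])
        (auto simp: p_def fun_eq_iff mult.commute)
    have "norm2 J (e (Suc m)) \<le> norm2 J (\<lambda>j. (cis (- (\<tau> * lam j)) + cis (\<tau> * lam j)) * e (Suc m) j)"
    proof (rule L2_set_mono)
      fix j assume "j \<in> J"
      then have "cos (pi / 3) \<le> cos \<bar>\<tau> * lam j\<bar>" using lam(2)[of j] pi_gt_zero by (intro cos_monotone_0_pi_le) auto
      then have "1 \<le> 2 * cos (\<tau> * lam j)" by (simp add: cos_60 cos_abs_real)
      moreover have "cis (- (\<tau> * lam j)) + cis (\<tau> * lam j) = of_real (2 * cos (\<tau> * lam j))" by (simp add: complex_eq_iff)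
      ultimately show "cmod (e (Suc m) j) \<le> cmod ((cis (- (\<tau> * lam j)) + cis (\<tau> * lam j)) * e (Suc m) j)"
        using mult_right_mono[of 1 "\<bar>2 * cos (\<tau> * lam j)\<bar>" "cmod (e (Suc m) j)"] by (simp only: norm_mult norm_of_real) auto
    qed auto
    also have "\<dots> = norm2 J (\<lambda>j. cis (- (\<tau> * lam j)) * q m j + cis (\<tau> * lam j) * p m j)"
    proof -
      have "(u + v) * x = u * (x + v * y) + v * (x - u * y)" for u v x y :: complex by (simp add: algebra_simps)
      then show ?thesis unfolding q_def p_def by simp
    qed
    also have "\<dots> \<le> 1 * norm2 J (q m) + 1 * norm2 J (p m)"
      by (intro order_trans[OF norm2_add] add_mono norm2_mult_le) auto
    also have "\<dots> \<le> 2 * norm2 J (e 1) + 4 * (\<epsilon> * c * \<tau>\<^sup>2) + 2 * (\<Sum>k<m. R k) + 2 * (real m * (\<epsilon> * c * \<tau> ^ 3))"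
      using p q by simp
    also have "(\<Sum>k<m. R k) = real m * (\<epsilon> * c * \<tau> ^ 3) + 2 * \<epsilon> * \<tau> * B * (real m * H) + 2 * \<epsilon> * \<tau> * B * (\<Sum>k<m. norm2 J (e (Suc k)))"
      unfolding R_def by (simp add: sum.distrib sum_distrib_left algebra_simps)
    finally have "norm2 J (e (Suc m)) \<le> 2 * norm2 J (e 1) + 4 * (\<epsilon> * (c * \<tau>\<^sup>2)) + 4 * ((real m * (\<epsilon> * \<tau>)) * (c * \<tau>\<^sup>2))
        + 4 * ((real m * (\<epsilon> * \<tau>)) * (B * H)) + 4 * \<epsilon> * \<tau> * B * (\<Sum>k<m. norm2 J (e (Suc k)))"
      by (simp add: algebra_simps power2_eq_square power3_eq_cube)
    moreover have "\<epsilon> * (c * \<tau>\<^sup>2) \<le> 1 * (c * \<tau>\<^sup>2)" using \<epsilon> c by (intro mult_right_mono) auto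
    moreover have "(real m * (\<epsilon> * \<tau>)) * (c * \<tau>\<^sup>2) \<le> T0 * (c * \<tau>\<^sup>2)" "(real m * (\<epsilon> * \<tau>)) * (B * H) \<le> T0 * (B * H)"
      using Mk[of m] m c B H by (intro mult_right_mono; simp)+
    moreover have "norm2 J (e 1) \<le> E1" using e1 m by auto
    ultimately show ?thesis unfolding A_def by (simp add: algebra_simps)
  qed
  show ?thesis unfolding A_def[symmetric]
  proof (cases n)
    case 0
    have "norm2 J (e 0) = 0" using e0 by (simp add: L2_set_eq_0_iff J)
    with 0 A0 show "norm2 J (e n) \<le> A * exp (4 * B * T0)" by simp
  next
    case (Suc m)
    have "norm2 J (e (Suc m)) \<le> A * exp (4 * \<epsilon> * \<tau> * B * real m)"
      by (rule discrete_Gronwall[where N="M - 1" and u="\<lambda>m. norm2 J (e (Suc m))", OF A0])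
        (use \<epsilon> \<tau> B step n Suc in \<open>auto intro!: mult_nonneg_nonneg\<close>)
    also have "4 * \<epsilon> * \<tau> * B * real m = 4 * B * (real m * (\<epsilon> * \<tau>))" by (simp add: ac_simps)
    also have "A * exp (4 * B * (real m * (\<epsilon> * \<tau>))) \<le> A * exp (4 * B * T0)"
      using A0 B Mk[of m] n Suc by (intro mult_left_mono) (auto intro!: mult_left_mono)
    finally show "norm2 J (e n) \<le> A * exp (4 * B * T0)" using Suc by simp
  qed
qed

section \<open>Duhamel's formula and the local error\<close>

lemma has_vector_derivative_cis_linear:
  "((\<lambda>s. cis (c * s + e)) has_vector_derivative (\<i> * of_real c * cis (c * s + e))) (at s within S)"
  unfolding has_vector_derivative_def
  by (rule has_derivative_eq_rhs, rule has_derivative_cis, auto intro!: derivative_eq_intros simp: fun_eq_iff scaleR_conv_of_real)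

text \<open>The sign \<open>\<sigma>\<close> treats steps forward and backward in time at once.\<close>

lemma Duhamel:
  fixes y f :: "real \<Rightarrow> complex"
  assumes y: "continuous_on {0..T} y" and f: "continuous_on {0..T} f"
    and ode: "\<And>t. t \<in> {0..T} \<Longrightarrow> y t - y 0 = (LINT r|Om 0 t. - \<i> * (of_real lam * y r + of_real \<epsilon> * f r))"
    and \<sigma>: "\<sigma> = 1 \<or> \<sigma> = - 1" and \<tau>: "0 \<le> \<tau>" and t: "t \<in> {0..T}" "t + \<sigma> * \<tau> \<in> {0..T}"
  shows "y (t + \<sigma> * \<tau>) = cis (- \<sigma> * (\<tau> * lam)) * y t
    - \<i> * of_real (\<epsilon> * \<sigma>) * integral {0..\<tau>} (\<lambda>s. cis (- \<sigma> * ((\<tau> - s) * lam)) * f (t + \<sigma> * s))"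
proof -
  define g where "g r = - \<i> * (of_real lam * y r + of_real \<epsilon> * f r)" for r
  have gc: "continuous_on {0..T} g" unfolding g_def by (intro continuous_intros y f)
  have yg: "y r = y 0 + integral {0..r} g" if r: "r \<in> {0..T}" for r
  proof -
    have gr: "continuous_on {0..r} g" using gc r by (auto elim: continuous_on_subset)
    have "(LINT q|Om 0 r. g q) = integral {0<..<r} g"
      unfolding integral_Om
      by (rule set_borel_integral_eq_integral(2)) (rule set_integrable_continuous_bounded_interval[OF gr])
    also have "\<dots> = integral {0..r} g" by (rule integral_open_interval_real[symmetric])
    finally show ?thesis using ode[OF r] unfolding g_def[symmetric] by (simp add: algebra_simps)
  qed
  have y': "(y has_vector_derivative g r) (at r within {0..T})" if r: "r \<in> {0..T}" for r
  proof -
    have "((\<lambda>r. y 0 + integral {0..r} g) has_vector_derivative (0 + g r)) (at r within {0..T})"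
      by (intro derivative_intros integral_has_vector_derivative gc r)
    then have "((\<lambda>r. y 0 + integral {0..r} g) has_vector_derivative g r) (at r within {0..T})" by simp
    then show ?thesis using r yg
      by (rule has_vector_derivative_transform[rotated 2]) auto
  qed
  have mem: "t + \<sigma> * s \<in> {0..T}" if "s \<in> {0..\<tau>}" for s
    using \<sigma> t that by auto
  \<comment> \<open>The integrating factor propagates \<open>y (t + \<sigma> s)\<close> freely to the final time.\<close>
  define H where "H s = cis (- \<sigma> * ((\<tau> - s) * lam)) * y (t + \<sigma> * s)" for s
  have H': "(H has_vector_derivative (- \<i> * of_real (\<epsilon> * \<sigma>) * (cis (- \<sigma> * ((\<tau> - s) * lam)) * f (t + \<sigma> * s)))) (at s within {0..\<tau>})"
    if s: "s \<in> {0..\<tau>}" for s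
  proof -
    have 1: "((\<lambda>s. y (t + \<sigma> * s)) has_vector_derivative (\<sigma> *\<^sub>R g (t + \<sigma> * s))) (at s within {0..\<tau>})"
    proof -
      have "((\<lambda>s. t + \<sigma> * s) has_vector_derivative \<sigma>) (at s within {0..\<tau>})"
        by (auto intro!: derivative_eq_intros simp: has_real_derivative_iff_has_vector_derivative[symmetric])
      moreover have "(y has_vector_derivative g (t + \<sigma> * s)) (at (t + \<sigma> * s) within (\<lambda>s. t + \<sigma> * s) ` {0..\<tau>})"
        using mem by (intro has_vector_derivative_within_subset[OF y'[OF mem[OF s]]]) auto
      ultimately show ?thesis using vector_diff_chain_within by (fastforce simp: o_def)
    qed
    have e: "cis (- \<sigma> * ((\<tau> - s) * lam)) = cis ((\<sigma> * lam) * s + (- \<sigma> * \<tau> * lam))" for s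
      by (simp add: algebra_simps)
    have 2: "((\<lambda>s. cis (- \<sigma> * ((\<tau> - s) * lam))) has_vector_derivative
        (\<i> * of_real (\<sigma> * lam) * cis (- \<sigma> * ((\<tau> - s) * lam)))) (at s within {0..\<tau>})"
      unfolding e by (rule has_vector_derivative_cis_linear)
    have "(H has_vector_derivative
        (cis (- \<sigma> * ((\<tau> - s) * lam)) * (\<sigma> *\<^sub>R g (t + \<sigma> * s)) + \<i> * of_real (\<sigma> * lam) * cis (- \<sigma> * ((\<tau> - s) * lam)) * y (t + \<sigma> * s)))
        (at s within {0..\<tau>})"
      unfolding H_def by (rule has_vector_derivative_mult[OF 2 1])
    moreover have "z * (\<sigma> *\<^sub>R (- \<i> * (of_real lam * Y + of_real \<epsilon> * F))) + \<i> * of_real (\<sigma> * lam) * z * Y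
        = - \<i> * of_real (\<epsilon> * \<sigma>) * (z * F)" for z Y F :: complex
      by (simp add: scaleR_conv_of_real algebra_simps)
    ultimately show ?thesis unfolding g_def by simp
  qed
  have "((\<lambda>s. - \<i> * of_real (\<epsilon> * \<sigma>) * (cis (- \<sigma> * ((\<tau> - s) * lam)) * f (t + \<sigma> * s))) has_integral (H \<tau> - H 0)) {0..\<tau>}"
    by (rule fundamental_theorem_of_calculus[OF \<tau> H'])
  then have "H \<tau> - H 0 = - \<i> * of_real (\<epsilon> * \<sigma>) * integral {0..\<tau>} (\<lambda>s. cis (- \<sigma> * ((\<tau> - s) * lam)) * f (t + \<sigma> * s))"
    by (auto dest!: integral_unique)
  then show ?thesis unfolding H_def by (simp add: algebra_simps)
qed

lemma integral_cos_linear: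
  assumes "lam \<noteq> 0" "0 \<le> \<tau>"
  shows "integral {0..\<tau>} (\<lambda>s. complex_of_real (cos ((\<tau> - s) * lam))) = of_real (sin (\<tau> * lam) / lam)"
proof -
  have "((\<lambda>s. complex_of_real (cos ((\<tau> - s) * lam))) has_integral
      (of_real (- sin ((\<tau> - \<tau>) * lam) / lam) - of_real (- sin ((\<tau> - 0) * lam) / lam))) {0..\<tau>}"
    using assms
    by (intro fundamental_theorem_of_calculus has_vector_derivative_of_real)
      (auto intro!: derivative_eq_intros simp flip: has_real_derivative_iff_has_vector_derivative)
  then show ?thesis by (simp add: integral_unique)
qed

lemma integral_cis_linear:
  assumes "lam \<noteq> 0" "0 \<le> \<tau>"
  shows "\<i> * integral {0..\<tau>} (\<lambda>s. cis (- ((\<tau> - s) * lam))) = (1 - cis (- (\<tau> * lam))) / of_real lam"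
proof -
  have e: "cis (- ((\<tau> - s) * lam)) = cis (lam * s + (- \<tau> * lam))" for s by (simp add: algebra_simps)
  have "((\<lambda>s. \<i> * of_real lam * cis (lam * s + (- \<tau> * lam))) has_integral
      (cis (lam * \<tau> + (- \<tau> * lam)) - cis (lam * 0 + (- \<tau> * lam)))) {0..\<tau>}"
    using assms by (intro fundamental_theorem_of_calculus has_vector_derivative_cis_linear)
  then have "\<i> * of_real lam * integral {0..\<tau>} (\<lambda>s. cis (- ((\<tau> - s) * lam))) = 1 - cis (- (\<tau> * lam))"
    unfolding e[symmetric] by (auto dest: integral_unique)
  then show ?thesis using assms(1) by (simp add: field_simps)
qed

text \<open>The difference of the forward and the backward Duhamel formula.  Splitting the exponentials into
  cosine and sine sorts the forcing into its symmetric second difference and its symmetric first difference; the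
  value \<open>f t\<close> taken out of the former yields the term that is used by the scheme.\<close>

theorem two_step_identity:
  fixes y f :: "real \<Rightarrow> complex"
  assumes y: "continuous_on {0..T} y" and f: "continuous_on {0..T} f"
    and ode: "\<And>t. t \<in> {0..T} \<Longrightarrow> y t - y 0 = (LINT r|Om 0 t. - \<i> * (of_real lam * y r + of_real \<epsilon> * f r))"
    and lam: "lam \<noteq> 0" and t: "0 \<le> \<tau>" "0 \<le> t - \<tau>" "t + \<tau> \<le> T"
  shows "y (t + \<tau>) = y (t - \<tau>) - 2 * \<i> * of_real (sin (\<tau> * lam)) * y t
     - \<i> * of_real \<epsilon> * (integral {0..\<tau>} (\<lambda>s. of_real (cos ((\<tau> - s) * lam)) * (f (t + s) + f (t - s) - 2 * f t))
        - \<i> * integral {0..\<tau>} (\<lambda>s. of_real (sin ((\<tau> - s) * lam)) * (f (t + s) - f (t - s)))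
        + of_real (2 * sin (\<tau> * lam) / lam) * f t)"
proof -
  have fp: "continuous_on {0..\<tau>} (\<lambda>s. f (t + s))" and fm: "continuous_on {0..\<tau>} (\<lambda>s. f (t - s))"
    using t by (auto intro!: continuous_on_compose2[OF f] continuous_intros)
  let ?c = "\<lambda>s. complex_of_real (cos ((\<tau> - s) * lam))" and ?s = "\<lambda>s. complex_of_real (sin ((\<tau> - s) * lam))"
  have i: "(\<lambda>s. cis (- ((\<tau> - s) * lam)) * f (t + s)) integrable_on {0..\<tau>}"
    "(\<lambda>s. cis ((\<tau> - s) * lam) * f (t - s)) integrable_on {0..\<tau>}"
    "(\<lambda>s. ?c s * (f (t + s) + f (t - s) - 2 * f t)) integrable_on {0..\<tau>}"
    "(\<lambda>s. - \<i> * (?s s * (f (t + s) - f (t - s)))) integrable_on {0..\<tau>}"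
    "(\<lambda>s. 2 * f t * ?c s) integrable_on {0..\<tau>}"
    by (intro integrable_continuous_real continuous_intros fp fm)+
  have "integral {0..\<tau>} (\<lambda>s. cis (- ((\<tau> - s) * lam)) * f (t + s)) + integral {0..\<tau>} (\<lambda>s. cis ((\<tau> - s) * lam) * f (t - s))
      = integral {0..\<tau>} (\<lambda>s. cis (- ((\<tau> - s) * lam)) * f (t + s) + cis ((\<tau> - s) * lam) * f (t - s))"
    by (rule integral_add[symmetric]) (rule i)+
  also have "\<dots> = integral {0..\<tau>} (\<lambda>s. ?c s * (f (t + s) + f (t - s) - 2 * f t)
      + - \<i> * (?s s * (f (t + s) - f (t - s))) + 2 * f t * ?c s)"
  proof -
    have "cis (- \<theta>) * p + cis \<theta> * q = of_real (cos \<theta>) * (p + q - 2 * w) + - \<i> * (of_real (sin \<theta>) * (p - q))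
        + 2 * w * of_real (cos \<theta>)" for \<theta> and p q w :: complex
      by (simp add: complex_eq_iff algebra_simps)
    then show ?thesis by simp
  qed
  also have "\<dots> = integral {0..\<tau>} (\<lambda>s. ?c s * (f (t + s) + f (t - s) - 2 * f t))
      + integral {0..\<tau>} (\<lambda>s. - \<i> * (?s s * (f (t + s) - f (t - s)))) + integral {0..\<tau>} (\<lambda>s. 2 * f t * ?c s)"
    using i by (simp only: integral_add integrable_add)
  also have "\<dots> = integral {0..\<tau>} (\<lambda>s. ?c s * (f (t + s) + f (t - s) - 2 * f t))
      - \<i> * integral {0..\<tau>} (\<lambda>s. ?s s * (f (t + s) - f (t - s))) + of_real (2 * sin (\<tau> * lam) / lam) * f t"
    using integral_cos_linear[OF lam t(1)] by simp
  finally have I: "integral {0..\<tau>} (\<lambda>s. cis (- ((\<tau> - s) * lam)) * f (t + s)) + integral {0..\<tau>} (\<lambda>s. cis ((\<tau> - s) * lam) * f (t - s)) = \<dots>" .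
  have "y (t + \<tau>) = cis (- (\<tau> * lam)) * y t - \<i> * of_real \<epsilon> * integral {0..\<tau>} (\<lambda>s. cis (- ((\<tau> - s) * lam)) * f (t + s))"
    using Duhamel[OF y f ode, where \<sigma>=1 and \<tau>=\<tau> and t=t] t by simp
  moreover have "y (t - \<tau>) = cis (\<tau> * lam) * y t + \<i> * of_real \<epsilon> * integral {0..\<tau>} (\<lambda>s. cis ((\<tau> - s) * lam) * f (t - s))"
    using Duhamel[OF y f ode, where \<sigma>="-1" and \<tau>=\<tau> and t=t] t by simp
  moreover have "- 2 * \<i> * of_real (sin (\<tau> * lam)) = cis (- (\<tau> * lam)) - cis (\<tau> * lam)" by (simp add: complex_eq_iff)
  ultimately show ?thesis unfolding I[symmetric] by (simp add: algebra_simps)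
qed

theorem first_step_identity:
  fixes y f :: "real \<Rightarrow> complex"
  assumes y: "continuous_on {0..T} y" and f: "continuous_on {0..T} f"
    and ode: "\<And>t. t \<in> {0..T} \<Longrightarrow> y t - y 0 = (LINT r|Om 0 t. - \<i> * (of_real lam * y r + of_real \<epsilon> * f r))"
    and lam: "lam \<noteq> 0" and t: "0 \<le> \<tau>" "\<tau> \<le> T"
  shows "y \<tau> = cis (- (\<tau> * lam)) * y 0 - of_real \<epsilon> * ((1 - cis (- (\<tau> * lam))) / of_real lam) * f 0
     - \<i> * of_real \<epsilon> * integral {0..\<tau>} (\<lambda>s. cis (- ((\<tau> - s) * lam)) * (f s - f 0))"
proof -
  have fp: "continuous_on {0..\<tau>} f" using t by (auto intro: continuous_on_subset[OF f])
  have "integral {0..\<tau>} (\<lambda>s. cis (- ((\<tau> - s) * lam)) * (f s - f 0))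
      = integral {0..\<tau>} (\<lambda>s. cis (- ((\<tau> - s) * lam)) * f s) - integral {0..\<tau>} (\<lambda>s. cis (- ((\<tau> - s) * lam))) * f 0"
    by (simp add: right_diff_distrib)
      (subst integral_diff, auto intro!: integrable_continuous_real continuous_intros fp)
  moreover have "y \<tau> = cis (- (\<tau> * lam)) * y 0 - \<i> * of_real \<epsilon> * integral {0..\<tau>} (\<lambda>s. cis (- ((\<tau> - s) * lam)) * f s)"
    using Duhamel[OF y f ode, where \<sigma>=1 and \<tau>=\<tau> and t=0] t by simp
  ultimately have "y \<tau> = cis (- (\<tau> * lam)) * y 0 - \<i> * of_real \<epsilon> *
      (integral {0..\<tau>} (\<lambda>s. cis (- ((\<tau> - s) * lam)) * (f s - f 0)) + integral {0..\<tau>} (\<lambda>s. cis (- ((\<tau> - s) * lam))) * f 0)"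
    by simp
  then show ?thesis
    unfolding integral_cis_linear[OF lam t(1), symmetric] by (simp only: distrib_left mult.assoc) (simp add: ac_simps)
qed

section \<open>Coordinates in the eigenbasis of the symbol\<close>

lemma matrix_eq_2: "(A = B) \<longleftrightarrow> A$1$1 = B$1$1 \<and> A$1$2 = B$1$2 \<and> A$2$1 = B$2$1 \<and> A$2$2 = B$2$2" for A B :: "'a^2^2"
  by (auto simp: vec_eq_iff forall_2)

lemma delta_facts: "delta \<mu> \<ge> 1" "(delta \<mu>)\<^sup>2 = 1 + \<mu>\<^sup>2"
  by (simp_all add: delta_def)

text \<open>The columns are the normalised eigenvectors \<open>(1 + \<delta>, \<mu>)\<close> and \<open>(- \<mu>, 1 + \<delta>)\<close>; this choice
  does not degenerate at \<open>\<mu> = 0\<close>.\<close>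

lemma Q_mat_exists:
  "\<exists>Q. Q ** adj Q = mat 1 \<and> adj Q ** Q = mat 1 \<and>
      Gamma_mat \<mu> = Q ** diag2 (of_real (delta \<mu>)) (of_real (- delta \<mu>)) ** adj Q"
proof -
  define \<delta> where "\<delta> = delta \<mu>"
  have \<delta>: "\<delta> \<ge> 1" "\<delta>\<^sup>2 = 1 + \<mu>\<^sup>2" using delta_facts by (auto simp: \<delta>_def)
  \<comment> \<open>The common length of the two eigenvectors.\<close>
  define n where "n = sqrt (2 * \<delta> * (1 + \<delta>))"
  have n2: "n\<^sup>2 = 2 * \<delta> * (1 + \<delta>)" and n0: "n > 0" using \<delta>(1) by (auto simp: n_def)
  define c s where "c = (1 + \<delta>) / n" and "s = \<mu> / n"
  have A: "(1 + \<delta>)\<^sup>2 + \<mu>\<^sup>2 = n\<^sup>2" "\<delta> * ((1 + \<delta>)\<^sup>2 - \<mu>\<^sup>2) = n\<^sup>2" "\<delta> * (2 * (1 + \<delta>) * \<mu>) = \<mu> * n\<^sup>2"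
    unfolding n2 using \<delta>(2) by (simp_all add: power2_eq_square algebra_simps)
  have B: "x / n * (x / n) + y / n * (y / n) = (x\<^sup>2 + y\<^sup>2) / n\<^sup>2"
    "\<delta> * (x / n * (x / n) - y / n * (y / n)) = \<delta> * (x\<^sup>2 - y\<^sup>2) / n\<^sup>2"
    "\<delta> * (2 * (x / n) * (y / n)) = \<delta> * (2 * x * y) / n\<^sup>2" for x y
    by (simp_all add: power2_eq_square add_divide_distrib diff_divide_distrib right_diff_distrib)
  have cs: "c * c + s * s = 1" "\<delta> * (c * c - s * s) = 1" "\<delta> * (2 * c * s) = \<mu>"
    unfolding c_def s_def B A using n0 by simp_all
  define Q :: "complex^2^2" where "Q = vector [vector [of_real c, of_real (- s)], vector [of_real s, of_real c]]"
  have Qe: "Q$1$1 = of_real c" "Q$1$2 = of_real (- s)" "Q$2$1 = of_real s" "Q$2$2 = of_real c"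
    by (simp_all add: Q_def)
  have "Q ** adj Q = mat 1" "adj Q ** Q = mat 1"
    using cs(1) by (simp_all add: matrix_eq_2 matrix_matrix_mult_def sum_2 adj_def Qe mat_def of_real_mult[symmetric] of_real_add[symmetric] add.commute
        del: of_real_mult of_real_add)
  moreover have "Gamma_mat \<mu> = Q ** diag2 (of_real \<delta>) (of_real (- \<delta>)) ** adj Q"
  proof -
    have "\<delta> * c * c - \<delta> * s * s = 1" "\<delta> * c * s + \<delta> * c * s = \<mu>" using cs(2,3) by (simp_all add: algebra_simps)
    then show ?thesis
      by (simp add: matrix_eq_2 matrix_matrix_mult_def sum_2 adj_def Qe diag2_def Gamma_mat_def sigma1_def sigma3_def complex_eq_iff
         algebra_simps)
  qed
  ultimately show ?thesis unfolding \<delta>_def by blast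
qed

lemma Q_mat_unitary: "Q_mat \<mu> ** adj (Q_mat \<mu>) = mat 1" "adj (Q_mat \<mu>) ** Q_mat \<mu> = mat 1"
  "Gamma_mat \<mu> = Q_mat \<mu> ** diag2 (of_real (delta \<mu>)) (of_real (- delta \<mu>)) ** adj (Q_mat \<mu>)"
  using someI_ex[OF Q_mat_exists[of \<mu>]] unfolding Q_mat_def by blast+

text \<open>The index \<open>1 :: 2\<close> belongs to the positive eigenvalue, as in the definition of \<open>Q_mat\<close>.\<close>

definition eig :: "real \<Rightarrow> 2 \<Rightarrow> real" where
  "eig \<mu> i = (if i = 1 then delta \<mu> else - delta \<mu>)"

definition eigcoord :: "real \<Rightarrow> complex^2 \<Rightarrow> 2 \<Rightarrow> complex" where
  "eigcoord \<mu> c i = (adj (Q_mat \<mu>) *v c) $ i"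

lemma eig_abs: "eig \<mu> i \<noteq> 0" "\<bar>eig \<mu> i\<bar> = delta \<mu>"
  using delta_facts(1)[of \<mu>] by (auto simp: eig_def)

lemma eigcoord_fun_Gamma: "eigcoord \<mu> (fun_Gamma f \<mu> *v c) i = f (eig \<mu> i) * eigcoord \<mu> c i"
proof -
  have "adj (Q_mat \<mu>) *v (fun_Gamma f \<mu> *v c)
      = (adj (Q_mat \<mu>) ** Q_mat \<mu>) *v (diag2 (f (delta \<mu>)) (f (- delta \<mu>)) *v (adj (Q_mat \<mu>) *v c))"
    unfolding fun_Gamma_def by (simp add: matrix_vector_mul_assoc matrix_mul_assoc)
  also have "\<dots> = diag2 (f (delta \<mu>)) (f (- delta \<mu>)) *v (adj (Q_mat \<mu>) *v c)" by (simp add: Q_mat_unitary(2))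
  finally show ?thesis unfolding eigcoord_def eig_def
    by (cases i rule: exhaust_2[THEN disjE]) (simp_all add: matrix_vector_mult_def diag2_def sum_2)
qed

lemma Gamma_mat_eq_fun_Gamma: "Gamma_mat \<mu> = fun_Gamma of_real \<mu>"
  by (simp add: fun_Gamma_def Q_mat_unitary(3))

lemma eigcoord_Gamma: "eigcoord \<mu> (Gamma_mat \<mu> *v c) i = of_real (eig \<mu> i) * eigcoord \<mu> c i"
  unfolding Gamma_mat_eq_fun_Gamma by (rule eigcoord_fun_Gamma)

lemma Gamma_mat_inv: "Gamma_mat \<mu> ** matrix_inv (Gamma_mat \<mu>) = mat 1"
proof -
  define A where "A = (1 / (1 + \<mu>\<^sup>2)) *\<^sub>R Gamma_mat \<mu>"
  have nz: "1 + \<mu> * \<mu> \<noteq> 0" by (metis add_pos_nonneg less_irrefl zero_le_square zero_less_one)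
  have "Gamma_mat \<mu> ** A = mat 1 \<and> A ** Gamma_mat \<mu> = mat 1"
    using nz by (simp add: A_def matrix_eq_2 matrix_matrix_mult_def sum_2 Gamma_mat_def sigma1_def sigma3_def mat_def
       complex_eq_iff power2_eq_square add_divide_distrib[symmetric])
  then show ?thesis unfolding matrix_inv_def by (rule someI2) simp
qed

lemma eigcoord_Gamma_inv: "eigcoord \<mu> (matrix_inv (Gamma_mat \<mu>) *v c) i = eigcoord \<mu> c i / of_real (eig \<mu> i)"
proof -
  have "eigcoord \<mu> c i = of_real (eig \<mu> i) * eigcoord \<mu> (matrix_inv (Gamma_mat \<mu>) *v c) i"
    unfolding eigcoord_Gamma[symmetric] by (simp add: matrix_vector_mul_assoc Gamma_mat_inv)
  then show ?thesis using eig_abs(1)[of \<mu> i] by simp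
qed

lemma eigcoord_linear:
  "eigcoord \<mu> (x + y) i = eigcoord \<mu> x i + eigcoord \<mu> y i"
  "eigcoord \<mu> (x - y) i = eigcoord \<mu> x i - eigcoord \<mu> y i"
  "eigcoord \<mu> (c *s x) i = c * eigcoord \<mu> x i"
  "eigcoord \<mu> (r *\<^sub>R x) i = of_real r * eigcoord \<mu> x i"
proof -
  interpret bounded_linear "\<lambda>x. adj (Q_mat \<mu>) *v x" by (rule bounded_linear_matrix)
  show "eigcoord \<mu> (x + y) i = eigcoord \<mu> x i + eigcoord \<mu> y i"
    "eigcoord \<mu> (x - y) i = eigcoord \<mu> x i - eigcoord \<mu> y i"
    "eigcoord \<mu> (c *s x) i = c * eigcoord \<mu> x i"
    by (simp_all add: eigcoord_def add diff matrix_smult_commute)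
  show "eigcoord \<mu> (r *\<^sub>R x) i = of_real r * eigcoord \<mu> x i"
    unfolding eigcoord_def scaleR vector_scaleR_component by (rule scaleR_conv_of_real)
qed

lemma bounded_linear_eigcoord: "bounded_linear (\<lambda>c. eigcoord \<mu> c i)"
  unfolding eigcoord_def by (rule bounded_linear_compose[OF bounded_linear_vec_nth bounded_linear_matrix])

lemma eigcoord_exp: "eigcoord \<mu> (exp_Gamma \<tau> \<mu> *v c) i = cis (- (\<tau> * eig \<mu> i)) * eigcoord \<mu> c i"
  unfolding exp_Gamma_def eigcoord_fun_Gamma by (simp add: cis_conv_exp)

lemma eigcoord_sin: "eigcoord \<mu> (sin_Gamma \<tau> \<mu> *v c) i = of_real (sin (\<tau> * eig \<mu> i)) * eigcoord \<mu> c i"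
  unfolding sin_Gamma_def eigcoord_fun_Gamma ..

text \<open>The function \<open>\<lambda> \<mapsto> sin (\<tau> \<lambda>) / \<lambda>\<close> is even, so the scalar factor of the scheme has the same form on both
  eigenspaces.\<close>

lemma eig_sinc: "sin (\<tau> * delta \<mu>) / delta \<mu> = sin (\<tau> * eig \<mu> i) / eig \<mu> i"
  by (simp add: eig_def)

lemma sum_eigcoord: "(\<Sum>i\<in>UNIV. (cmod (eigcoord \<mu> c i))\<^sup>2) = (norm c)\<^sup>2"
proof -
  define Q where "Q = Q_mat \<mu>"
  define herm :: "complex^2 \<Rightarrow> complex^2 \<Rightarrow> complex" where "herm x y = (\<Sum>i\<in>UNIV. x $ i * cnj (y $ i))" for x y
  have nh: "complex_of_real ((norm x)\<^sup>2) = herm x x" for x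
    by (simp add: herm_def norm_vec_def L2_set_def sum_nonneg complex_norm_square del: of_real_power)
  have ad: "herm (A *v x) y = herm x (adj A *v y)" for A x y
    by (simp add: herm_def matrix_vector_mult_def sum_2 adj_def algebra_simps)
  have aa: "adj (adj Q) = Q" by (simp add: adj_def vec_eq_iff)
  have "herm (adj Q *v c) (adj Q *v c) = herm c c"
    unfolding ad aa by (simp add: matrix_vector_mul_assoc Q_def Q_mat_unitary(1))
  then have "complex_of_real ((norm (adj Q *v c))\<^sup>2) = complex_of_real ((norm c)\<^sup>2)" by (simp only: nh)
  then have "(norm (adj Q *v c))\<^sup>2 = (norm c)\<^sup>2" by (rule of_real_eq_iff[THEN iffD1])
  then show ?thesis by (simp add: norm_vec_def L2_set_def sum_nonneg eigcoord_def Q_def)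
qed

text \<open>The factor \<open>\<surd>(b - a)\<close> makes the \<open>l\<^sup>2\<close> norm of the coordinates equal to the \<open>L\<^sup>2\<close> norm of
  the trigonometric polynomial.\<close>

definition modal :: "real \<Rightarrow> real \<Rightarrow> (int \<Rightarrow> complex^2) \<Rightarrow> int \<times> 2 \<Rightarrow> complex" where
  "modal a b c j = of_real (sqrt (b - a)) * eigcoord (freq a b (fst j)) (c (fst j)) (snd j)"

definition modes :: "nat \<Rightarrow> (int \<times> 2) set" where
  "modes N = T_idx N \<times> UNIV"

lemma finite_modes: "finite (modes N)"
  by (simp add: modes_def finite_T_idx)

lemma norm2_modal:
  assumes "a < b"
  shows "(norm2 (modes N) (modal a b c))\<^sup>2 = (b - a) * (\<Sum>l\<in>T_idx N. (norm (c l))\<^sup>2)"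
proof -
  have "(norm2 (modes N) (modal a b c))\<^sup>2 = (\<Sum>l\<in>T_idx N. \<Sum>i\<in>UNIV. (cmod (modal a b c (l, i)))\<^sup>2)"
    unfolding L2_set_def modes_def by (subst real_sqrt_pow2) (auto intro!: sum_nonneg simp: sum.cartesian_product)
  also have "\<dots> = (\<Sum>l\<in>T_idx N. \<Sum>i\<in>UNIV. (b - a) * (cmod (eigcoord (freq a b l) (c l) i))\<^sup>2)"
    using assms by (simp add: modal_def norm_mult power_mult_distrib)
  also have "\<dots> = (b - a) * (\<Sum>l\<in>T_idx N. (norm (c l))\<^sup>2)"
    by (simp add: sum_distrib_left[symmetric] sum_eigcoord)
  finally show ?thesis .
qed

lemma norm2_mode_coeff_le:
  assumes "a < b" "L2_le (Om a b) K u"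
  shows "norm2 (modes N) (modal a b (fourier_coeff a b u)) \<le> K"
proof (rule power2_le_imp_le)
  show "(norm2 (modes N) (modal a b (fourier_coeff a b u)))\<^sup>2 \<le> K\<^sup>2"
    unfolding norm2_modal[OF assms(1)] by (rule Bessel[OF assms(1) finite_T_idx assms(2)])
  show "0 \<le> K" using assms(2) by (simp add: L2_le_def)
qed

lemma L2_le_trig_poly_modal:
  assumes "a < b"
  shows "L2_le (Om a b) (norm2 (modes N) (modal a b c)) (trig_poly a b N c)"
  by (rule L2_le_trig_poly[OF assms]) (simp_all add: norm2_modal[OF assms])

lemma modal_diff: "modal a b (\<lambda>l. c l - d l) j = modal a b c j - modal a b d j"
  by (simp add: modal_def eigcoord_linear algebra_simps)

section \<open>The Dirac equation and the scheme in modal coordinates\<close>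

lemma G_mat_apply: "G_mat V A1 t x *v u = V t x *\<^sub>R u - A1 t x *\<^sub>R (sigma1 *v u)"
  by (simp add: vec_eq_iff forall_2 G_mat_def sigma1_def mat_def matrix_vector_mult_def sum_2 scaleR_conv_of_real[where 'a=complex])

lemma norm_sigma1: "norm (sigma1 *v u) = norm u"
  by (simp add: norm_vec_def L2_set_def sigma1_def matrix_vector_mult_def sum_2 add.commute)

lemma measurable_matrix:
  fixes u :: "'a \<Rightarrow> complex^2" and A :: "complex^2^2"
  shows "u \<in> borel_measurable M \<Longrightarrow> (\<lambda>x. A *v u x) \<in> borel_measurable M"
  by (intro borel_measurable_continuous_on[where f="\<lambda>x. A *v x"] linear_continuous_on bounded_linear_matrix)

lemma L2_le_sigma1: "L2_le M K u \<Longrightarrow> L2_le M K (\<lambda>x. sigma1 *v u x)"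
  using L2_le_dominated[of M K u "\<lambda>x. sigma1 *v u x" 1]
  by (simp add: norm_sigma1) (simp add: L2_le_def measurable_matrix)

lemma L2_le_G_mat:
  assumes "Linf_le M K (V t)" "Linf_le M K (A1 t)" "L2_le M L u"
  shows "L2_le M (2 * K * L) (\<lambda>x. G_mat V A1 t x *v u x)"
  unfolding G_mat_apply
  using L2_le_diff[OF L2_le_scaleR_Linf[OF assms(1,3)] L2_le_scaleR_Linf[OF assms(2) L2_le_sigma1[OF assms(3)]]]
  by (simp add: algebra_simps)

lemma diffs_le_sigma1:
  assumes "diffs_le T (L2_le M) K u"
  shows "diffs_le T (L2_le M) K (\<lambda>t x. sigma1 *v u t x)"
proof -
  interpret bounded_linear "\<lambda>x :: complex^2. sigma1 *v x" by (rule bounded_linear_matrix)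
  show ?thesis using assms unfolding diffs_le_def
    by (auto simp: add[symmetric] diff[symmetric] intro!: L2_le_sigma1)
qed

lemma diffs_le_diff:
  fixes u v :: "real \<Rightarrow> real \<Rightarrow> 'v::{banach, second_countable_topology}"
  assumes u: "diffs_le T (L2_le M) K u" and v: "diffs_le T (L2_le M) L v"
  shows "diffs_le T (L2_le M) (K + L) (\<lambda>t x. u t x - v t x)"
  unfolding diffs_le_def
proof (intro conjI allI impI ballI)
  note u' = u[unfolded diffs_le_def] and v' = v[unfolded diffs_le_def]
  show "0 \<le> K + L" using u' v' by simp
  show "L2_le M (K + L) (\<lambda>x. u t x - v t x)" if "t \<in> {0..T}" for t
    using u' v' that by (intro L2_le_diff) auto
  show "L2_le M ((K + L) * h) (\<lambda>x. u (t + h) x - v (t + h) x - (u t x - v t x))" if "0 \<le> t" "0 \<le> h" "t + h \<le> T" for t h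
  proof -
    have "L2_le M (K * h + L * h) (\<lambda>x. (u (t + h) x - u t x) - (v (t + h) x - v t x))"
      using u' v' that by (intro L2_le_diff) auto
    then show ?thesis by (simp add: algebra_simps)
  qed
  show "L2_le M ((K + L) * h * k) (\<lambda>x. u (t + h + k) x - v (t + h + k) x - (u (t + h) x - v (t + h) x)
      - (u (t + k) x - v (t + k) x) + (u t x - v t x))" if "0 \<le> t" "0 \<le> h" "0 \<le> k" "t + h + k \<le> T" for t h k
  proof -
    have "L2_le M (K * h * k + L * h * k) (\<lambda>x. (u (t + h + k) x - u (t + h) x - u (t + k) x + u t x)
        - (v (t + h + k) x - v (t + h) x - v (t + k) x + v t x))"
      using u' v' that by (intro L2_le_diff) auto
    then show ?thesis by (simp add: algebra_simps)
  qed
qed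

lemma fourier_coeff_Fubini:
  fixes f :: "real \<Rightarrow> real \<Rightarrow> complex^2"
  assumes f: "integrable (Om s t \<Otimes>\<^sub>M Om a b) (\<lambda>(r, x). f r x)"
  shows "integrable (Om s t) (\<lambda>r. fourier_coeff a b (f r) l)"
    and "fourier_coeff a b (\<lambda>x. LINT r|Om s t. f r x) l = (LINT r|Om s t. fourier_coeff a b (f r) l)"
proof -
  interpret pair_sigma_finite "Om s t" "Om a b" by (rule pair_sigma_finite_Om)
  let ?e = "\<lambda>x. cis (- freq a b l * (x - a))"
  have i: "integrable (Om s t \<Otimes>\<^sub>M Om a b) (\<lambda>(r, x). ?e x *s f r x)"
  proof (rule Bochner_Integration.integrable_bound[OF f])
    have "(\<lambda>p. ?e (snd p) *s (\<lambda>(r, x). f r x) p) \<in> borel_measurable (Om s t \<Otimes>\<^sub>M Om a b)"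
      by (rule measurable_smult[OF measurable_compose[OF measurable_snd measurable_cis_affine] borel_measurable_integrable[OF f]])
    then show "(\<lambda>(r, x). ?e x *s f r x) \<in> borel_measurable (Om s t \<Otimes>\<^sub>M Om a b)" by (simp add: case_prod_beta')
    show "AE p in Om s t \<Otimes>\<^sub>M Om a b. norm (case p of (r, x) \<Rightarrow> ?e x *s f r x) \<le> norm (case p of (r, x) \<Rightarrow> f r x)"
      by (intro AE_I2) (simp add: case_prod_beta')
  qed
  show "integrable (Om s t) (\<lambda>r. fourier_coeff a b (f r) l)"
    unfolding fourier_coeff_Om using integrable_fst[OF i] by (intro integrable_scaleR_right)
  have "(LINT x|Om a b. ?e x *s (LINT r|Om s t. f r x)) = (LINT x|Om a b. (LINT r|Om s t. ?e x *s f r x))"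
  proof (rule integral_cong_AE)
    have "integrable (Om a b) (\<lambda>x. LINT r|Om s t. f r x)" by (rule integrable_snd[OF f])
    then show "(\<lambda>x. ?e x *s (LINT r|Om s t. f r x)) \<in> borel_measurable (Om a b)"
      by (intro measurable_smult measurable_cis_affine borel_measurable_integrable)
    show "(\<lambda>x. LINT r|Om s t. ?e x *s f r x) \<in> borel_measurable (Om a b)"
      by (rule borel_measurable_integrable[OF integrable_snd[OF i]])
    show "AE x in Om a b. ?e x *s (LINT r|Om s t. f r x) = (LINT r|Om s t. ?e x *s f r x)"
      using AE_integrable_snd[OF f]
      by eventually_elim (rule integral_bounded_linear[OF bounded_linear_smult, symmetric])
  qed
  also have "\<dots> = (LINT r|Om s t. (LINT x|Om a b. ?e x *s f r x))" by (rule Fubini_integral[OF i])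
  finally show "fourier_coeff a b (\<lambda>x. LINT r|Om s t. f r x) l = (LINT r|Om s t. fourier_coeff a b (f r) l)"
    unfolding fourier_coeff_Om by simp
qed

lemma bounded_linear_modal:
  "bounded_linear (\<lambda>c. of_real (sqrt (b - a)) * eigcoord \<mu> c i)"
  by (rule bounded_linear_compose[OF bounded_linear_mult_right bounded_linear_eigcoord])

abbreviation mode_coeff :: "real \<Rightarrow> real \<Rightarrow> (real \<Rightarrow> complex^2) \<Rightarrow> int \<times> 2 \<Rightarrow> complex" where
  "mode_coeff a b u \<equiv> modal a b (fourier_coeff a b u)"

lemma mode_coeff_add: "integrable (Om a b) u \<Longrightarrow> integrable (Om a b) v \<Longrightarrow> mode_coeff a b (\<lambda>x. u x + v x) j = mode_coeff a b u j + mode_coeff a b v j"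
  by (simp add: modal_def fourier_coeff_add eigcoord_linear algebra_simps)

lemma mode_coeff_diff: "integrable (Om a b) u \<Longrightarrow> integrable (Om a b) v \<Longrightarrow> mode_coeff a b (\<lambda>x. u x - v x) j = mode_coeff a b u j - mode_coeff a b v j"
  by (simp add: modal_def fourier_coeff_diff eigcoord_linear algebra_simps)

text \<open>First differences bound the modulus of continuity, by Bessel's inequality.\<close>

lemma continuous_on_mode_coeff:
  assumes ab: "a < b" and u: "diffs_le T (L2_le (Om a b)) K u" and j: "j \<in> modes N"
  shows "continuous_on {0..T} (\<lambda>t. mode_coeff a b (u t) j)"
proof -
  have K: "0 \<le> K" using u by (simp add: diffs_le_def)
  have i: "integrable (Om a b) (u t)" if "t \<in> {0..T}" for t
    using u that L2_le_integrable(1) unfolding diffs_le_def by blast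
  have le: "cmod (mode_coeff a b (u t) j - mode_coeff a b (u s) j) \<le> K * (t - s)" if "0 \<le> s" "s \<le> t" "t \<le> T" for s t
  proof -
    have "L2_le (Om a b) (K * (t - s)) (\<lambda>x. u (s + (t - s)) x - u s x)"
      using u that unfolding diffs_le_def by (metis add.commute diff_add_cancel diff_ge_0_iff_ge)
    then have "norm2 (modes N) (mode_coeff a b (\<lambda>x. u t x - u s x)) \<le> K * (t - s)"
      by (intro norm2_mode_coeff_le[OF ab]) simp
    moreover have "cmod (mode_coeff a b (\<lambda>x. u t x - u s x) j) \<le> norm2 (modes N) (mode_coeff a b (\<lambda>x. u t x - u s x))"
      by (rule member_le_L2_set[OF finite_modes j])
    ultimately show ?thesis using i that by (simp add: mode_coeff_diff)
  qed
  show ?thesis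
  proof (rule lipschitz_on_continuous_on[of K], rule lipschitz_onI)
    fix s t assume st: "s \<in> {0..T}" "t \<in> {0..T}"
    show "dist (mode_coeff a b (u s) j) (mode_coeff a b (u t) j) \<le> K * dist s t"
      using le[of s t] le[of t s] st by (cases "s \<le> t") (auto simp: dist_norm norm_minus_commute)
  qed (rule K)
qed

text \<open>One problem with fixed \<open>\<epsilon>\<close>, mesh size and time step.  The constant \<open>K\<close> bounds all the
  data; in the application it is independent of these parameters.\<close>

locale dirac_problem =
  fixes a b T T0 \<epsilon> K :: real and V A1 :: "real \<Rightarrow> real \<Rightarrow> real" and \<Phi>0 :: "real \<Rightarrow> complex^2"
    and \<Phi> \<Phi>t :: "real \<Rightarrow> real \<Rightarrow> complex^2" and m0 N :: nat and h \<tau> :: real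
  assumes ab: "a < b" and eps: "0 < \<epsilon>" "\<epsilon> \<le> 1" and T: "T = T0 / \<epsilon>" "0 < T0"
    and int_\<Phi>0: "integrable (Om a b) \<Phi>0" and sol: "dirac_solution T a b \<epsilon> V A1 \<Phi>0 \<Phi> \<Phi>t"
    and dV: "diffs_le T (Linf_le (Om a b)) K V" and dA: "diffs_le T (Linf_le (Om a b)) K A1"
    and dP: "diffs_le T (L2_le (Om a b)) K \<Phi>"
    and reg: "AE t in Om 0 T. \<exists>D. Hp_derivs a b m0 (\<Phi> t) D \<and> L2_le (Om a b) K (D m0)"
    and m0: "1 \<le> m0" and N: "even N" "0 < N" and h: "h = (b - a) / real N"
    and \<tau>: "0 < \<tau>" "\<tau> \<le> 1" and stable: "\<And>l. l \<in> T_idx N \<Longrightarrow> \<tau> * delta (freq a b l) \<le> pi / 3"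
begin

definition F :: "real \<Rightarrow> real \<Rightarrow> complex^2" where "F t x = G_mat V A1 t x *v \<Phi> t x"

text \<open>The numerical solution and, below, the forcing which it produces.\<close>

definition W :: "nat \<Rightarrow> real \<Rightarrow> complex^2" where "W n = sEWI_FS a b N \<tau> \<epsilon> V A1 \<Phi>0 n"

definition GW :: "nat \<Rightarrow> real \<Rightarrow> complex^2" where "GW n x = G_mat V A1 (real n * \<tau>) x *v W n x"

definition lam :: "int \<times> 2 \<Rightarrow> real" where "lam j = eig (freq a b (fst j)) (snd j)"

definition err :: "nat \<Rightarrow> int \<times> 2 \<Rightarrow> complex" where
  "err n j = mode_coeff a b (\<Phi> (real n * \<tau>)) j - mode_coeff a b (W n) j"

lemma T_pos: "0 < T" using T eps by simp

lemma h_pos: "0 < h" using h ab N by simp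

lemma K_nonneg: "0 \<le> K" using dP by (simp add: diffs_le_def)

lemma dF: "diffs_le T (L2_le (Om a b)) (8 * K\<^sup>2) F"
proof -
  have "diffs_le T (L2_le (Om a b)) (4 * (K * K) + 4 * (K * K)) (\<lambda>t x. V t x *\<^sub>R \<Phi> t x - A1 t x *\<^sub>R (sigma1 *v \<Phi> t x))"
    by (intro diffs_le_diff diffs_le_product diffs_le_sigma1 dV dA dP)
  then show ?thesis by (simp add: F_def[abs_def] G_mat_apply power2_eq_square)
qed

lemma time_deriv: "has_time_deriv T a b \<Phi> \<Phi>t" using sol by (simp add: dirac_solution_def)

lemma L2_\<Phi>: "t \<in> {0..T} \<Longrightarrow> L2_le (Om a b) K (\<Phi> t)" using dP by (simp add: diffs_le_def)

lemma L2_F: "t \<in> {0..T} \<Longrightarrow> L2_le (Om a b) (8 * K\<^sup>2) (F t)" using dF by (simp add: diffs_le_def)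

lemma int_\<Phi>: "t \<in> {0..T} \<Longrightarrow> integrable (Om a b) (\<Phi> t)" using L2_\<Phi> L2_le_integrable(1) by blast

lemma int_F: "t \<in> {0..T} \<Longrightarrow> integrable (Om a b) (F t)" using L2_F L2_le_integrable(1) by blast

lemma L2_G: "t \<in> {0..T} \<Longrightarrow> L2_le (Om a b) L u \<Longrightarrow> L2_le (Om a b) (2 * K * L) (\<lambda>x. G_mat V A1 t x *v u x)"
  using dV dA by (intro L2_le_G_mat) (auto simp: diffs_le_def)

lemma lam_bounds: "lam j \<noteq> 0" "j \<in> modes N \<Longrightarrow> \<bar>\<tau> * lam j\<bar> \<le> pi / 3"
  using stable[of "fst j"] \<tau> by (auto simp: lam_def eig_abs abs_mult modes_def)

text \<open>On the \<open>l\<close>-th coefficient, \<open>- \<i> \<sigma>\<^sub>1 \<partial>\<^sub>x + \<sigma>\<^sub>3\<close> acts as the matrix \<open>\<Gamma>\<^sub>l\<close>, hence as multiplication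
  by an eigenvalue on each modal coordinate.\<close>

lemma mode_equation: "AE r in Om 0 T. mode_coeff a b (\<Phi>t r) j = - \<i> * (of_real (lam j) * mode_coeff a b (\<Phi> r) j + of_real \<epsilon> * mode_coeff a b (F r) j)"
proof -
  interpret P: pair_sigma_finite "Om 0 T" "Om a b" by (rule pair_sigma_finite_Om)
  have "integrable (Om 0 T \<Otimes>\<^sub>M Om a b) (\<lambda>(r, x). \<Phi>t r x)"
    using time_deriv unfolding has_time_deriv_def integrable_pair_Om by simp
  then have it: "AE r in Om 0 T. integrable (Om a b) (\<Phi>t r)" by (rule P.AE_integrable_fst)
  have eq: "AE r in Om 0 T. \<exists>\<Phi>x. has_weak_deriv a b (\<Phi> r) \<Phi>x \<and>
        (AE x in Om a b.
           \<i> *s \<Phi>t r x = - \<i> *s (sigma1 *v \<Phi>x x) + sigma3 *v \<Phi> r x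
                         + \<epsilon> *\<^sub>R (G_mat V A1 r x *v \<Phi> r x))"
    using sol unfolding dirac_solution_def AE_Om by blast
  have trace: "periodic_trace a b (\<Phi> r)" if "r \<in> {0..T}" for r
    using sol that unfolding dirac_solution_def periodic_bc_def by blast
  show ?thesis using it eq AE_space
  proof eventually_elim
    case (elim r)
    then have r: "r \<in> {0..T}" by simp
    obtain \<Phi>x where wd: "has_weak_deriv a b (\<Phi> r) \<Phi>x"
      and ae: "AE x in Om a b. \<i> *s \<Phi>t r x = - \<i> *s (sigma1 *v \<Phi>x x) + sigma3 *v \<Phi> r x + \<epsilon> *\<^sub>R F r x"
      using elim(2) unfolding F_def by blast
    define l \<mu> where "l = fst j" and "\<mu> = freq a b l"
    define c where "c = fourier_coeff a b (\<Phi> r) l"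
    have ix: "integrable (Om a b) \<Phi>x" using wd by (simp add: has_weak_deriv_def integrable_Om)
    have i1: "integrable (Om a b) (\<lambda>x. sigma1 *v \<Phi>x x)" "integrable (Om a b) (\<lambda>x. sigma3 *v \<Phi> r x)"
      "integrable (Om a b) (\<lambda>x. \<i> *s \<Phi>t r x)" "integrable (Om a b) (\<lambda>x. \<epsilon> *\<^sub>R F r x)"
      using ix int_\<Phi>[OF r] int_F[OF r] elim(1)
      by (auto intro!: integrable_bounded_linear[OF bounded_linear_matrix] integrable_bounded_linear[OF bounded_linear_smult])
    have i2: "integrable (Om a b) (\<lambda>x. - \<i> *s (sigma1 *v \<Phi>x x))"
      using i1(1) by (intro integrable_minus integrable_bounded_linear[OF bounded_linear_smult])
    have i3: "integrable (Om a b) (\<lambda>x. - \<i> *s (sigma1 *v \<Phi>x x) + sigma3 *v \<Phi> r x)"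
      by (intro Bochner_Integration.integrable_add i1 i2)
    have "fourier_coeff a b (\<lambda>x. \<i> *s \<Phi>t r x) l
        = fourier_coeff a b (\<lambda>x. - \<i> *s (sigma1 *v \<Phi>x x) + sigma3 *v \<Phi> r x + \<epsilon> *\<^sub>R F r x) l"
      using i1 i2 i3 ae by (intro fourier_coeff_cong_AE borel_measurable_integrable Bochner_Integration.integrable_add)
    also have "\<dots> = - \<i> *s (sigma1 *v fourier_coeff a b \<Phi>x l) + sigma3 *v c + fourier_coeff a b (\<lambda>x. \<epsilon> *\<^sub>R F r x) l"
      by (simp only: fourier_coeff_add[OF i3 i1(4)] fourier_coeff_add[OF i2 i1(2)] fourier_coeff_smult[OF i1(1)]
          fourier_coeff_matrix[OF ix] fourier_coeff_matrix[OF int_\<Phi>[OF r]] c_def)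
    also have "fourier_coeff a b (\<lambda>x. \<epsilon> *\<^sub>R F r x) l = \<epsilon> *\<^sub>R fourier_coeff a b (F r) l"
      by (rule fourier_coeff_linear[OF bounded_linear_scaleR_right _ int_F[OF r]]) (simp add: vec_eq_iff)
    also have "fourier_coeff a b \<Phi>x l = (\<i> * of_real \<mu>) *s c"
      unfolding c_def \<mu>_def by (rule fourier_coeff_weak_deriv[OF ab wd trace[OF r]])
    also have "- \<i> *s (sigma1 *v ((\<i> * of_real \<mu>) *s c)) + sigma3 *v c = Gamma_mat \<mu> *v c"
      by (simp add: vec_eq_iff forall_2 Gamma_mat_def sigma1_def sigma3_def matrix_vector_mult_def sum_2 scaleR_conv_of_real[where 'a=complex]
         algebra_simps)
    finally have "eigcoord \<mu> (\<i> *s fourier_coeff a b (\<Phi>t r) l) (snd j)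
        = eigcoord \<mu> (Gamma_mat \<mu> *v c + \<epsilon> *\<^sub>R fourier_coeff a b (F r) l) (snd j)"
      by (simp only: fourier_coeff_smult[OF elim(1)])
    then have e: "\<i> * eigcoord \<mu> (fourier_coeff a b (\<Phi>t r) l) (snd j)
        = of_real (lam j) * eigcoord \<mu> c (snd j) + of_real \<epsilon> * eigcoord \<mu> (fourier_coeff a b (F r) l) (snd j)"
      by (simp add: eigcoord_linear eigcoord_Gamma lam_def \<mu>_def l_def)
    have "x = - \<i> * (\<i> * x)" for x :: complex by simp
    then have "eigcoord \<mu> (fourier_coeff a b (\<Phi>t r) l) (snd j)
        = - \<i> * (of_real (lam j) * eigcoord \<mu> c (snd j) + of_real \<epsilon> * eigcoord \<mu> (fourier_coeff a b (F r) l) (snd j))"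
      unfolding e[symmetric] .
    moreover have "s * x = - \<i> * (p * (s * y) + q * (s * z))" if "x = - \<i> * (p * y + q * z)" for s x p y q z :: complex
      unfolding that by (simp add: algebra_simps)
    ultimately show ?case unfolding modal_def c_def \<mu>_def l_def by blast
  qed
qed

text \<open>The integrated form of the modal equation holds at every time, since both the solution and
  its modal coordinates are continuous in time.\<close>

lemma mode_ode:
  assumes j: "j \<in> modes N" and t: "t \<in> {0..T}"
  shows "mode_coeff a b (\<Phi> t) j - mode_coeff a b (\<Phi> 0) j
    = (LINT r|Om 0 t. - \<i> * (of_real (lam j) * mode_coeff a b (\<Phi> r) j + of_real \<epsilon> * mode_coeff a b (F r) j))"
proof -
  have "integrable (Om 0 T \<Otimes>\<^sub>M Om a b) (\<lambda>(r, x). \<Phi>t r x)"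
    using time_deriv unfolding has_time_deriv_def integrable_pair_Om by simp
  then have it: "integrable (Om 0 t \<Otimes>\<^sub>M Om a b) (\<lambda>(r, x). \<Phi>t r x)"
    using t by (auto intro: integrable_pair_subinterval)
  define l where "l = fst j"
  let ?m = "\<lambda>c. of_real (sqrt (b - a)) * eigcoord (freq a b l) c (snd j)"
  interpret P: pair_sigma_finite "Om 0 t" "Om a b" by (rule pair_sigma_finite_Om)
  have z: "0 \<in> {0..T}" using T_pos by simp
  have "fourier_coeff a b (\<Phi> t) l - fourier_coeff a b (\<Phi> 0) l = fourier_coeff a b (\<lambda>x. \<Phi> t x - \<Phi> 0 x) l"
    using int_\<Phi>[OF t] int_\<Phi>[OF z] by (rule fourier_coeff_diff[symmetric])
  also have "\<dots> = fourier_coeff a b (\<lambda>x. LINT r|Om 0 t. \<Phi>t r x) l"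
  proof (rule fourier_coeff_cong_AE)
    show "(\<lambda>x. \<Phi> t x - \<Phi> 0 x) \<in> borel_measurable (Om a b)"
      using int_\<Phi>[OF t] int_\<Phi>[OF z] by (intro borel_measurable_integrable Bochner_Integration.integrable_diff)
    show "(\<lambda>x. LINT r|Om 0 t. \<Phi>t r x) \<in> borel_measurable (Om a b)"
      by (rule borel_measurable_integrable[OF P.integrable_snd[OF it]])
    show "AE x in Om a b. \<Phi> t x - \<Phi> 0 x = (LINT r|Om 0 t. \<Phi>t r x)"
      by (rule has_time_deriv_FTC[OF time_deriv]) (use t in auto)
  qed
  also have "\<dots> = (LINT r|Om 0 t. fourier_coeff a b (\<Phi>t r) l)" by (rule fourier_coeff_Fubini(2)[OF it])
  finally have "?m (fourier_coeff a b (\<Phi> t) l - fourier_coeff a b (\<Phi> 0) l) = ?m (LINT r|Om 0 t. fourier_coeff a b (\<Phi>t r) l)"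
    by simp
  also have "\<dots> = (LINT r|Om 0 t. ?m (fourier_coeff a b (\<Phi>t r) l))"
    by (rule integral_bounded_linear[OF bounded_linear_modal fourier_coeff_Fubini(1)[OF it], symmetric])
  also have "\<dots> = (LINT r|Om 0 t. mode_coeff a b (\<Phi>t r) j)" by (simp add: modal_def l_def)
  also have "\<dots> = (LINT r|Om 0 t. - \<i> * (of_real (lam j) * mode_coeff a b (\<Phi> r) j + of_real \<epsilon> * mode_coeff a b (F r) j))"
  proof (rule integral_cong_AE)
    show "(\<lambda>r. mode_coeff a b (\<Phi>t r) j) \<in> borel_measurable (Om 0 t)"
      using integrable_bounded_linear[OF bounded_linear_modal fourier_coeff_Fubini(1)[OF it, of l], of b a "freq a b l" "snd j"]
      by (simp add: modal_def l_def)
    have "continuous_on {0..t} (\<lambda>r. mode_coeff a b (\<Phi> r) j)" "continuous_on {0..t} (\<lambda>r. mode_coeff a b (F r) j)"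
      using t by (auto intro: continuous_on_subset[OF continuous_on_mode_coeff[OF ab dP j]] continuous_on_subset[OF continuous_on_mode_coeff[OF ab dF j]])
    then have "integrable (Om 0 t) (\<lambda>r. - \<i> * (of_real (lam j) * mode_coeff a b (\<Phi> r) j + of_real \<epsilon> * mode_coeff a b (F r) j))"
      unfolding integrable_Om by (intro set_integrable_continuous_bounded_interval continuous_intros)
    then show "(\<lambda>r. - \<i> * (of_real (lam j) * mode_coeff a b (\<Phi> r) j + of_real \<epsilon> * mode_coeff a b (F r) j)) \<in> borel_measurable (Om 0 t)"
      by (rule borel_measurable_integrable)
    show "AE r in Om 0 t. mode_coeff a b (\<Phi>t r) j = - \<i> * (of_real (lam j) * mode_coeff a b (\<Phi> r) j + of_real \<epsilon> * mode_coeff a b (F r) j)"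
      using mode_equation[of j] by (rule AE_Om_mono) (use t in auto)
  qed
  finally show ?thesis by (simp add: modal_def l_def eigcoord_linear algebra_simps)
qed

lemma mode_coeff_trig_poly: "j \<in> modes N \<Longrightarrow> mode_coeff a b (trig_poly a b N c) j = modal a b c j"
  by (auto simp: modal_def modes_def trig_poly_def[abs_def] fourier_coeff_trig_sum[OF ab finite_T_idx])

lemma W_trig: "\<exists>c. W n = trig_poly a b N c"
proof -
  consider "n = 0" | "n = Suc 0" | m where "n = Suc (Suc m)" by (metis not0_implies_Suc)
  then show ?thesis unfolding W_def by cases (auto simp: Let_def)
qed

lemma W_L2: "\<exists>L. L2_le (Om a b) L (W n)"
  using W_trig[of n] L2_le_trig_poly_modal[OF ab] by metis

lemma W_0: "j \<in> modes N \<Longrightarrow> mode_coeff a b (W 0) j = mode_coeff a b (\<Phi> 0) j"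
proof -
  assume j: "j \<in> modes N"
  have z: "0 \<in> {0..T}" using T_pos by simp
  have "AE x in Om a b. \<Phi> 0 x = \<Phi>0 x" using sol unfolding dirac_solution_def AE_Om by blast
  then have ae: "AE x in Om a b. \<Phi>0 x = \<Phi> 0 x" by eventually_elim simp
  have "W 0 = trig_poly a b N (fourier_coeff a b \<Phi>0)" unfolding W_def by simp
  then have "mode_coeff a b (W 0) j = mode_coeff a b \<Phi>0 j" by (simp add: mode_coeff_trig_poly[OF j])
  also have "fourier_coeff a b \<Phi>0 = fourier_coeff a b (\<Phi> 0)"
    using fourier_coeff_cong_AE[OF borel_measurable_integrable[OF int_\<Phi>0] borel_measurable_integrable[OF int_\<Phi>[OF z]] ae]
    by blast
  finally show ?thesis .
qed

lemma W_1:
  assumes j: "j \<in> modes N"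
  shows "mode_coeff a b (W 1) j = cis (- (\<tau> * lam j)) * mode_coeff a b (W 0) j
    - of_real \<epsilon> * ((1 - cis (- (\<tau> * lam j))) / of_real (lam j)) * mode_coeff a b (GW 0) j"
proof -
  have "W 1 = trig_poly a b N (\<lambda>l. exp_Gamma \<tau> (freq a b l) *v fourier_coeff a b (W 0) l
        - \<epsilon> *\<^sub>R ((matrix_inv (Gamma_mat (freq a b l)) ** (mat 1 - exp_Gamma \<tau> (freq a b l)))
                 *v fourier_coeff a b (GW 0) l))"
    unfolding W_def GW_def[abs_def] by (simp add: Let_def)
  then show ?thesis
    by (simp add: mode_coeff_trig_poly[OF j] del: One_nat_def)
      (simp add: modal_def eigcoord_linear eigcoord_exp eigcoord_Gamma_inv lam_def matrix_vector_mul_assoc[symmetric]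
        matrix_vector_mult_diff_rdistrib diff_divide_distrib algebra_simps)
qed

lemma W_rec:
  assumes j: "j \<in> modes N"
  shows "mode_coeff a b (W (Suc (Suc n))) j = mode_coeff a b (W n) j - 2 * \<i> * of_real (sin (\<tau> * lam j)) * mode_coeff a b (W (Suc n)) j
    - \<i> * of_real \<epsilon> * (of_real (2 * sin (\<tau> * lam j) / lam j) * mode_coeff a b (GW (Suc n)) j)"
proof -
  have W: "W (Suc (Suc n)) = trig_poly a b N (\<lambda>l. fourier_coeff a b (W n) l
        - (2 * \<i>) *s (sin_Gamma \<tau> (freq a b l) *v fourier_coeff a b (W (Suc n)) l)
        - (\<i> * of_real (2 * \<epsilon> / delta (freq a b l) * sin (\<tau> * delta (freq a b l))))
            *s fourier_coeff a b (GW (Suc n)) l)"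
    unfolding W_def GW_def[abs_def] by (simp add: Let_def)
  have "2 * \<epsilon> / delta \<mu> * sin (\<tau> * delta \<mu>) = \<epsilon> * (2 * sin (\<tau> * eig \<mu> i) / eig \<mu> i)" for \<mu> i
  proof -
    have "2 * \<epsilon> / delta \<mu> * sin (\<tau> * delta \<mu>) = 2 * \<epsilon> * (sin (\<tau> * delta \<mu>) / delta \<mu>)" by simp
    also have "\<dots> = 2 * \<epsilon> * (sin (\<tau> * eig \<mu> i) / eig \<mu> i)" by (simp only: eig_sinc[of \<tau> \<mu> i])
    finally show ?thesis by simp
  qed
  note sinc = this[of "freq a b (fst j)" "snd j"]
  show ?thesis
    unfolding W mode_coeff_trig_poly[OF j] unfolding modal_def eigcoord_linear eigcoord_sin lam_def sinc
    by (simp add: algebra_simps)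
qed

end

section \<open>The error of the scheme for one value of \<open>\<epsilon>\<close>\<close>

lemma trig_poly_diff: "trig_poly a b N (\<lambda>l. c l - d l) x = trig_poly a b N c x - trig_poly a b N d x"
  by (simp add: trig_poly_def sum_subtractf vec_eq_iff algebra_simps)

context dirac_problem
begin

text \<open>Regularity in space is available for almost every time only.  Choosing a good time at
  distance at most \<open>h\<^bsup>m\<^sub>0\<^esup>\<close> makes the increment of \<open>\<Phi>\<close> as small as the projection error.\<close>

lemma projection_error_every_time:
  assumes t: "t \<in> {0..T}"
  shows "L2_le (Om a b) (2 * K * h ^ m0) (\<lambda>x. \<Phi> t x - trig_poly a b N (fourier_coeff a b (\<Phi> t)) x)"
proof -
  \<comment> \<open>The admissible distance in time.\<close>
  define \<delta> where "\<delta> = h ^ m0"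
  have \<delta>: "0 < \<delta>" using h_pos by (simp add: \<delta>_def)
  obtain r D where r: "r \<in> {0<..<T}" "\<bar>r - t\<bar> \<le> \<delta>" and D: "Hp_derivs a b m0 (\<Phi> r) D" "L2_le (Om a b) K (D m0)"
    using ex_AE_time_near[OF reg T_pos t \<delta>] by blast
  have r': "r \<in> {0..T}" using r by simp
  have "L2_le (Om a b) ((h / pi) ^ m0 * K) (\<lambda>x. \<Phi> r x - trig_poly a b N (fourier_coeff a b (\<Phi> r)) x)"
    by (rule projection_error[OF ab N h D(1) m0 D(2) L2_\<Phi>[OF r']])
  moreover have "(h / pi) ^ m0 * K \<le> \<delta> * K"
    unfolding \<delta>_def using h_pos K_nonneg pi_ge_two
    by (intro mult_right_mono power_mono) (auto simp: field_simps)
  ultimately have 1: "L2_le (Om a b) (\<delta> * K) (\<lambda>x. \<Phi> r x - trig_poly a b N (fourier_coeff a b (\<Phi> r)) x)"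
    by (rule L2_le_mono)
  have "L2_le (Om a b) (K * \<bar>r - t\<bar>) (\<lambda>x. \<Phi> t x - \<Phi> r x)"
  proof (cases "r \<le> t")
    case True
    have "L2_le (Om a b) (K * (t - r)) (\<lambda>x. \<Phi> (r + (t - r)) x - \<Phi> r x)"
      using dP[unfolded diffs_le_def, THEN conjunct2, THEN conjunct2, THEN conjunct1, rule_format, of r "t - r"] r t True by simp
    then show ?thesis using True by simp
  next
    case False
    have "L2_le (Om a b) (K * (r - t)) (\<lambda>x. \<Phi> (t + (r - t)) x - \<Phi> t x)"
      using dP[unfolded diffs_le_def, THEN conjunct2, THEN conjunct2, THEN conjunct1, rule_format, of t "r - t"] r t False by simp
    from L2_le_minus[OF this] show ?thesis using False by simp
  qed
  moreover have "K * \<bar>r - t\<bar> \<le> \<delta> * K" using mult_left_mono[OF r(2) K_nonneg] by (simp add: mult.commute)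
  ultimately have "L2_le (Om a b) (\<delta> * K) (\<lambda>x. \<Phi> t x - \<Phi> r x)" by (rule L2_le_mono)
  from L2_le_projection_error[OF ab this, of N]
  have 2: "L2_le (Om a b) (\<delta> * K) (\<lambda>x. \<Phi> t x - \<Phi> r x - trig_poly a b N (fourier_coeff a b (\<lambda>x. \<Phi> t x - \<Phi> r x)) x)" .
  have lin: "trig_poly a b N (fourier_coeff a b (\<lambda>x. \<Phi> t x - \<Phi> r x)) x
      = trig_poly a b N (fourier_coeff a b (\<Phi> t)) x - trig_poly a b N (fourier_coeff a b (\<Phi> r)) x" for x
    unfolding trig_poly_diff[symmetric] using fourier_coeff_diff[OF int_\<Phi>[OF t] int_\<Phi>[OF r']] by (simp add: trig_poly_def)
  show ?thesis using L2_le_add[OF 1 2] unfolding lin \<delta>_def by (simp add: algebra_simps)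
qed

text \<open>The bound on the projection error, through which the mesh size enters the recursion.\<close>

abbreviation (input) H :: real where "H \<equiv> 2 * K * h ^ m0"

text \<open>Projection error plus the difference of two elements of \<open>Y\<^sub>N\<close>, which is measured by the modal
  coordinates.\<close>

lemma full_error_le:
  assumes n: "real n * \<tau> \<in> {0..T}"
  shows "L2_le (Om a b) (H + norm2 (modes N) (err n)) (\<lambda>x. \<Phi> (real n * \<tau>) x - W n x)"
proof -
  obtain c where c: "W n = trig_poly a b N c" using W_trig by blast
  let ?u = "\<Phi> (real n * \<tau>)"
  have "norm2 (modes N) (modal a b (\<lambda>l. fourier_coeff a b ?u l - c l)) = norm2 (modes N) (err n)"
    by (intro L2_set_cong refl) (simp add: modal_diff err_def c mode_coeff_trig_poly)
  with L2_le_trig_poly_modal[OF ab, where N=N and c="\<lambda>l. fourier_coeff a b ?u l - c l"]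
  have "L2_le (Om a b) (norm2 (modes N) (err n)) (\<lambda>x. trig_poly a b N (fourier_coeff a b ?u) x - W n x)"
    by (simp add: trig_poly_diff[abs_def] c)
  from L2_le_add[OF projection_error_every_time[OF n] this] show ?thesis by simp
qed

text \<open>The forcing error is \<open>G (\<Phi> - \<Phi>\<^sub>N)\<close>, and the potentials are bounded; the projection error of
  \<open>\<Phi>\<close> enters here, multiplied by \<open>\<epsilon> \<tau>\<close> in every step.\<close>

lemma forcing_error:
  assumes n: "real n * \<tau> \<in> {0..T}"
  shows "norm2 (modes N) (\<lambda>j. mode_coeff a b (F (real n * \<tau>)) j - mode_coeff a b (GW n) j) \<le> 2 * K * (H + norm2 (modes N) (err n))"
proof -
  obtain L where L: "L2_le (Om a b) L (W n)" using W_L2 by blast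
  have iG: "integrable (Om a b) (GW n)"
    unfolding GW_def[abs_def] by (rule L2_le_integrable(1)[OF L2_G[OF n L]])
  have "F (real n * \<tau>) x - GW n x = G_mat V A1 (real n * \<tau>) x *v (\<Phi> (real n * \<tau>) x - W n x)" for x
    by (simp add: F_def GW_def matrix_vector_mult_diff_distrib)
  then have "L2_le (Om a b) (2 * K * (H + norm2 (modes N) (err n))) (\<lambda>x. F (real n * \<tau>) x - GW n x)"
    using L2_G[OF n full_error_le[OF n]] by simp
  from norm2_mode_coeff_le[OF ab this, of N] show ?thesis
    by (simp add: mode_coeff_diff[OF int_F[OF n] iG])
qed

lemma first_diff_F:
  assumes "0 \<le> t" "0 \<le> r" "t + r \<le> T"
  shows "norm2 (modes N) (\<lambda>j. mode_coeff a b (F (t + r)) j - mode_coeff a b (F t) j) \<le> 8 * K\<^sup>2 * r"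
proof -
  have "L2_le (Om a b) (8 * K\<^sup>2 * r) (\<lambda>x. F (t + r) x - F t x)"
    using dF assms by (simp add: diffs_le_def)
  from norm2_mode_coeff_le[OF ab this, of N] show ?thesis using assms by (simp add: mode_coeff_diff int_F)
qed

lemma second_diff_F:
  assumes "0 \<le> t" "0 \<le> r" "0 \<le> k" "t + r + k \<le> T"
  shows "norm2 (modes N) (\<lambda>j. mode_coeff a b (F (t + r + k)) j - mode_coeff a b (F (t + r)) j - mode_coeff a b (F (t + k)) j + mode_coeff a b (F t) j)
    \<le> 8 * K\<^sup>2 * r * k"
proof -
  have i: "integrable (Om a b) (F (t + r + k))" "integrable (Om a b) (F (t + r))" "integrable (Om a b) (F (t + k))" "integrable (Om a b) (F t)"
    using assms by (auto intro: int_F)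
  have "L2_le (Om a b) (8 * K\<^sup>2 * r * k) (\<lambda>x. F (t + r + k) x - F (t + r) x - F (t + k) x + F t x)"
    using dF[unfolded diffs_le_def, THEN conjunct2, THEN conjunct2, THEN conjunct2, rule_format, OF assms] .
  from norm2_mode_coeff_le[OF ab this, of N] show ?thesis
    by (simp add: mode_coeff_add mode_coeff_diff i)
qed

lemma mode_error_first_step:
  assumes "\<tau> \<le> T"
  shows "norm2 (modes N) (err 1) \<le> 8 * K\<^sup>2 * \<tau>\<^sup>2 + 2 * K * H"
proof -
  have z: "0 \<in> {0..T}" using T_pos by simp
  define \<kappa> where "\<kappa> j s = cis (- ((\<tau> - s) * lam j))" for j s
  define S where "S j = integral {0..\<tau>} (\<lambda>s. \<kappa> j s * (mode_coeff a b (F s) j - mode_coeff a b (F 0) j))" for j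
  define \<sigma> where "\<sigma> j = (1 - cis (- (\<tau> * lam j))) / of_real (lam j)" for j
  define g where "g j = mode_coeff a b (F 0) j - mode_coeff a b (GW 0) j" for j
  have e: "err 1 j = - of_real \<epsilon> * (\<sigma> j * g j) + - (\<i> * of_real \<epsilon>) * S j" if j: "j \<in> modes N" for j
  proof -
    have "mode_coeff a b (\<Phi> \<tau>) j = cis (- (\<tau> * lam j)) * mode_coeff a b (\<Phi> 0) j - of_real \<epsilon> * \<sigma> j * mode_coeff a b (F 0) j - \<i> * of_real \<epsilon> * S j"
      unfolding \<sigma>_def S_def \<kappa>_def using lam_bounds(1) \<tau> assms
      by (intro first_step_identity[OF continuous_on_mode_coeff[OF ab dP j] continuous_on_mode_coeff[OF ab dF j] mode_ode[OF j]]) auto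
    then show ?thesis
      unfolding err_def W_1[OF j] W_0[OF j] g_def \<sigma>_def[symmetric] by (simp add: algebra_simps)
  qed
  have \<sigma>: "cmod (\<sigma> j) \<le> \<tau>" for j
  proof -
    have "cmod (integral {0..\<tau>} (\<lambda>s. \<kappa> j s)) \<le> 1 * (\<tau> - 0)"
      unfolding \<kappa>_def using \<tau> by (intro integral_bound continuous_intros) auto
    moreover have "\<sigma> j = \<i> * integral {0..\<tau>} (\<lambda>s. \<kappa> j s)"
      unfolding \<sigma>_def \<kappa>_def using lam_bounds(1) \<tau> by (intro integral_cis_linear[symmetric]) auto
    ultimately show ?thesis by (simp add: norm_mult)
  qed
  have e0: "norm2 (modes N) (err 0) = 0"
    unfolding L2_set_eq_0_iff[OF finite_modes] by (simp add: err_def W_0)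
  have g: "norm2 (modes N) g \<le> 2 * K * H"
    using forcing_error[of 0] z e0 unfolding g_def by simp
  have S: "norm2 (modes N) S \<le> \<tau> * (8 * K\<^sup>2 * \<tau>)"
    unfolding S_def
  proof (rule norm2_integral_le[OF finite_modes])
    show "0 \<le> \<tau>" using \<tau> by simp
    show "continuous_on {0..\<tau>} (\<lambda>s. mode_coeff a b (F s) j - mode_coeff a b (F 0) j)" if "j \<in> modes N" for j
      using continuous_on_subset[OF continuous_on_mode_coeff[OF ab dF that], of "{0..\<tau>}"] assms by (intro continuous_intros) auto
    show "continuous_on {0..\<tau>} (\<kappa> j)" for j unfolding \<kappa>_def by (intro continuous_intros)
    show "cmod (\<kappa> j s) \<le> 1" for j s by (simp add: \<kappa>_def)
    fix s assume s: "s \<in> {0..\<tau>}"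
    have "norm2 (modes N) (\<lambda>j. mode_coeff a b (F (0 + s)) j - mode_coeff a b (F 0) j) \<le> 8 * K\<^sup>2 * s"
      using s assms by (intro first_diff_F) auto
    also have "\<dots> \<le> 8 * K\<^sup>2 * \<tau>" using s by (intro mult_left_mono) auto
    finally show "norm2 (modes N) (\<lambda>j. mode_coeff a b (F s) j - mode_coeff a b (F 0) j) \<le> 8 * K\<^sup>2 * \<tau>" by simp
  qed
  have "norm2 (modes N) (err 1) = norm2 (modes N) (\<lambda>j. - of_real \<epsilon> * (\<sigma> j * g j) + - (\<i> * of_real \<epsilon>) * S j)"
    using e by (intro L2_set_cong) auto
  also have "\<dots> \<le> 1 * (\<tau> * norm2 (modes N) g) + 1 * norm2 (modes N) S"
  proof -
    have "norm2 (modes N) (\<lambda>j. - of_real \<epsilon> * (\<sigma> j * g j)) \<le> 1 * norm2 (modes N) (\<lambda>j. \<sigma> j * g j)"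
      "norm2 (modes N) (\<lambda>j. - (\<i> * of_real \<epsilon>) * S j) \<le> 1 * norm2 (modes N) S"
      using eps by (intro norm2_mult_le; simp add: norm_mult)+
    moreover have "norm2 (modes N) (\<lambda>j. \<sigma> j * g j) \<le> \<tau> * norm2 (modes N) g"
      using \<sigma> \<tau> by (intro norm2_mult_le) auto
    ultimately show ?thesis by (intro order_trans[OF norm2_add]) linarith
  qed
  also have "\<dots> \<le> 1 * (1 * (2 * K * H)) + 1 * (\<tau> * (8 * K\<^sup>2 * \<tau>))"
    using g S \<tau> by (intro add_mono mult_mono) auto
  finally show ?thesis by (simp add: power2_eq_square algebra_simps)
qed

text \<open>The constant \<open>16 K\<^sup>2\<close> is twice the bound on the differences of \<open>F\<close>, because the symmetric
  difference runs over a time interval of length \<open>2 s\<close>.\<close>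

theorem mode_error_bound:
  assumes n: "real n * \<tau> \<le> T"
  shows "norm2 (modes N) (err n) \<le>
    (2 * (8 * K\<^sup>2 * \<tau>\<^sup>2 + 2 * K * H) + 4 * (16 * K\<^sup>2) * (1 + T0) * \<tau>\<^sup>2 + 4 * T0 * (2 * K) * H) * exp (4 * (2 * K) * T0)"
proof -
  define f where "f j t = mode_coeff a b (F t) j" for j t
  define g where "g k j = f j (real k * \<tau>) - mode_coeff a b (GW k) j" for k j
  define d where "d k j s = f j (real k * \<tau> + s) - f j (real k * \<tau> - s)" for k j s
  define C where "C k j = integral {0..\<tau>} (\<lambda>s. of_real (cos ((\<tau> - s) * lam j))
      * (f j (real k * \<tau> + s) + f j (real k * \<tau> - s) - 2 * f j (real k * \<tau>)))" for k j
  have in_range: "real k * \<tau> \<le> T" if "k \<le> n" for k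
  proof -
    have "real k * \<tau> \<le> real n * \<tau>" using that \<tau> by (intro mult_right_mono) auto
    then show ?thesis using n by linarith
  qed
  have step: "\<tau> \<le> real (Suc k) * \<tau>" "real (Suc k) * \<tau> + \<tau> \<le> T" if "Suc (Suc k) \<le> n" for k
    using in_range[OF that] \<tau> by (auto simp: algebra_simps)
  have fc: "continuous_on {0..T} (f j)" if "j \<in> modes N" for j
    unfolding f_def using continuous_on_mode_coeff[OF ab dF that] .
  have fcs: "continuous_on {0..\<tau>} (\<lambda>s. f j (real (Suc k) * \<tau> + s))" "continuous_on {0..\<tau>} (\<lambda>s. f j (real (Suc k) * \<tau> - s))"
    if "Suc (Suc k) \<le> n" "j \<in> modes N" for k j
  proof -
    have "real (Suc k) * \<tau> + s \<in> {0..T}" "real (Suc k) * \<tau> - s \<in> {0..T}" if "s \<in> {0..\<tau>}" for s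
      using step[OF \<open>Suc (Suc k) \<le> n\<close>] that \<tau> unfolding atLeastAtMost_iff by linarith+
    then show "continuous_on {0..\<tau>} (\<lambda>s. f j (real (Suc k) * \<tau> + s))" "continuous_on {0..\<tau>} (\<lambda>s. f j (real (Suc k) * \<tau> - s))"
      by (intro continuous_on_compose2[OF fc[OF that(2)]] continuous_intros; blast)+
  qed
  have H0: "0 \<le> H" using K_nonneg h_pos by simp
  show ?thesis
  proof (rule two_step_error_bound[where J="modes N" and e=err and C=C and g=g and d=d and lam=lam and M=n and n=n and \<tau>=\<tau> and \<epsilon>=\<epsilon>])
    show "err 0 j = 0" if "j \<in> modes N" for j using that by (simp add: err_def W_0)
    show "err (Suc (Suc k)) j = err k j - 2 * \<i> * of_real (sin (\<tau> * lam j)) * err (Suc k) j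
        - \<i> * of_real \<epsilon> * (C (Suc k) j - \<i> * integral {0..\<tau>} (\<lambda>s. of_real (sin ((\<tau> - s) * lam j)) * d (Suc k) j s)
            + of_real (2 * sin (\<tau> * lam j) / lam j) * g (Suc k) j)"
      if k: "Suc (Suc k) \<le> n" and j: "j \<in> modes N" for k j
    proof -
      have t: "real (Suc (Suc k)) * \<tau> = real (Suc k) * \<tau> + \<tau>" "real k * \<tau> = real (Suc k) * \<tau> - \<tau>"
        by (simp_all add: algebra_simps)
      have "mode_coeff a b (\<Phi> (real (Suc (Suc k)) * \<tau>)) j = mode_coeff a b (\<Phi> (real k * \<tau>)) j - 2 * \<i> * of_real (sin (\<tau> * lam j)) * mode_coeff a b (\<Phi> (real (Suc k) * \<tau>)) j
        - \<i> * of_real \<epsilon> * (C (Suc k) j - \<i> * integral {0..\<tau>} (\<lambda>s. of_real (sin ((\<tau> - s) * lam j)) * d (Suc k) j s)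
            + of_real (2 * sin (\<tau> * lam j) / lam j) * f j (real (Suc k) * \<tau>))"
        unfolding t C_def d_def f_def using lam_bounds(1) \<tau> step[OF k]
        by (intro two_step_identity[OF continuous_on_mode_coeff[OF ab dP j] continuous_on_mode_coeff[OF ab dF j] mode_ode[OF j]]) auto
      then show ?thesis
        unfolding err_def W_rec[OF j] g_def by (simp add: algebra_simps)
    qed
    show "continuous_on {0..\<tau>} (d (Suc k) j)" if "Suc (Suc k) \<le> n" "j \<in> modes N" for k j
      unfolding d_def by (intro continuous_intros fcs that)
    show "norm2 (modes N) (C (Suc k)) \<le> 16 * K\<^sup>2 * \<tau> ^ 3" if k: "Suc (Suc k) \<le> n" for k
    proof -
      have "norm2 (modes N) (C (Suc k)) \<le> \<tau> * (8 * K\<^sup>2 * \<tau>\<^sup>2)"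
        unfolding C_def
      proof (rule norm2_integral_le[OF finite_modes])
        show "0 \<le> \<tau>" using \<tau> by simp
        show "continuous_on {0..\<tau>} (\<lambda>s. f j (real (Suc k) * \<tau> + s) + f j (real (Suc k) * \<tau> - s) - 2 * f j (real (Suc k) * \<tau>))"
          if "j \<in> modes N" for j by (intro continuous_intros fcs k that)
        show "continuous_on {0..\<tau>} (\<lambda>s. complex_of_real (cos ((\<tau> - s) * lam j)))" for j by (intro continuous_intros)
        show "cmod (complex_of_real (cos ((\<tau> - s) * lam j))) \<le> 1" for j s by simp
        fix s assume s: "s \<in> {0..\<tau>}"
        \<comment> \<open>The symmetric second difference, based at the left end point \<open>t\<^sub>n - s\<close> with both increments \<open>s\<close>.\<close>
        let ?t = "real (Suc k) * \<tau> - s"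
        have "norm2 (modes N) (\<lambda>j. f j (?t + s + s) - f j (?t + s) - f j (?t + s) + f j ?t) \<le> 8 * K\<^sup>2 * s * s"
          unfolding f_def using s step[OF k] unfolding atLeastAtMost_iff by (intro second_diff_F; linarith)
        also have "(\<lambda>j. f j (?t + s + s) - f j (?t + s) - f j (?t + s) + f j ?t)
            = (\<lambda>j. f j (real (Suc k) * \<tau> + s) + f j ?t - 2 * f j (real (Suc k) * \<tau>))"
          by (simp add: fun_eq_iff)
        also have "8 * K\<^sup>2 * s * s \<le> 8 * K\<^sup>2 * \<tau> * \<tau>" using s \<tau> by (intro mult_mono) auto
        finally show "norm2 (modes N) (\<lambda>j. f j (real (Suc k) * \<tau> + s) + f j ?t - 2 * f j (real (Suc k) * \<tau>)) \<le> 8 * K\<^sup>2 * \<tau>\<^sup>2"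
          by (simp add: power2_eq_square mult.assoc)
      qed
      also have "\<dots> = 8 * (K\<^sup>2 * \<tau> ^ 3)" by (simp add: power3_eq_cube power2_eq_square)
      also have "\<dots> \<le> 16 * (K\<^sup>2 * \<tau> ^ 3)" using \<tau> by (intro mult_right_mono) auto
      finally show ?thesis by (simp add: mult.assoc)
    qed
    show "norm2 (modes N) (\<lambda>j. d (Suc k) j s) \<le> 16 * K\<^sup>2 * \<tau>" if k: "Suc (Suc k) \<le> n" and s: "s \<in> {0..\<tau>}" for k s
    proof -
      let ?t = "real (Suc k) * \<tau> - s"
      have "norm2 (modes N) (\<lambda>j. f j (?t + 2 * s) - f j ?t) \<le> 8 * K\<^sup>2 * (2 * s)"
        unfolding f_def using s step[OF k] unfolding atLeastAtMost_iff by (intro first_diff_F; linarith)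
      also have "(\<lambda>j. f j (?t + 2 * s) - f j ?t) = (\<lambda>j. d (Suc k) j s)" by (simp add: d_def fun_eq_iff algebra_simps)
      also have "8 * K\<^sup>2 * (2 * s) \<le> 8 * K\<^sup>2 * (2 * \<tau>)" using s by (intro mult_left_mono) auto
      finally show ?thesis by simp
    qed
    show "norm2 (modes N) (\<lambda>j. d (Suc (Suc k)) j s - d (Suc k) j s) \<le> 16 * K\<^sup>2 * \<tau>\<^sup>2"
      if k: "Suc (Suc (Suc k)) \<le> n" and s: "s \<in> {0..\<tau>}" for k s
    proof -
      let ?t = "real (Suc k) * \<tau> - s"
      \<comment> \<open>The mixed second difference with increments \<open>2 s\<close> and \<open>\<tau>\<close>.\<close>
      have e: "real (Suc (Suc k)) * \<tau> = real (Suc k) * \<tau> + \<tau>" by (simp add: algebra_simps)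
      have "norm2 (modes N) (\<lambda>j. f j (?t + 2 * s + \<tau>) - f j (?t + 2 * s) - f j (?t + \<tau>) + f j ?t) \<le> 8 * K\<^sup>2 * (2 * s) * \<tau>"
        unfolding f_def using s step(1)[OF Suc_leD[OF k]] step(2)[OF k] \<tau> unfolding atLeastAtMost_iff e by (intro second_diff_F; linarith)
      also have "(\<lambda>j. f j (?t + 2 * s + \<tau>) - f j (?t + 2 * s) - f j (?t + \<tau>) + f j ?t) = (\<lambda>j. d (Suc (Suc k)) j s - d (Suc k) j s)"
        unfolding d_def e by (simp add: fun_eq_iff algebra_simps)
      also have "8 * K\<^sup>2 * (2 * s) * \<tau> \<le> 8 * K\<^sup>2 * (2 * \<tau>) * \<tau>" using s \<tau> by (intro mult_right_mono mult_left_mono) auto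
      finally show ?thesis by (simp add: power2_eq_square algebra_simps)
    qed
    show "norm2 (modes N) (g (Suc k)) \<le> 2 * K * (H + norm2 (modes N) (err (Suc k)))" if k: "Suc (Suc k) \<le> n" for k
      unfolding g_def f_def using in_range[of "Suc k"] k \<tau> by (intro forcing_error) auto
    show "norm2 (modes N) (err 1) \<le> 8 * K\<^sup>2 * \<tau>\<^sup>2 + 2 * K * H" if "n \<ge> 1"
      using in_range[OF that] by (intro mode_error_first_step) simp
    have "\<epsilon> * (real n * \<tau>) \<le> \<epsilon> * T" using n eps by (intro mult_left_mono) auto
    then show "real n * (\<epsilon> * \<tau>) \<le> T0" using T eps by (simp add: algebra_simps)
  qed (use finite_modes \<tau> eps lam_bounds K_nonneg T H0 in auto)
qed

lemma solution_error:
  assumes n: "real n * \<tau> \<le> T"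
  shows "L2_le (Om a b) (((16 * K\<^sup>2 + 64 * K\<^sup>2 * (1 + T0) + 8 * K\<^sup>2 + 16 * T0 * K\<^sup>2) * exp (8 * K * T0) + 2 * K) * (h ^ m0 + \<tau>\<^sup>2))
    (\<lambda>x. \<Phi> (real n * \<tau>) x - sEWI_FS a b N \<tau> \<epsilon> V A1 \<Phi>0 n x)"
proof -
  define E where "E = exp (8 * K * T0)"
  define \<delta> where "\<delta> = h ^ m0"
  have nn: "0 \<le> \<delta>" "0 \<le> E" "0 \<le> K" "0 \<le> T0" using h_pos K_nonneg T by (auto simp: \<delta>_def E_def)
  have "norm2 (modes N) (err n) \<le> ((16 * K\<^sup>2 + 64 * K\<^sup>2 * (1 + T0)) * \<tau>\<^sup>2 + (8 * K\<^sup>2 + 16 * T0 * K\<^sup>2) * \<delta>) * E"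
    using mode_error_bound[OF n] unfolding E_def \<delta>_def by (simp add: power2_eq_square algebra_simps)
  also have "\<dots> \<le> ((16 * K\<^sup>2 + 64 * K\<^sup>2 * (1 + T0)) * (\<delta> + \<tau>\<^sup>2) + (8 * K\<^sup>2 + 16 * T0 * K\<^sup>2) * (\<delta> + \<tau>\<^sup>2)) * E"
    using nn by (intro mult_right_mono add_mono mult_left_mono) auto
  finally have "H + norm2 (modes N) (err n)
      \<le> 2 * K * (\<delta> + \<tau>\<^sup>2) + ((16 * K\<^sup>2 + 64 * K\<^sup>2 * (1 + T0)) * (\<delta> + \<tau>\<^sup>2) + (8 * K\<^sup>2 + 16 * T0 * K\<^sup>2) * (\<delta> + \<tau>\<^sup>2)) * E"
    using nn unfolding \<delta>_def[symmetric] by (intro add_mono mult_left_mono) auto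
  also have "\<dots> = ((16 * K\<^sup>2 + 64 * K\<^sup>2 * (1 + T0) + 8 * K\<^sup>2 + 16 * T0 * K\<^sup>2) * E + 2 * K) * (\<delta> + \<tau>\<^sup>2)"
    by (simp add: algebra_simps)
  finally have le: "H + norm2 (modes N) (err n) \<le> \<dots>" .
  have "real n * \<tau> \<in> {0..T}" using n \<tau> by simp
  from L2_le_mono[OF full_error_le[OF this] le] show ?thesis unfolding W_def E_def \<delta>_def .
qed

end

section \<open>Bounds uniform in \<open>\<epsilon>\<close> and the convergence theorem\<close>

lemma esssup_nonneg:
  fixes f :: "'a \<Rightarrow> ereal"
  assumes "emeasure M (space M) \<noteq> 0" and "\<And>x. 0 \<le> f x"
  shows "0 \<le> esssup M f"
proof (rule ccontr)
  assume "\<not> 0 \<le> esssup M f"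
  then have "AE x in M. False"
    using esssup_AE[of f M] by (auto elim!: eventually_mono dest: order_trans[OF assms(2)])
  then show False using assms(1) by (simp add: eventually_False ae_filter_eq_bot_iff)
qed

lemma Linf_time_AE: "Linf_time T X u \<le> ereal K \<Longrightarrow> AE t in Om 0 T. X (u t) \<le> ereal K"
proof -
  assume le: "Linf_time T X u \<le> ereal K"
  have "AE t in restrict_space lborel {0..T}. X (u t) \<le> ereal K"
    using esssup_AE[of "\<lambda>t. X (u t)" "restrict_space lborel {0..T}"] le unfolding Linf_time_def
    by (auto elim!: eventually_mono)
  then show ?thesis unfolding AE_Om by (subst (asm) AE_restrict_space_iff) (auto elim!: eventually_mono)
qed

lemma Linf_norm_imp_Linf_le:
  assumes "Linf_norm a b u \<le> ereal K" "u \<in> borel_measurable (Om a b)" "0 \<le> K"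
  shows "Linf_le (Om a b) K u"
proof -
  have "AE x in Om a b. ereal (norm (u x)) \<le> Linf_norm a b u"
    unfolding Linf_norm_def Om_def by (rule esssup_AE)
  then have "AE x in Om a b. norm (u x) \<le> K"
    by eventually_elim (use assms(1) in \<open>metis ereal_less_eq(3) order_trans\<close>)
  then show ?thesis using assms by (simp add: Linf_le_def)
qed

lemma has_time_deriv_measurable:
  assumes "has_time_deriv T a b u v"
  shows "AE t in Om 0 T. u t \<in> borel_measurable (Om a b)" "AE t in Om 0 T. v t \<in> borel_measurable (Om a b)"
proof -
  interpret pair_sigma_finite "Om 0 T" "Om a b" by (rule pair_sigma_finite_Om)
  have "integrable (Om 0 T \<Otimes>\<^sub>M Om a b) (\<lambda>(r, x). u r x)" "integrable (Om 0 T \<Otimes>\<^sub>M Om a b) (\<lambda>(r, x). v r x)"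
    using assms unfolding has_time_deriv_def integrable_pair_Om by simp_all
  note ae = this[THEN AE_integrable_fst]
  show "AE t in Om 0 T. u t \<in> borel_measurable (Om a b)" "AE t in Om 0 T. v t \<in> borel_measurable (Om a b)"
    using ae by (eventually_elim, simp)+
qed

text \<open>Serves to bound each potential by the sum of the two norms.  The intervals have to be nontrivial:
  over a null set the essential supremum of any function is \<open>- \<infinity>\<close>.\<close>

lemma W2inf_norm_nonneg:
  assumes "a < b" "0 < T"
  shows "0 \<le> W2inf_norm T a b V"
proof -
  have x: "0 \<le> Linf_norm a b u" for u :: "real \<Rightarrow> real"
    unfolding Linf_norm_def using assms
    by (intro esssup_nonneg) (auto simp: space_restrict_space emeasure_restrict_space)
  have "0 \<le> Linf_time T (Linf_norm a b) u" for u :: "real \<Rightarrow> real \<Rightarrow> real"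
    unfolding Linf_time_def using assms x
    by (intro esssup_nonneg) (auto simp: space_restrict_space emeasure_restrict_space)
  then show ?thesis unfolding W2inf_norm_def by (auto intro!: INF_greatest simp: le_max_iff_disj)
qed

lemma W2inf_norm_diffs_le:
  assumes "0 < T" "0 \<le> M" and V: "W2inf_norm T a b V \<le> ereal M"
  shows "diffs_le T (Linf_le (Om a b)) (2 * (M + 1)) V"
proof -
  have "W2inf_norm T a b V < ereal (M + 1)" by (rule le_less_trans[OF V]) simp
  then obtain V' V'' where D: "has_time_deriv T a b V V'" "has_time_deriv T a b V' V''"
    and "Linf_time T (Linf_norm a b) V < ereal (M + 1)" "Linf_time T (Linf_norm a b) V' < ereal (M + 1)"
      "Linf_time T (Linf_norm a b) V'' < ereal (M + 1)"
    unfolding W2inf_norm_def by (auto simp: INF_less_iff)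
  then have "Linf_time T (Linf_norm a b) V \<le> ereal (M + 1)" "Linf_time T (Linf_norm a b) V' \<le> ereal (M + 1)"
      "Linf_time T (Linf_norm a b) V'' \<le> ereal (M + 1)" by auto
  note ae = this[THEN Linf_time_AE]
  have "AE t in Om 0 T. Linf_le (Om a b) (M + 1) (V t)"
    using ae(1) has_time_deriv_measurable(1)[OF D(1)]
    by eventually_elim (use \<open>0 \<le> M\<close> in \<open>auto intro: Linf_norm_imp_Linf_le\<close>)
  moreover have "AE t in Om 0 T. Linf_le (Om a b) (M + 1) (V' t)"
    using ae(2) has_time_deriv_measurable(2)[OF D(1)]
    by eventually_elim (use \<open>0 \<le> M\<close> in \<open>auto intro: Linf_norm_imp_Linf_le\<close>)
  moreover have "AE t in Om 0 T. Linf_le (Om a b) (M + 1) (V'' t)"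
    using ae(3) has_time_deriv_measurable(2)[OF D(2)]
    by eventually_elim (use \<open>0 \<le> M\<close> in \<open>auto intro: Linf_norm_imp_Linf_le\<close>)
  ultimately show ?thesis
    using \<open>0 < T\<close> \<open>0 \<le> M\<close> by (intro size_bound.diffs_le_of_derivs[OF size_bound_Linf D]) auto
qed

lemma Hp_norm_leD:
  fixes u :: "real \<Rightarrow> 'v::{banach, second_countable_topology}"
  assumes "Hp_norm a b k u \<le> ereal M"
  shows "\<exists>D. Hp_derivs a b k u D \<and> (\<forall>l\<le>k. L2_le (Om a b) (\<bar>M\<bar> + 1) (D l))"
proof -
  have "Hp_norm a b k u < ereal (\<bar>M\<bar> + 1)" by (rule le_less_trans[OF assms]) simp
  then obtain D where D: "Hp_derivs a b k u D"
    and lt: "sqrt (\<Sum>l\<le>k. LINT x:{a<..<b}|lborel. (norm (D l x))\<^sup>2) < \<bar>M\<bar> + 1"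
    unfolding Hp_norm_def by (auto simp: INF_less_iff)
  have nn: "0 \<le> (LINT x:{a<..<b}|lborel. (norm (D l x))\<^sup>2)" for l
    unfolding integral_Om[symmetric] by (rule Bochner_Integration.integral_nonneg) simp
  have "L2_le (Om a b) (\<bar>M\<bar> + 1) (D l)" if "l \<le> k" for l
  proof -
    have "L2_norm a b (D l) < \<infinity>" using D that by (simp add: Hp_derivs_def)
    then have n: "L2_norm a b (D l) = ereal (sqrt (LINT x:{a<..<b}|lborel. (norm (D l x))\<^sup>2))"
      unfolding L2_norm_def by (simp split: if_splits)
    have "(LINT x:{a<..<b}|lborel. (norm (D l x))\<^sup>2) \<le> (\<Sum>l\<le>k. LINT x:{a<..<b}|lborel. (norm (D l x))\<^sup>2)"
      by (rule member_le_sum[where f="\<lambda>l. LINT x:{a<..<b}|lborel. (norm (D l x))\<^sup>2"]) (use that nn in auto)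
    then have "sqrt (LINT x:{a<..<b}|lborel. (norm (D l x))\<^sup>2) \<le> sqrt (\<Sum>l\<le>k. LINT x:{a<..<b}|lborel. (norm (D l x))\<^sup>2)"
      by (rule real_sqrt_le_mono)
    then have "L2_norm a b (D l) \<le> ereal (\<bar>M\<bar> + 1)" using lt unfolding n by (simp del: real_sqrt_le_iff)
    then show ?thesis using L2_norm_le_iff[of "\<bar>M\<bar> + 1" a b "D l"] by simp
  qed
  with D show ?thesis by (intro exI[of _ D] conjI allI impI)
qed

text \<open>From \<open>\<bar>\<mu>\<^sub>l\<bar> \<le> \<pi> / h\<close> for \<open>l \<in> \<T>\<^sub>N\<close> we get \<open>\<delta>\<^sub>l \<le> \<surd>(h\<^sup>2 + \<pi>\<^sup>2) / h\<close>, which is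
  the reciprocal of the first bound in the stability condition up to the factor \<open>\<pi> / 3\<close>.\<close>

lemma stability_bound_imp:
  assumes "a < b" "even N" "N > 0" and h: "h = (b - a) / real N" and "0 < \<tau>"
    and s: "ereal \<tau> < stability_bound h V0 A0" and l: "l \<in> T_idx N"
  shows "\<tau> * delta (freq a b l) \<le> pi / 3"
proof -
  have h0: "0 < h" using assms by simp
  define r where "r = sqrt (h\<^sup>2 + pi\<^sup>2)"
  have r: "0 < r" unfolding r_def using h0 by (simp add: add_pos_pos)
  have "\<bar>freq a b l\<bar> \<le> pi / h" using freq_inside_T_idx[OF assms(1-3) l] h by simp
  then have "(freq a b l)\<^sup>2 \<le> (pi / h)\<^sup>2" using h0 by (simp add: abs_le_square_iff[symmetric])
  then have "delta (freq a b l) \<le> sqrt (1 + (pi / h)\<^sup>2)" by (simp add: delta_def)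
  also have "1 + (pi / h)\<^sup>2 = (h\<^sup>2 + pi\<^sup>2) / h\<^sup>2" using h0 by (simp add: power_divide add_divide_distrib)
  also have "sqrt \<dots> = r / h" using h0 by (simp add: r_def real_sqrt_divide)
  finally have d: "delta (freq a b l) \<le> r / h" .
  have "ereal \<tau> < ereal (h * pi / (3 * r))" using s unfolding stability_bound_def r_def by simp
  then have "\<tau> \<le> h * pi / (3 * r)" by simp
  then have "\<tau> * delta (freq a b l) \<le> (h * pi / (3 * r)) * (r / h)"
    using d h0 r \<open>0 < \<tau>\<close> delta_facts(1)[of "freq a b l"] by (intro mult_mono) auto
  also have "\<dots> = pi / 3" using h0 r by simp
  finally show ?thesis .
qed

theorem theorem3p2:
  fixes a b T0 V0 A0 :: real and m0 :: nat
    and V A1 :: "real \<Rightarrow> real \<Rightarrow> real"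
    and \<Phi>0 :: "real \<Rightarrow> complex^2"
    and \<Phi> \<Phi>t \<Phi>tt :: "real \<Rightarrow> real \<Rightarrow> real \<Rightarrow> complex^2"
  assumes "a < b" and "T0 > 0"
    and "periodic_bc a b \<Phi>0"
    and "\<And>\<epsilon>. \<epsilon> \<in> {0<..1} \<Longrightarrow> dirac_solution (T0 / \<epsilon>) a b \<epsilon> V A1 \<Phi>0 (\<Phi> \<epsilon>) (\<Phi>t \<epsilon>)"
    and "\<And>\<epsilon>. \<epsilon> \<in> {0<..1} \<Longrightarrow> has_time_deriv (T0 / \<epsilon>) a b (\<Phi>t \<epsilon>) (\<Phi>tt \<epsilon>)"
    and "m0 \<ge> 2"
    and "\<exists>M::real. \<forall>\<epsilon>\<in>{0<..1}. Linf_time (T0 / \<epsilon>) (Hp_norm a b m0) (\<Phi> \<epsilon>) \<le> ereal M"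
    and "\<exists>M::real. \<forall>\<epsilon>\<in>{0<..1}. Linf_time (T0 / \<epsilon>) (L2_norm a b) (\<Phi>t \<epsilon>) \<le> ereal M"
    and "\<exists>M::real. \<forall>\<epsilon>\<in>{0<..1}. Linf_time (T0 / \<epsilon>) (L2_norm a b) (\<Phi>tt \<epsilon>) \<le> ereal M"
    and "\<exists>M::real. \<forall>\<epsilon>\<in>{0<..1}.
           W2inf_norm (T0 / \<epsilon>) a b V + W2inf_norm (T0 / \<epsilon>) a b A1 \<le> ereal M"
  shows "\<exists>\<tau>0>0. \<exists>C>0. \<forall>\<epsilon>\<in>{0<..1}. \<forall>N h \<tau>.
           even N \<longrightarrow> N > 0 \<longrightarrow> h = (b - a) / real N \<longrightarrow>
           0 < \<tau> \<longrightarrow> ereal \<tau> < stability_bound h V0 A0 \<longrightarrow> \<tau> \<le> \<tau>0 \<longrightarrow>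
           (\<forall>n. real n \<le> T0 / \<epsilon> / \<tau> \<longrightarrow>
              L2_norm a b (\<lambda>x. \<Phi> \<epsilon> (real n * \<tau>) x - sEWI_FS a b N \<tau> \<epsilon> V A1 \<Phi>0 n x)
                \<le> ereal (C * (h ^ m0 + \<tau>\<^sup>2)))"
proof -
  obtain M1 M2 M3 M4 where
    M1: "\<And>\<epsilon>. \<epsilon> \<in> {0<..1} \<Longrightarrow> Linf_time (T0 / \<epsilon>) (Hp_norm a b m0) (\<Phi> \<epsilon>) \<le> ereal M1" and
    M2: "\<And>\<epsilon>. \<epsilon> \<in> {0<..1} \<Longrightarrow> Linf_time (T0 / \<epsilon>) (L2_norm a b) (\<Phi>t \<epsilon>) \<le> ereal M2" and
    M3: "\<And>\<epsilon>. \<epsilon> \<in> {0<..1} \<Longrightarrow> Linf_time (T0 / \<epsilon>) (L2_norm a b) (\<Phi>tt \<epsilon>) \<le> ereal M3" and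
    M4: "\<And>\<epsilon>. \<epsilon> \<in> {0<..1} \<Longrightarrow> W2inf_norm (T0 / \<epsilon>) a b V + W2inf_norm (T0 / \<epsilon>) a b A1 \<le> ereal M4"
    using assms(7-10) by metis
  define M where "M = \<bar>M1\<bar> + \<bar>M2\<bar> + \<bar>M3\<bar> + \<bar>M4\<bar>"
  define K where "K = 2 * (M + 1)"
  have M: "0 \<le> M" "\<bar>M1\<bar> \<le> M" "M2 \<le> M" "M3 \<le> M" "M4 \<le> M" by (auto simp: M_def)
  have K: "0 \<le> K" "M + 1 \<le> K" using M by (auto simp: K_def)
  define C where "C = (16 * K\<^sup>2 + 64 * K\<^sup>2 * (1 + T0) + 8 * K\<^sup>2 + 16 * T0 * K\<^sup>2) * exp (8 * K * T0) + 2 * K"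
  have C: "0 < C" unfolding C_def using \<open>T0 > 0\<close> K M by (intro add_nonneg_pos mult_nonneg_nonneg add_nonneg_nonneg) auto
  have main: "L2_norm a b (\<lambda>x. \<Phi> \<epsilon> (real n * \<tau>) x - sEWI_FS a b N \<tau> \<epsilon> V A1 \<Phi>0 n x) \<le> ereal (C * (h ^ m0 + \<tau>\<^sup>2))"
    if \<epsilon>: "\<epsilon> \<in> {0<..1}" and N: "even N" "N > 0" and h: "h = (b - a) / real N"
      and \<tau>: "0 < \<tau>" "ereal \<tau> < stability_bound h V0 A0" "\<tau> \<le> 1" and n: "real n \<le> T0 / \<epsilon> / \<tau>"
    for \<epsilon> N h \<tau> n
  proof -
    define T where "T = T0 / \<epsilon>"
    have T: "0 < T" using \<epsilon> \<open>T0 > 0\<close> by (simp add: T_def)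
    have sol: "dirac_solution T a b \<epsilon> V A1 \<Phi>0 (\<Phi> \<epsilon>) (\<Phi>t \<epsilon>)" unfolding T_def using assms(4) \<epsilon> .
    have D1: "has_time_deriv T a b (\<Phi> \<epsilon>) (\<Phi>t \<epsilon>)" using sol by (simp add: dirac_solution_def)
    have D2: "has_time_deriv T a b (\<Phi>t \<epsilon>) (\<Phi>tt \<epsilon>)" unfolding T_def using assms(5) \<epsilon> .
    have W: "W2inf_norm T a b V \<le> ereal M" "W2inf_norm T a b A1 \<le> ereal M"
    proof -
      have s: "W2inf_norm T a b V + W2inf_norm T a b A1 \<le> ereal M"
        using M4[OF \<epsilon>] M(5) unfolding T_def by (metis ereal_less_eq(3) order_trans)
      have nn: "0 \<le> W2inf_norm T a b V" "0 \<le> W2inf_norm T a b A1"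
        using W2inf_norm_nonneg[OF \<open>a < b\<close> T] by auto
      show "W2inf_norm T a b V \<le> ereal M"
        by (rule order_trans[OF _ s]) (use add_left_mono[OF nn(2), of "W2inf_norm T a b V"] in simp)
      show "W2inf_norm T a b A1 \<le> ereal M"
        by (rule order_trans[OF _ s]) (use add_right_mono[OF nn(1), of "W2inf_norm T a b A1"] in simp)
    qed
    have reg: "AE t in Om 0 T. \<exists>D. Hp_derivs a b m0 (\<Phi> \<epsilon> t) D \<and> (\<forall>l\<le>m0. L2_le (Om a b) (M + 1) (D l))"
      using Linf_time_AE[OF M1[OF \<epsilon>]] unfolding T_def[symmetric]
    proof eventually_elim
      case (elim t)
      then obtain D where "Hp_derivs a b m0 (\<Phi> \<epsilon> t) D" "\<forall>l\<le>m0. L2_le (Om a b) (\<bar>M1\<bar> + 1) (D l)"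
        using Hp_norm_leD by blast
      then show ?case using M(2) by (intro exI[of _ D]) (auto intro: L2_le_mono)
    qed
    have B0: "AE t in Om 0 T. L2_le (Om a b) (M + 1) (\<Phi> \<epsilon> t)"
      using reg by eventually_elim (auto simp: Hp_derivs_def)
    have B12: "AE t in Om 0 T. L2_le (Om a b) (M + 1) (\<Phi>t \<epsilon> t)" "AE t in Om 0 T. L2_le (Om a b) (M + 1) (\<Phi>tt \<epsilon> t)"
    proof -
      have "AE t in Om 0 T. L2_norm a b (\<Phi>t \<epsilon> t) \<le> ereal M2" "AE t in Om 0 T. L2_norm a b (\<Phi>tt \<epsilon> t) \<le> ereal M3"
        unfolding T_def by (rule Linf_time_AE M2 M3 \<epsilon>)+
      note ae = this
      have "AE t in Om 0 T. L2_norm a b (\<Phi>t \<epsilon> t) \<le> ereal (M + 1)"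
        using ae(1) by eventually_elim (erule order_trans, use M in simp)
      moreover have "AE t in Om 0 T. L2_norm a b (\<Phi>tt \<epsilon> t) \<le> ereal (M + 1)"
        using ae(2) by eventually_elim (erule order_trans, use M in simp)
      ultimately show "AE t in Om 0 T. L2_le (Om a b) (M + 1) (\<Phi>t \<epsilon> t)" "AE t in Om 0 T. L2_le (Om a b) (M + 1) (\<Phi>tt \<epsilon> t)"
        using M(1) by (simp_all add: L2_norm_le_iff)
    qed
    interpret dirac_problem a b T T0 \<epsilon> K V A1 \<Phi>0 "\<Phi> \<epsilon>" "\<Phi>t \<epsilon>" m0 N h \<tau>
    proof
      show "diffs_le T (L2_le (Om a b)) K (\<Phi> \<epsilon>)"
        unfolding K_def using B0 B12 M(1) T by (intro size_bound.diffs_le_of_derivs[OF size_bound_L2 D1 D2]) auto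
      show "diffs_le T (Linf_le (Om a b)) K V" "diffs_le T (Linf_le (Om a b)) K A1"
        unfolding K_def using W M(1) T by (intro W2inf_norm_diffs_le; simp)+
      show "AE t in Om 0 T. \<exists>D. Hp_derivs a b m0 (\<Phi> \<epsilon> t) D \<and> L2_le (Om a b) K (D m0)"
        using reg K(2) by (auto elim!: eventually_mono intro: L2_le_mono)
      show "integrable (Om a b) \<Phi>0"
        using assms(3) unfolding periodic_bc_def has_weak_deriv_def integrable_Om by blast
      show "\<tau> * delta (freq a b l) \<le> pi / 3" if "l \<in> T_idx N" for l
        by (rule stability_bound_imp[OF \<open>a < b\<close> N h \<tau>(1,2) that])
    qed (use assms(1,2,6) \<epsilon> sol N h \<tau> in \<open>auto simp: T_def\<close>)
    have "real n * \<tau> \<le> T" using n \<tau>(1) unfolding T_def[symmetric] by (simp add: pos_le_divide_eq)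
    from solution_error[OF this] have "L2_le (Om a b) (C * (h ^ m0 + \<tau>\<^sup>2)) (\<lambda>x. \<Phi> \<epsilon> (real n * \<tau>) x - sEWI_FS a b N \<tau> \<epsilon> V A1 \<Phi>0 n x)"
      unfolding C_def .
    moreover have "0 \<le> C * (h ^ m0 + \<tau>\<^sup>2)" using C h_pos by simp
    ultimately show ?thesis using L2_norm_le_iff by blast
  qed
  show ?thesis
    \<comment> \<open>The threshold \<open>\<tau>\<^sub>0 = 1\<close> absorbs one factor \<open>\<tau>\<close> in the first step.\<close>
    using main C by (intro exI[of _ 1] exI[of _ C] conjI ballI allI impI) simp_all
qed

end
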